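(* Let $0<\alpha\le\tfrac12$, $\rho>0$, $k\in\mathbb{N}$, $\lambda_1,\dots,\lambda_k>0$, $\Lambda=\lambda_1+\dots+\lambda_k$. Let $M$ be the generalized counting process with parameters $\lambda_1,\dots,\lambda_k$, independent of the inverse process $\mathcal{L}^{\alpha,\rho}$ of the sum $H_1^{2\alpha,\rho}(t)+H_2^{\alpha,\rho}(t)$ of independent tempered stable subordinators. Then the probabilities $\tilde p_n^{\alpha,\rho}(t)=\mathsf{P}\{M(\mathcal{L}^{\alpha,\rho}(t))=n\}$ satisfy $$\left(\mathcal{D}_t^{2\alpha,\rho}+\mathcal{D}_t^{\alpha,\rho}\right)\tilde p_n^{\alpha,\rho}(t)=-\Lambda\tilde p_n^{\alpha,\rho}(t)+\sum_{j=1}^{\min\{n,k\}}\lambda_j\tilde p_{n-j}^{\alpha,\rho}(t),\quad n\ge0,$$ with $\tilde p_0^{\alpha,\rho}(0)=1$, $\tilde p_n^{\alpha,\rho}(0)=0$ for $n\ge1$; and the probability generating function $\tilde G_{\alpha,\rho}(u,t)=\sum_{n=0}^\infty u^n\tilde p_n^{\alpha,\rho}(t)$, $|u|\le1$, solves $$\left(\mathcal{D}_t^{2\alpha,\rho}+\mathcal{D}_t^{\alpha,\rho}\right)\tilde G_{\alpha,\rho}(u,t)=-\sum_{j=1}^k\lambda_j(1-u^j)\,\tilde G_{\alpha,\rho}(u,t),\qquad\tilde G_{\alpha,\rho}(u,0)=1,$$ where $\mathcal{D}_t^{2\alpha,\rho}$, $\mathcal{D}_t^{\alpha,\rho}$ are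 the generalized Caputo–Djrbashian derivatives associated with tempered stable subordinators.
   Context: The generalized counting process $M(t)$, $t\ge0$, with parameters $\lambda_1,\dots,\lambda_k>0$ is the counting process ($\mathbb{N}_0$-valued) with $M(0)=0$ a.s., stationary and independent increments, $\mathsf{P}\{M(h)=j\}=\lambda_jh+o(h)$ for $j=1,\dots,k$, and $\mathsf{P}\{M(h)>k\}=o(h)$ as $h\downarrow 0$. For $\beta\in(0,1)$, $\rho>0$, the tempered stable subordinator $H^{\beta,\rho}$ is the nondecreasing Lévy process with $\mathsf{E}e^{-sH^{\beta,\rho}(t)}=e^{-t((s+\rho)^\beta-\rho^\beta)}$, $s>0$; for $\beta=1$ this means $H^{1,\rho}(t)=t$. $H_1^{2\alpha,\rho}$ and $H_2^{\alpha,\rho}$ are independent with parameters $(2\alpha,\rho)$ and $(\alpha,\rho)$, and $$\mathcal{L}^{\alpha,\rho}(t)=\inf\{s>0:H_1^{2\alpha,\rho}(s)+H_2^{\alpha,\rho}(s)\ge t\},\quad t>0,\qquad\mathcal{L}^{\alpha,\rho}(0)=0.$$ The generalized Caputo–Djrbashian derivative is, for $\beta\in(0,1)$, $$\mathcal{D}_t^{\beta,\rho}u(t)=\frac{\beta\rho^\beta}{\Gamma(1-\beta)}\int_0^t\frac{\partial}{\partial t}u(t-s)\,\Gamma(-\beta,\rho s)\,ds,\qquad\Gamma(-\beta,s)=\int_s^\infty e^{-z}z^{-\beta-1}dz,$$ and $\mathcal{D}_t^{1,\rho}=\frac{d}{dt}$. *)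

theory Defs
  imports "HOL-Probability.Probability"
begin

definition stationary_increments :: "'a measure \<Rightarrow> (real \<Rightarrow> 'a \<Rightarrow> real) \<Rightarrow> bool" where
  "stationary_increments P X \<longleftrightarrow>
     (\<forall>s\<ge>0. \<forall>h\<ge>0. distr P borel (\<lambda>\<omega>. X (s + h) \<omega> - X s \<omega>) = distr P borel (\<lambda>\<omega>. X h \<omega> - X 0 \<omega>))"

definition independent_increments :: "'a measure \<Rightarrow> (real \<Rightarrow> 'a \<Rightarrow> real) \<Rightarrow> bool" where
  "independent_increments P X \<longleftrightarrow>
     (\<forall>(n::nat) (\<tau>::nat \<Rightarrow> real). 0 \<le> \<tau> 0 \<and> (\<forall>i<n. \<tau> i < \<tau> (Suc i)) \<longrightarrow>
        prob_space.indep_vars P (\<lambda>_. borel) (\<lambda>i \<omega>. X (\<tau> (Suc i)) \<omega> - X (\<tau> i) \<omega>) {..<n})"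

text \<open>
  Nondecreasing processes with stationary independent increments, time set \<open>[0, \<infinity>)\<close>.
  Path regularity is imposed on every path, so that inverse and time-changed processes are
  measurable without completing \<open>P\<close>. Left limits are automatic by monotonicity, and stochastic
  continuity follows from right-continuity.
\<close>

definition increasing_levy_process :: "'a measure \<Rightarrow> (real \<Rightarrow> 'a \<Rightarrow> real) \<Rightarrow> bool" where
  "increasing_levy_process P X \<longleftrightarrow>
     (\<forall>t\<ge>0. X t \<in> borel_measurable P) \<and>
     (\<forall>\<omega>\<in>space P. mono_on {0..} (\<lambda>t. X t \<omega>)) \<and>
     (\<forall>\<omega>\<in>space P. \<forall>t\<ge>0. continuous (at_right t) (\<lambda>s. X s \<omega>)) \<and>
     (AE \<omega> in P. X 0 \<omega> = 0) \<and>
     stationary_increments P X \<and> independent_increments P X"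

definition generalized_counting_process ::
    "'a measure \<Rightarrow> nat \<Rightarrow> (nat \<Rightarrow> real) \<Rightarrow> (real \<Rightarrow> 'a \<Rightarrow> nat) \<Rightarrow> bool" where
  "generalized_counting_process P k lam M \<longleftrightarrow>
     increasing_levy_process P (\<lambda>t \<omega>. real (M t \<omega>)) \<and>
     (\<forall>j\<in>{1..k}. (\<lambda>h. measure P {\<omega> \<in> space P. M h \<omega> = j} - lam j * h) \<in> o[at_right 0](\<lambda>h. h)) \<and>
     (\<lambda>h. measure P {\<omega> \<in> space P. M h \<omega> > k}) \<in> o[at_right 0](\<lambda>h. h)"

definition tempered_stable_subordinator ::
    "'a measure \<Rightarrow> real \<Rightarrow> real \<Rightarrow> (real \<Rightarrow> 'a \<Rightarrow> real) \<Rightarrow> bool" where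
  "tempered_stable_subordinator P \<beta> \<rho> H \<longleftrightarrow>
     (if \<beta> = 1 then \<forall>t\<ge>0. \<forall>\<omega>\<in>space P. H t \<omega> = t
      else increasing_levy_process P H \<and>
        (\<forall>t\<ge>0. \<forall>s>0. prob_space.expectation P (\<lambda>\<omega>. exp (- s * H t \<omega>))
                       = exp (- t * ((s + \<rho>) powr \<beta> - \<rho> powr \<beta>))))"

text \<open>
  The level \<open>t\<close> is never reached only on a null event. There the infimum would be \<open>\<infinity>\<close>, while
  \<open>Inf {}\<close> is unspecified on \<^typ>\<open>real\<close> (and possibly negative, i.e. outside the time
  set), so the value there is fixed to \<open>0\<close>.
\<close>

definition first_passage :: "(real \<Rightarrow> 'a \<Rightarrow> real) \<Rightarrow> real \<Rightarrow> 'a \<Rightarrow> real" where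
  "first_passage H t \<omega> =
     (if t > 0 \<and> (\<exists>s>0. H s \<omega> \<ge> t) then Inf {s. s > 0 \<and> H s \<omega> \<ge> t} else 0)"

definition independent_processes ::
    "'a measure \<Rightarrow> (real \<Rightarrow> 'a \<Rightarrow> real) \<Rightarrow> (real \<Rightarrow> 'a \<Rightarrow> real) \<Rightarrow> bool" where
  "independent_processes P X Y \<longleftrightarrow>
     prob_space.indep_var P
       (PiM {0..} (\<lambda>_. borel)) (\<lambda>\<omega>. \<lambda>t\<in>{0..}. X t \<omega>)
       (PiM {0..} (\<lambda>_. borel)) (\<lambda>\<omega>. \<lambda>t\<in>{0..}. Y t \<omega>)"

definition upper_incomplete_gamma :: "real \<Rightarrow> real \<Rightarrow> real" where
  "upper_incomplete_gamma a x = (LBINT z:{x..}. exp (- z) * z powr (a - 1))"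

text \<open>
  The operator is total; \<open>tempered_caputo_differentiable\<close> says that the derivatives and the
  integral in it really exist. Values of \<open>u\<close> on \<open>(0, t)\<close> only are used when \<open>\<beta> < 1\<close>, and
  \<open>\<partial>/\<partial>t u(t - s)\<close> is the derivative of \<open>u\<close> at \<open>t - s\<close>.
\<close>

definition tempered_caputo ::
    "real \<Rightarrow> real \<Rightarrow> (real \<Rightarrow> 'b::{banach, second_countable_topology}) \<Rightarrow> real \<Rightarrow> 'b" where
  "tempered_caputo \<beta> \<rho> u t =
     (if \<beta> = 1 then vector_derivative u (at t)
      else (\<beta> * \<rho> powr \<beta> / Gamma (1 - \<beta>)) *\<^sub>R
        (LBINT s:{0<..<t}. upper_incomplete_gamma (- \<beta>) (\<rho> * s) *\<^sub>R vector_derivative u (at (t - s))))"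

definition tempered_caputo_differentiable ::
    "real \<Rightarrow> real \<Rightarrow> (real \<Rightarrow> 'b::{banach, second_countable_topology}) \<Rightarrow> real \<Rightarrow> bool" where
  "tempered_caputo_differentiable \<beta> \<rho> u t \<longleftrightarrow>
     (if \<beta> = 1 then u differentiable (at t)
      else (\<forall>s\<in>{0<..<t}. u differentiable (at s)) \<and>
        set_integrable lborel {0<..<t}
          (\<lambda>s. upper_incomplete_gamma (- \<beta>) (\<rho> * s) *\<^sub>R vector_derivative u (at (t - s))))"

definition time_changed_prob ::
    "'a measure \<Rightarrow> (real \<Rightarrow> 'a \<Rightarrow> nat) \<Rightarrow> (real \<Rightarrow> 'a \<Rightarrow> real) \<Rightarrow> nat \<Rightarrow> real \<Rightarrow> real" where
  "time_changed_prob P M L n t = measure P {\<omega> \<in> space P. M (L t \<omega>) \<omega> = n}"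

definition time_changed_pgf ::
    "'a measure \<Rightarrow> (real \<Rightarrow> 'a \<Rightarrow> nat) \<Rightarrow> (real \<Rightarrow> 'a \<Rightarrow> real) \<Rightarrow> complex \<Rightarrow> real \<Rightarrow> complex" where
  "time_changed_pgf P M L u t = (\<Sum>n. u ^ n * of_real (time_changed_prob P M L n t))"

end

theory Submission
  imports Defs "HOL-Real_Asymp.Real_Asymp"
begin

text \<open>
  Everything is read off from Laplace transforms in \<open>t\<close>. Let \<open>H = H1 + H2\<close>, with Laplace exponent
  \<open>f(\<theta>) = ((\<theta> + \<rho>)^(2\<alpha>) - \<rho>^(2\<alpha>)) + ((\<theta> + \<rho>)^\<alpha> - \<rho>^\<alpha>)\<close>. Since \<open>L(t) > s\<close> means \<open>H(s) < t\<close>,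
  the transform of \<open>t \<mapsto> E exp (-\<psi> L(t))\<close> is \<open>f / (\<theta> (f + \<psi>))\<close>. The generalized counting process
  satisfies \<open>E u^M(s) = exp (-s \<psi>(u))\<close> with \<open>\<psi>(u) = \<Sum>j. \<lambda>_j (1 - u^j)\<close>, so this is the transform
  of the generating function, and comparing coefficients of \<open>u^n\<close> gives a recurrence for the
  transforms of the probabilities. On the other side, the tempered derivative of order \<open>\<beta>\<close> is the
  convolution of \<open>u'\<close> with the tail of the Levy measure of a tempered stable subordinator, whose
  transform is \<open>((\<theta> + \<rho>)^\<beta> - \<rho>^\<beta>) / \<theta>\<close>; for \<open>\<beta> = 1\<close> this factor is \<open>1\<close>, in agreement with
  the derivative \<open>d/dt\<close>. Both fractional equations thus become the algebraic
  relation \<open>f (y^ - y(0)/\<theta>) = r^\<close>, where \<open>r\<close> is the right-hand side, and this relation holds.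

  What remains is to invert the transforms at every single \<open>t > 0\<close>: \<open>y\<close> has to be differentiable
  there, and the convolutions have to converge. Densities of \<open>H\<close> would be hard to control, so the
  derivative is exhibited as an explicit series. With \<open>x = (\<theta> + \<rho>)^(-\<alpha>)\<close> one has
  \<open>f = (1 + x - c x^2) / x^2\<close>, hence \<open>\<theta> y^\<close> and \<open>\<theta> r^\<close> are power series in \<open>x\<close> for all the functions
  \<open>y\<close>, \<open>r\<close> in question, and \<open>\<theta> y^ - y(0) = x^2 \<Sum>m. b_m x^m\<close> with geometrically bounded \<open>b_m\<close>. But
  \<open>V(t) = exp (-\<rho> t) \<Sum>m. b_m t^(\<alpha> m + 2\<alpha> - 1) / Gamma (\<alpha> m + 2\<alpha>)\<close> has exactly this transform, is
  continuous for \<open>t > 0\<close> and is of order \<open>t^(2\<alpha> - 1)\<close> near \<open>0\<close>. Uniqueness of Laplace transforms gives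
  \<open>y(t) = y(0) + \<integral>\<^sub>0\<^sup>t V\<close>, so \<open>y' = V\<close>; the convolutions of \<open>V\<close> with the two kernels converge
  and are continuous, and uniqueness once more identifies their sum with \<open>r\<close>. This is
  \<open>tempered_caputo_from_laplace\<close>.

  Uniqueness pointwise, and not only almost everywhere, needs a one-sided continuity of \<open>y\<close> and \<open>r\<close>.
  Left continuity is cheap: the first passage time \<open>L\<close> is left continuous on almost every path, and
  \<open>E \<phi>(M(L(t))) = E \<chi>(L(t))\<close> where \<open>\<chi>(s) = E \<phi>(M(s))\<close> is continuous, although \<open>M(L(t))\<close> is not
  left continuous.
\<close>

section \<open>Laplace transforms on the half line\<close>

text \<open>
  A relation rather than a function, so that a transform always comes with its absolute convergence.
\<close>
definition has_laplace ::
    "(real \<Rightarrow> 'b::{banach, second_countable_topology}) \<Rightarrow> real \<Rightarrow> 'b \<Rightarrow> bool" where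
  "has_laplace v \<theta> l \<longleftrightarrow>
     set_integrable lborel {0<..} (\<lambda>t. exp (- \<theta> * t) *\<^sub>R v t) \<and>
     (LBINT t:{0<..}. exp (- \<theta> * t) *\<^sub>R v t) = l"

lemma has_laplace_add:
  "has_laplace v \<theta> a \<Longrightarrow> has_laplace w \<theta> b \<Longrightarrow> has_laplace (\<lambda>t. v t + w t) \<theta> (a + b)"
  unfolding has_laplace_def by (auto simp: scaleR_add_right)

lemma has_laplace_bounded_linear:
  assumes "bounded_linear T" "has_laplace v \<theta> a"
  shows "has_laplace (\<lambda>t. T (v t)) \<theta> (T a)"
proof -
  interpret bounded_linear T by fact
  from assms(2) have *: "integrable lborel (\<lambda>t. indicator {0<..} t *\<^sub>R exp (- \<theta> * t) *\<^sub>R v t)"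
      "integral\<^sup>L lborel (\<lambda>t. indicator {0<..} t *\<^sub>R exp (- \<theta> * t) *\<^sub>R v t) = a"
    by (auto simp: has_laplace_def set_integrable_def set_lebesgue_integral_def)
  have "integrable lborel (\<lambda>t. T (indicator {0<..} t *\<^sub>R exp (- \<theta> * t) *\<^sub>R v t))"
    "integral\<^sup>L lborel (\<lambda>t. T (indicator {0<..} t *\<^sub>R exp (- \<theta> * t) *\<^sub>R v t)) = T a"
    using integrable_bounded_linear[OF assms(1) *(1)] integral_bounded_linear[OF assms(1) *(1)] *(2)
    by auto
  thus ?thesis
    by (simp add: has_laplace_def set_integrable_def set_lebesgue_integral_def scaleR)
qed

lemma has_laplace_minus: "has_laplace v \<theta> a \<Longrightarrow> has_laplace (\<lambda>t. - v t) \<theta> (- a)"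
  by (rule has_laplace_bounded_linear[OF bounded_linear_minus[OF bounded_linear_ident]])

lemma has_laplace_diff:
  "has_laplace v \<theta> a \<Longrightarrow> has_laplace w \<theta> b \<Longrightarrow> has_laplace (\<lambda>t. v t - w t) \<theta> (a - b)"
  using has_laplace_add[OF _ has_laplace_minus] by fastforce

lemma has_laplace_zero: "has_laplace (\<lambda>_. 0) \<theta> 0"
  unfolding has_laplace_def by (auto simp: set_integrable_def)

lemma has_laplace_sum:
  "(\<And>i. i \<in> I \<Longrightarrow> has_laplace (v i) \<theta> (a i)) \<Longrightarrow>
    has_laplace (\<lambda>t. \<Sum>i\<in>I. v i t) \<theta> (\<Sum>i\<in>I. a i)"
  by (induction I rule: infinite_finite_induct) (auto intro: has_laplace_zero has_laplace_add)

lemma has_laplace_mult_left: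
  fixes v :: "real \<Rightarrow> 'b::{banach, second_countable_topology, real_normed_algebra}"
  shows "has_laplace v \<theta> a \<Longrightarrow> has_laplace (\<lambda>t. c * v t) \<theta> (c * a)"
  by (rule has_laplace_bounded_linear[OF bounded_linear_mult_right])

lemma has_laplace_cong:
  assumes "\<And>t. t > 0 \<Longrightarrow> v t = w t" "a = b"
  shows "has_laplace v \<theta> a \<longleftrightarrow> has_laplace w \<theta> b"
proof -
  have "set_integrable lborel {0<..} (\<lambda>t. exp (- \<theta> * t) *\<^sub>R v t) \<longleftrightarrow>
        set_integrable lborel {0<..} (\<lambda>t. exp (- \<theta> * t) *\<^sub>R w t)"
    by (rule set_integrable_cong) (use assms in auto)
  moreover have "(LBINT t:{0<..}. exp (- \<theta> * t) *\<^sub>R v t) = (LBINT t:{0<..}. exp (- \<theta> * t) *\<^sub>R w t)"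
    by (rule set_lebesgue_integral_cong) (use assms in auto)
  ultimately show ?thesis using assms(2) unfolding has_laplace_def by simp
qed

text \<open>
  Exponential tempering is a shift of the transform.
\<close>
lemma has_laplace_shift: 
  "has_laplace (\<lambda>t. exp (- \<rho> * t) *\<^sub>R v t) \<theta> a \<longleftrightarrow> has_laplace v (\<theta> + \<rho>) a"
proof -
  have "exp (- \<theta> * t) *\<^sub>R exp (- \<rho> * t) *\<^sub>R v t = exp (- (\<theta> + \<rho>) * t) *\<^sub>R v t" for t
    by (simp add: exp_add[symmetric] algebra_simps)
  thus ?thesis unfolding has_laplace_def by presburger
qed

lemma has_laplace_bounded:
  fixes v :: "real \<Rightarrow> 'b::{banach, second_countable_topology}"
  assumes [measurable]: "v \<in> borel_measurable borel" and "\<And>t. t > 0 \<Longrightarrow> norm (v t) \<le> B" and "\<theta> > 0"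
  shows "has_laplace v \<theta> (LBINT t:{0<..}. exp (- \<theta> * t) *\<^sub>R v t)"
proof -
  have 1: "set_integrable lborel {0<..} (\<lambda>t. exp (- \<theta> * t))"
  proof -
    have "set_integrable lborel {0..} (\<lambda>t. exp (- (t * \<theta>)))"
      using integrable_on_exp_minus_to_infinity[of \<theta> 0] assms(3) 
        nonnegative_absolutely_integrable_1[of "\<lambda>x. exp(- \<theta> * x)" "{0..}"]
      by (simp add: absolutely_integrable_on_def integrable_completion set_integrable_def mult.commute)
    hence "set_integrable lborel {0..} (\<lambda>t. exp (- \<theta> * t))" by (simp add: mult.commute)
    thus ?thesis by (rule set_integrable_subset) auto
  qed
  hence 2: "set_integrable lborel {0<..} (\<lambda>t. B * exp (- \<theta> * t))" by simp
  have "set_integrable lborel {0<..} (\<lambda>t. exp (- \<theta> * t) *\<^sub>R v t)"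
    by (rule set_integrable_bound[OF 2])
       (auto simp: set_borel_measurable_def abs_mult mult.commute[of B]
         intro!: AE_I2 mult_left_mono order.trans[OF assms(2) abs_ge_self])
  thus ?thesis unfolding has_laplace_def by simp
qed

lemma has_laplace_powr:
  assumes s: "s > 0" and \<theta>: "\<theta> > 0"
  shows "has_laplace (\<lambda>t. t powr (s - 1)) \<theta> (Gamma s / \<theta> powr s)"
proof -
  define f where "f = (\<lambda>t::real. indicator {0..} t * t powr (s - 1) / exp t)"
  have f: "has_bochner_integral lborel f (Gamma s)"
  proof (rule has_bochner_integral_nn_integral)
    show "f \<in> borel_measurable lborel" unfolding f_def by measurable
    show "AE t in lborel. 0 \<le> f t" by (auto simp: f_def)
    show "0 \<le> Gamma s" using s by (simp add: Gamma_real_pos less_imp_le)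
    show "(\<integral>\<^sup>+ t. ennreal (f t) \<partial>lborel) = ennreal (Gamma s)"
      unfolding f_def using Gamma_conv_nn_integral_real[OF s] by simp
  qed
  define h where "h t = indicator {0<..} t * (exp (- \<theta> * t) * t powr (s - 1))" for t :: real
  have eq: "f (\<theta> * t) = \<theta> powr (s - 1) * h t" for t
    using \<theta> by (cases "t = 0")
      (auto simp: f_def h_def indicator_def powr_mult exp_minus field_simps zero_le_mult_iff)
  have c: "\<theta> powr (s - 1) > 0" "\<theta> powr s = \<theta> * \<theta> powr (s - 1)"
    using \<theta> by (auto simp: powr_diff)
  have "integrable lborel (\<lambda>t. f (0 + \<theta> * t))"
    using f \<theta> by (intro lborel_integrable_real_affine) (auto simp: has_bochner_integral_iff)
  moreover have "Gamma s = \<bar>\<theta>\<bar> *\<^sub>R (\<integral>t. f (0 + \<theta> * t) \<partial>lborel)"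
    using f \<theta> lborel_integral_real_affine[of \<theta> f 0] by (auto simp: has_bochner_integral_iff)
  ultimately have "integrable lborel h" "Gamma s = \<theta> * (\<theta> powr (s - 1) * integral\<^sup>L lborel h)"
    using c \<theta> by (simp_all add: eq)
  hence "integrable lborel h" "integral\<^sup>L lborel h = Gamma s / \<theta> powr s"
    using c \<theta> by (simp_all add: field_simps)
  thus ?thesis
    unfolding has_laplace_def set_integrable_def set_lebesgue_integral_def h_def[abs_def] by simp
qed

lemma has_laplace_one: "\<theta> > 0 \<Longrightarrow> has_laplace (\<lambda>_. 1 :: real) \<theta> (1 / \<theta>)"
  using has_laplace_powr[of 1 \<theta>] has_laplace_cong[of "\<lambda>t. t powr 0" "\<lambda>_. 1 :: real" "1 / \<theta>"]
  by simp

text \<open>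
  The convolution of two functions that vanish on the negative half line.
\<close>
definition convolution_pos ::
    "(real \<Rightarrow> real) \<Rightarrow> (real \<Rightarrow> 'b::{banach, second_countable_topology}) \<Rightarrow> real \<Rightarrow> 'b" where
  "convolution_pos w v t = (LBINT s:{0<..<t}. w s *\<^sub>R v (t - s))"

lemma has_laplace_convolution_pos:
  fixes v :: "real \<Rightarrow> 'b::{banach, second_countable_topology}"
  assumes w: "has_laplace w \<theta> a" and v: "has_laplace v \<theta> b"
  shows "has_laplace (convolution_pos w v) \<theta> (a *\<^sub>R b)"
proof -
  define K where "K t = indicator {0<..} t * (exp (- \<theta> * t) * w t)" for t
  define J where "J t = indicator {0<..} t *\<^sub>R (exp (- \<theta> * t) *\<^sub>R v t)" for t
  have K: "integrable lborel K" "integral\<^sup>L lborel K = a"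
    using w by (auto simp: has_laplace_def set_integrable_def set_lebesgue_integral_def K_def[abs_def])
  have J: "integrable lborel J" "integral\<^sup>L lborel J = b"
    using v by (auto simp: has_laplace_def set_integrable_def set_lebesgue_integral_def J_def[abs_def])
  have [measurable]: "K \<in> borel_measurable borel" "J \<in> borel_measurable borel"
    using K(1) J(1) by (auto dest: borel_measurable_integrable)
  define F where "F = (\<lambda>s t. K s *\<^sub>R J (t - s))"
  have shift: "integrable lborel (\<lambda>t. f (t - s))" "(\<integral>t. f (t - s) \<partial>lborel) = integral\<^sup>L lborel f"
    if "integrable lborel f" for f :: "real \<Rightarrow> 'c::{banach, second_countable_topology}" and s
    using lborel_integrable_real_affine[OF that, of 1 "-s"] lborel_integral_real_affine[of 1 f "-s"]
    by (auto simp: add.commute)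
  have F: "integrable (lborel \<Otimes>\<^sub>M lborel) (case_prod F)"
  proof (rule lborel_pair.Fubini_integrable)
    show "case_prod F \<in> borel_measurable (lborel \<Otimes>\<^sub>M lborel)" unfolding F_def by measurable
    have "(\<integral>t. norm (case_prod F (s, t)) \<partial>lborel) = \<bar>K s\<bar> * (\<integral>t. norm (J t) \<partial>lborel)" for s
      using shift(2)[OF integrable_norm[OF J(1)], of s] by (simp add: F_def)
    thus "integrable lborel (\<lambda>s. \<integral>t. norm (case_prod F (s, t)) \<partial>lborel)"
      using K(1) by simp
    show "AE s in lborel. integrable lborel (\<lambda>t. case_prod F (s, t))"
      using shift(1)[OF J(1)] by (auto simp: F_def)
  qed
  have eq: "(\<integral>s. F s t \<partial>lborel) = indicator {0<..} t *\<^sub>R (exp (- \<theta> * t) *\<^sub>R convolution_pos w v t)" for t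
  proof -
    have "F s t = (indicator {0<..} t * exp (- \<theta> * t)) *\<^sub>R (indicator {0<..<t} s *\<^sub>R w s *\<^sub>R v (t - s))" for s
      by (auto simp: F_def K_def J_def indicator_def exp_add[symmetric] algebra_simps)
    hence "(\<integral>s. F s t \<partial>lborel) = (indicator {0<..} t * exp (- \<theta> * t)) *\<^sub>R
        (\<integral>s. indicator {0<..<t} s *\<^sub>R w s *\<^sub>R v (t - s) \<partial>lborel)"
      by (simp only: integral_scaleR_right)
    thus ?thesis by (simp add: convolution_pos_def set_lebesgue_integral_def)
  qed
  have "integrable lborel (\<lambda>t. \<integral>s. F s t \<partial>lborel)"
    using lborel_pair.integrable_snd[OF F] .
  moreover have "(\<integral>t. (\<integral>s. F s t \<partial>lborel) \<partial>lborel) = (\<integral>s. (\<integral>t. F s t \<partial>lborel) \<partial>lborel)"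
    using lborel_pair.Fubini_integral[OF F] .
  moreover have "(\<integral>s. (\<integral>t. F s t \<partial>lborel) \<partial>lborel) = a *\<^sub>R b"
    using shift(2)[OF J(1)] J(2) K by (simp add: F_def)
  ultimately show ?thesis
    unfolding eq has_laplace_def set_integrable_def set_lebesgue_integral_def by simp
qed

text \<open>
  The values of the transform at the naturals are the moments of \<open>K\<close> in the variable \<open>exp (-t)\<close>, so
  \<open>K\<close> is orthogonal to all polynomials in \<open>exp (-t)\<close>, and by Weierstrass to all continuous functions
  of it.
\<close>
lemma laplace_unique_integral:
  fixes K :: "real \<Rightarrow> 'b::{banach, second_countable_topology}"
  assumes K: "set_integrable lborel {0<..} K"
    and 0: "\<And>n::nat. (LBINT t:{0<..}. exp (- real n * t) *\<^sub>R K t) = 0"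
    and cont: "continuous_on {0..1} \<phi>"
  shows "(LBINT t:{0<..}. \<phi> (exp (- t)) *\<^sub>R K t) = 0"
proof -
  have int: "set_integrable lborel {0<..} (\<lambda>t. g (exp (- t)) *\<^sub>R K t)"
    if g: "continuous_on {0..1} g" for g :: "real \<Rightarrow> real"
  proof -
    obtain B where B: "\<And>x. x \<in> {0..1} \<Longrightarrow> \<bar>g x\<bar> \<le> B"
      using compact_imp_bounded[OF compact_continuous_image[OF g]] unfolding bounded_iff
      by (metis compact_Icc image_eqI real_norm_def)
    have m: "(\<lambda>t::real. indicator {0<..} t *\<^sub>R g (exp (- t))) \<in> borel_measurable borel"
      by (rule borel_measurable_continuous_on_indicator)
         (auto intro!: continuous_on_compose2[OF g] continuous_intros)
    have "set_integrable lborel {0<..} (\<lambda>t. B *\<^sub>R K t)" using K by simp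
    thus ?thesis
    proof (rule set_integrable_bound)
      have "(\<lambda>t. indicator {0<..} t *\<^sub>R K t) \<in> borel_measurable borel"
        using K by (auto simp: set_integrable_def dest: borel_measurable_integrable)
      with m have "(\<lambda>t. (indicator {0<..} t *\<^sub>R g (exp (- t))) *\<^sub>R (indicator {0<..} t *\<^sub>R K t))
          \<in> borel_measurable borel"
        by (rule borel_measurable_scaleR)
      hence "(\<lambda>t. (indicator {0<..} t *\<^sub>R g (exp (- t))) *\<^sub>R (indicator {0<..} t *\<^sub>R K t))
          \<in> borel_measurable lborel"
        by (subst measurable_lborel2)
      thus "set_borel_measurable lborel {0<..} (\<lambda>t. g (exp (- t)) *\<^sub>R K t)"
        unfolding set_borel_measurable_def
        by (rule measurable_cong[THEN iffD1, rotated]) (auto simp: indicator_def)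
    next
      have "\<bar>g (exp (- t))\<bar> \<le> \<bar>B\<bar>" if "t > 0" for t using B[of "exp (-t)"] that by auto
      thus "AE x in lborel. x \<in> {0<..} \<longrightarrow> norm (g (exp (- x)) *\<^sub>R K x) \<le> norm (B *\<^sub>R K x)"
        by (auto intro!: AE_I2 mult_right_mono)
    qed
  qed
  have poly0: "(LBINT t:{0<..}. (\<Sum>i\<in>I. c i * exp (- t) ^ e i) *\<^sub>R K t) = 0" if "finite I" for I :: "nat set" and c :: "nat \<Rightarrow> real" and e
  proof -
    have *: "set_integrable lborel {0<..} (\<lambda>t. exp (- t) ^ m *\<^sub>R K t)" for m
      by (rule int) (auto intro!: continuous_intros)
    have "(LBINT t:{0<..}. exp (- t) ^ m *\<^sub>R K t) = 0" for m
      using 0[of m] by (simp add: exp_of_nat_mult[symmetric] mult.commute)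
    hence "(LBINT t:{0<..}. c i *\<^sub>R exp (- t) ^ e i *\<^sub>R K t) = 0" for i
      by (simp only: set_integral_scaleR_right scaleR_zero_right)
    hence z: "(\<integral>t. indicator {0<..} t *\<^sub>R ((c i * exp (- t) ^ e i) *\<^sub>R K t) \<partial>lborel) = 0" for i
      unfolding set_lebesgue_integral_def by (simp only: scaleR_scaleR)
    have i: "integrable lborel (\<lambda>t. indicator {0<..} t *\<^sub>R ((c i * exp (- t) ^ e i) *\<^sub>R K t))" for i
      by (rule int[of "\<lambda>x. c i * x ^ e i", unfolded set_integrable_def]) (intro continuous_intros)
    have "(\<integral>t. (\<Sum>i\<in>I. indicator {0<..} t *\<^sub>R ((c i * exp (- t) ^ e i) *\<^sub>R K t)) \<partial>lborel) = 0"
      by (subst Bochner_Integration.integral_sum[OF i]) (simp only: z sum.neutral_const)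
    thus ?thesis unfolding set_lebesgue_integral_def scaleR_sum_left scaleR_sum_right .
  qed
  define N where "N = (LBINT t:{0<..}. norm (K t))"
  have N0: "N \<ge> 0" unfolding N_def set_lebesgue_integral_def by (auto intro!: integral_nonneg_AE)
  have "norm (LBINT t:{0<..}. \<phi> (exp (- t)) *\<^sub>R K t) \<le> e * N" if e: "e > 0" for e
  proof -
    obtain n where n: "\<And>x. x \<in> {0..1} \<Longrightarrow> \<bar>\<phi> x - (\<Sum>k\<le>n. \<phi> (k/n) * Bernstein n k x)\<bar> < e"
      using Bernstein_Weierstrass[OF cont e] by blast
    define p where "p x = (\<Sum>k\<le>n. \<phi> (k/n) * Bernstein n k x)" for x
    have cp: "continuous_on {0..1} p" unfolding p_def Bernstein_def by (auto intro!: continuous_intros)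
    have "\<exists>c d. \<forall>x. p x = (\<Sum>i\<le>d. c i * x ^ i)"
    proof -
      define q where "q = (\<Sum>k\<le>n. [:\<phi> (k/n) * real (n choose k):] * (monom 1 k * [:1, -1:] ^ (n - k)))"
      have "p x = (\<Sum>i\<le>degree q. coeff q i * x ^ i)" for x
        unfolding poly_altdef[symmetric] p_def q_def Bernstein_def
        by (simp add: poly_sum poly_monom mult.assoc)
      thus ?thesis by blast
    qed
    then obtain c d where "\<And>x. p x = (\<Sum>i\<le>d. c i * x ^ i)" by blast
    hence p0: "(LBINT t:{0<..}. p (exp (- t)) *\<^sub>R K t) = 0" using poly0[of "{..d}" c "\<lambda>i. i"] by simp
    have "(LBINT t:{0<..}. \<phi> (exp (- t)) *\<^sub>R K t) = (LBINT t:{0<..}. (\<phi> (exp (- t)) - p (exp (-t))) *\<^sub>R K t)"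
      using set_integral_diff(2)[OF int[OF cont] int[OF cp]] p0 by (simp add: scaleR_diff_left)
    also have "norm \<dots> \<le> (LBINT t:{0<..}. norm ((\<phi> (exp (- t)) - p (exp (-t))) *\<^sub>R K t))"
      by (rule set_integral_norm_bound) (rule int, use cont cp in \<open>auto intro!: continuous_intros\<close>)
    also have "\<dots> \<le> (LBINT t:{0<..}. e * norm (K t))"
    proof (rule set_integral_mono)
      show "set_integrable lborel {0<..} (\<lambda>t. norm ((\<phi> (exp (- t)) - p (exp (-t))) *\<^sub>R K t))"
        by (rule set_integrable_norm, rule int) (use cont cp in \<open>auto intro!: continuous_intros\<close>)
      show "set_integrable lborel {0<..} (\<lambda>t. e * norm (K t))" using K by (simp add: set_integrable_norm)
      show "norm ((\<phi> (exp (- t)) - p (exp (-t))) *\<^sub>R K t) \<le> e * norm (K t)" if "t \<in> {0<..}" for t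
        using n[of "exp (-t)"] that by (auto simp: p_def intro!: mult_right_mono)
    qed
    also have "\<dots> = e * N" by (simp add: N_def)
    finally show ?thesis .
  qed
  hence *: "norm (LBINT t:{0<..}. \<phi> (exp (- t)) *\<^sub>R K t) \<le> e * N" if "e > 0" for e using that by blast
  have "norm (LBINT t:{0<..}. \<phi> (exp (- t)) *\<^sub>R K t) \<le> 0"
  proof (rule field_le_epsilon)
    fix e :: real assume "e > 0"
    have "norm (LBINT t:{0<..}. \<phi> (exp (- t)) *\<^sub>R K t) \<le> e / (N + 1) * N"
      by (rule *) (use N0 \<open>e > 0\<close> in auto)
    also have "\<dots> \<le> e" using N0 \<open>e > 0\<close> by (simp add: field_simps)
    finally show "norm (LBINT t:{0<..}. \<phi> (exp (- t)) *\<^sub>R K t) \<le> 0 + e" by simp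
  qed
  thus ?thesis by simp
qed

text \<open>
  Indicators of intervals are bounded limits of continuous functions of \<open>exp (-t)\<close>.
\<close>
lemma laplace_zero_integral_Ioo:
  fixes K :: "real \<Rightarrow> 'b::{banach, second_countable_topology}"
  assumes K: "set_integrable lborel {0<..} K"
    and 0: "\<And>n::nat. (LBINT t:{0<..}. exp (- real n * t) *\<^sub>R K t) = 0"
    and ab: "0 \<le> a"
  shows "(LBINT t:{a<..<b}. K t) = 0"
proof -
  \<comment> \<open>A tent over \<open>(exp (-b), exp (-a))\<close>; scaled by \<open>m\<close> and cut off at \<open>1\<close> it increases to the indicator.\<close>
  define \<psi> where "\<psi> x = max 0 (min (x - exp (- b)) (exp (- a) - x))" for x :: real
  define \<phi> where "\<phi> m x = min 1 (real m * \<psi> x)" for m x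
  have cont: "continuous_on {0..1} (\<phi> m)" for m unfolding \<phi>_def \<psi>_def by (intro continuous_intros)
  have bnd: "0 \<le> \<phi> m x" "\<phi> m x \<le> 1" for m x by (auto simp: \<phi>_def \<psi>_def)
  have lim: "(\<lambda>m. \<phi> m (exp (- t))) \<longlonglongrightarrow> indicator {a<..<b} t" for t
  proof (cases "t \<in> {a<..<b}")
    case True
    hence "\<psi> (exp (-t)) > 0" by (auto simp: \<psi>_def)
    then obtain m0 :: nat where m0: "real m0 * \<psi> (exp (-t)) > 1" using reals_Archimedean3[of "\<psi> (exp (-t))"] by auto
    have "\<forall>\<^sub>F m in sequentially. \<phi> m (exp (-t)) = 1"
      using eventually_ge_at_top[of m0]
    proof eventually_elim
      case (elim m)
      have "real m0 * \<psi> (exp (-t)) \<le> real m * \<psi> (exp (-t))" 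
        using elim \<open>\<psi> (exp (-t)) > 0\<close> by (intro mult_right_mono) auto
      thus ?case using m0 by (auto simp: \<phi>_def min_def)
    qed
    thus ?thesis using True by (simp add: tendsto_eventually)
  next
    case False
    hence "exp (- a) \<le> exp (- t) \<or> exp (- t) \<le> exp (- b)" by auto
    hence "\<psi> (exp (-t)) = 0" unfolding \<psi>_def by linarith
    thus ?thesis using False by (simp add: \<phi>_def)
  qed
  have Kint: "integrable lborel (\<lambda>t. indicator {0<..} t *\<^sub>R K t)"
    using K by (simp add: set_integrable_def)
  have [measurable]: "(\<lambda>t. indicator {0<..} t *\<^sub>R K t) \<in> borel_measurable borel"
    using Kint by (auto dest: borel_measurable_integrable)
  have "(\<lambda>m. \<integral>t. \<phi> m (exp (- t)) *\<^sub>R (indicator {0<..} t *\<^sub>R K t) \<partial>lborel)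
      \<longlonglongrightarrow> (\<integral>t. indicator {a<..<b} t *\<^sub>R (indicator {0<..} t *\<^sub>R K t) \<partial>lborel)"
  proof (rule integral_dominated_convergence[where w = "\<lambda>t. norm (indicator {0<..} t *\<^sub>R K t)"])
    show "AE t in lborel. norm (\<phi> m (exp (- t)) *\<^sub>R (indicator {0<..} t *\<^sub>R K t))
        \<le> norm (indicator {0<..} t *\<^sub>R K t)" for m
    proof (rule AE_I2)
      fix t :: real
      show "norm (\<phi> m (exp (- t)) *\<^sub>R (indicator {0<..} t *\<^sub>R K t)) \<le> norm (indicator {0<..} t *\<^sub>R K t)"
        unfolding norm_scaleR[of "\<phi> m (exp (- t))"]
        by (rule mult_left_le_one_le) (use bnd[of m "exp (-t)"] in auto)
    qed
    show "(\<lambda>t. \<phi> m (exp (- t)) *\<^sub>R (indicator {0<..} t *\<^sub>R K t)) \<in> borel_measurable lborel" for m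
      unfolding \<phi>_def \<psi>_def by measurable
    show "(\<lambda>t. indicator {a<..<b} t *\<^sub>R (indicator {0<..} t *\<^sub>R K t)) \<in> borel_measurable lborel"
      by measurable
    show "AE t in lborel. (\<lambda>m. \<phi> m (exp (- t)) *\<^sub>R (indicator {0<..} t *\<^sub>R K t))
        \<longlonglongrightarrow> indicator {a<..<b} t *\<^sub>R (indicator {0<..} t *\<^sub>R K t)"
      by (intro AE_I2 tendsto_scaleR lim tendsto_const)
  qed (rule integrable_norm[OF Kint])
  moreover have "(\<integral>t. \<phi> m (exp (- t)) *\<^sub>R (indicator {0<..} t *\<^sub>R K t) \<partial>lborel) = 0" for m
    using laplace_unique_integral[OF K 0 cont[of m]]
    by (simp add: set_lebesgue_integral_def mult.commute)
  ultimately have "(\<integral>t. indicator {a<..<b} t *\<^sub>R (indicator {0<..} t *\<^sub>R K t) \<partial>lborel) = 0"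
    by (simp add: LIMSEQ_const_iff)
  moreover have "indicator {a<..<b} t *\<^sub>R (indicator {0<..} t *\<^sub>R K t) = indicator {a<..<b} t *\<^sub>R K t" for t
    using ab by (auto simp: indicator_def)
  ultimately show ?thesis unfolding set_lebesgue_integral_def by (simp only:)
qed

text \<open>
  If \<open>v t \<noteq> 0\<close> then, by left continuity, the integral of the damped function over a short interval
  ending at \<open>t\<close> would not vanish.
\<close>
lemma laplace_unique:
  fixes v :: "real \<Rightarrow> 'b::{banach, second_countable_topology}"
  assumes lap: "\<And>\<theta>. \<theta> \<ge> \<theta>0 \<Longrightarrow> has_laplace v \<theta> 0"
    and left: "continuous (at_left t) v" and t: "t > 0"
  shows "v t = 0"
proof (rule ccontr)
  assume nz: "v t \<noteq> 0"
  define K where "K s = exp (- \<theta>0 * s) *\<^sub>R v s" for s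
  have int: "set_integrable lborel {0<..} K"
    using lap[of \<theta>0] unfolding K_def[abs_def] has_laplace_def by simp
  have zero: "(LBINT s:{0<..}. exp (- real n * s) *\<^sub>R K s) = 0" for n
  proof -
    have "exp (- real n * s) *\<^sub>R K s = exp (- (\<theta>0 + real n) * s) *\<^sub>R v s" for s
      by (simp add: K_def exp_add[symmetric] algebra_simps)
    thus ?thesis using lap[of "\<theta>0 + real n"] unfolding has_laplace_def by simp
  qed
  define c where "c = norm (K t)"
  have c: "c > 0" using nz by (simp add: c_def K_def)
  have "(K \<longlongrightarrow> K t) (at_left t)"
    unfolding K_def using left by (auto intro!: tendsto_intros simp: continuous_within)
  hence "\<forall>\<^sub>F s in at_left t. dist (K s) (K t) < c / 2" using c by (auto dest: tendstoD[where e="c/2"])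
  then obtain b where b: "b < t" "\<And>s. b < s \<Longrightarrow> s < t \<Longrightarrow> dist (K s) (K t) < c / 2"
    unfolding eventually_at_left_field by blast
  define a where "a = max 0 b"
  have a: "0 \<le> a" "a < t" "b \<le> a" using t b by (auto simp: a_def)
  have intK: "set_integrable lborel {a<..<t} K"
    by (rule set_integrable_subset[OF int]) (use a in auto)
  have intc: "set_integrable lborel {a<..<t} (\<lambda>s. d)" for d :: 'b
    using a by (simp add: set_integrable_def)
  have intr: "set_integrable lborel {a<..<t} (\<lambda>s. d)" for d :: real
    using a by (simp add: set_integrable_def)
  have "(LBINT s:{a<..<t}. K t - K s) = (t - a) *\<^sub>R K t"
    using laplace_zero_integral_Ioo[OF int zero a(1), of t] set_integral_diff(2)[OF intc intK] a
    by (simp add: set_lebesgue_integral_def)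
  hence "(t - a) * c = norm (LBINT s:{a<..<t}. K t - K s)"
    using a by (simp add: c_def)
  also have "\<dots> \<le> (LBINT s:{a<..<t}. norm (K t - K s))"
    by (rule set_integral_norm_bound) (rule set_integral_diff(1)[OF intc intK])
  also have "\<dots> \<le> (LBINT s:{a<..<t}. c / 2)"
    by (rule set_integral_mono[OF set_integrable_norm[OF set_integral_diff(1)[OF intc intK]] intr])
       (use b a in \<open>auto simp: dist_norm norm_minus_commute intro: less_imp_le\<close>)
  also have "\<dots> = (t - a) * (c / 2)" using a by (simp add: set_lebesgue_integral_def)
  finally show False using a c by auto
qed

section \<open>Fractional power series and their transforms\<close>

text \<open>
  Cutting the Euler integral for \<open>Gamma (s + 1)\<close> at \<open>T + 1\<close> gives \<open>Gamma (s + 1) \<ge> (T + 1)^s exp (-T - 1)\<close>.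
  Because \<open>T\<close> is free, the bound turns both the superexponential growth of \<open>Gamma\<close> and an exponential
  bound in \<open>t\<close> into one estimate. Cutting at \<open>T + 1\<close> and not at \<open>T\<close> allows one to lower the exponent
  to \<open>s - \<delta>\<close>, which is what keeps small \<open>t\<close> under control.
\<close>
lemma inverse_Gamma_bound:
  fixes s T \<delta> :: real
  assumes "T > 0" "0 \<le> \<delta>" "\<delta> \<le> s" "s > 0"
  shows "1 / Gamma s \<le> s * exp (T + 1) * T powr (\<delta> - s)"
proof -
  have f: "((\<lambda>z. z powr s / exp z) has_integral Gamma (s + 1)) {0..}"
    using Gamma_integral_real[of "s + 1"] assms by simp
  have "((\<lambda>z. exp (- 1 * z)) has_integral exp (- 1 * (T + 1)) / 1) {T+1..}"
    by (rule has_integral_exp_minus_to_infinity) simp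
  hence "((\<lambda>z. (T + 1) powr s * exp (- z)) has_integral (T + 1) powr s * exp (- (T + 1))) {T+1..}"
    by (intro has_integral_mult_right) simp
  hence g: "((\<lambda>z. if z \<in> {T+1..} then (T + 1) powr s * exp (- z) else 0) has_integral
      (T + 1) powr s * exp (- (T + 1))) {0..}"
    by (subst has_integral_restrict) (use assms in auto)
  have "(T + 1) powr s * exp (- (T + 1)) \<le> Gamma (s + 1)"
    by (rule has_integral_le[OF g f])
       (use assms in \<open>auto simp: exp_minus field_simps intro!: powr_mono2\<close>)
  also have "Gamma (s + 1) = s * Gamma s"
    using assms by (intro Gamma_plus1) (auto dest!: nonpos_Ints_nonpos)
  finally have 1: "(T + 1) powr s * exp (- (T + 1)) \<le> s * Gamma s" .
  have "T powr (s - \<delta>) \<le> (T + 1) powr (s - \<delta>)" using assms by (intro powr_mono2) auto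
  also have "\<dots> \<le> (T + 1) powr s" using assms by (intro powr_mono) auto
  finally have "T powr (s - \<delta>) * exp (- (T + 1)) \<le> s * Gamma s" using 1
    by (meson exp_ge_zero mult_right_mono order.trans)
  moreover have "Gamma s > 0" using assms by (simp add: Gamma_real_pos)
  moreover have "T powr (\<delta> - s) = 1 / T powr (s - \<delta>)"
    using powr_minus_divide[of T "s - \<delta>"] by simp
  moreover have "T powr (s - \<delta>) > 0" using assms by simp
  ultimately show ?thesis using assms by (simp only: exp_minus) (simp add: field_simps)
qed

text \<open>
  Series of Mittag-Leffler type, \<open>\<Sum>m. b_m t^(\<alpha> m) / Gamma (\<alpha> m + \<delta>)\<close>, with geometrically bounded
  coefficients. Multiplied by \<open>t^(\<delta> - 1)\<close> they invert the power series \<open>\<theta>^(-\<delta>) \<Sum>m. b_m \<theta>^(-\<alpha> m)\<close>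
  in \<open>\<theta>^(-\<alpha>)\<close>.
\<close>
locale fractional_series =
  fixes \<alpha> \<delta> C R :: real and b :: "nat \<Rightarrow> 'b::{banach, second_countable_topology}"
  assumes \<alpha>: "\<alpha> > 0" and \<delta>: "\<delta> > 0" and R: "R > 0" and b: "\<And>m. norm (b m) \<le> C * R ^ m"
begin

text \<open>
  The exponential growth rate: chosen such that \<open>growth^\<alpha> = 2 R\<close>, which leaves a factor
  \<open>2^(-m)\<close> in the \<open>m\<close>-th term.
\<close>
definition growth :: real where "growth = (2 * R) powr (1 / \<alpha>)"

definition series :: "real \<Rightarrow> 'b" where
  "series t = (\<Sum>m. (t powr (\<alpha> * real m) / Gamma (\<alpha> * real m + \<delta>)) *\<^sub>R b m)"

definition total :: real where "total = (\<Sum>m. C * (\<alpha> * real m + \<delta>) * exp 1 * (1/2) ^ m)"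

lemma C_nonneg: "C \<ge> 0" using order.trans[OF norm_ge_zero b[of 0]] by simp

lemma Gamma_pos: "Gamma (\<alpha> * real m + \<delta>) > 0"
  using \<alpha> \<delta> by (intro Gamma_real_pos add_nonneg_pos) auto

lemma growth: "growth > 0" "growth powr (\<alpha> * real m) = 2 ^ m * R ^ m"
proof -
  show "growth > 0" using R by (simp add: growth_def)
  have "growth powr (\<alpha> * real m) = (growth powr \<alpha>) powr real m" by (simp add: powr_powr)
  also have "growth powr \<alpha> = 2 * R" using R \<alpha> by (simp add: growth_def powr_powr)
  also have "(2 * R) powr real m = (2 * R) ^ m" using R by (simp add: powr_realpow)
  finally show "growth powr (\<alpha> * real m) = 2 ^ m * R ^ m" by (simp add: power_mult_distrib)
qed

lemma total_summable: "summable (\<lambda>m. C * (\<alpha> * real m + \<delta>) * exp 1 * (1/2) ^ m)"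
proof -
  have "summable (\<lambda>m. of_nat m * (1/2::real) ^ (m - 1))"
    using geometric_deriv_sums[of "1/2::real"] 
  by (subst summable_Suc_iff[symmetric]) (auto simp: sums_iff)
  hence "summable (\<lambda>m. 1/2 * (of_nat m * (1/2::real) ^ (m - 1)))" by (rule summable_mult)
  moreover have "1/2 * (of_nat m * (1/2::real) ^ (m - 1)) = real m * (1/2) ^ m" for m
    by (cases m) auto
  ultimately have "summable (\<lambda>m. real m * (1/2::real) ^ m)" by (simp only:)
  hence "summable (\<lambda>m. C * exp 1 * \<alpha> * (real m * (1/2) ^ m) + C * exp 1 * \<delta> * (1/2) ^ m)"
    by (intro summable_add summable_mult) auto
  thus ?thesis by (simp add: algebra_simps)
qed

lemma term_bound:
  assumes t: "t > 0"
  shows "norm ((t powr (\<alpha> * real m) / Gamma (\<alpha> * real m + \<delta>)) *\<^sub>R b m)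
    \<le> C * (\<alpha> * real m + \<delta>) * exp 1 * (1/2) ^ m * exp (growth * t)"
proof -
  define s where "s = \<alpha> * real m + \<delta>"
  have s: "s > 0" "\<delta> \<le> s" using \<alpha> \<delta> by (auto simp: s_def intro: add_nonneg_pos)
  have G: "Gamma s > 0" using s by (simp add: Gamma_real_pos)
  have "1 / Gamma s \<le> s * exp (growth * t + 1) * (growth * t) powr (- (\<alpha> * real m))"
    using inverse_Gamma_bound[of "growth * t" \<delta> s] growth t \<delta> s by (simp add: s_def)
  also have "(growth * t) powr (- (\<alpha> * real m)) = 1 / (2 ^ m * R ^ m * t powr (\<alpha> * real m))"
    using growth t by (simp add: powr_minus_divide powr_mult)
  finally have "t powr (\<alpha> * real m) * (1 / Gamma s) \<le> t powr (\<alpha> * real m) * (s * exp (growth * t + 1) * (1 / (2 ^ m * R ^ m * t powr (\<alpha> * real m))))"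
    by (rule mult_left_mono) simp
  also have "\<dots> = s * exp (growth * t + 1) / (2 ^ m * R ^ m)" using t by simp
  finally have "t powr (\<alpha> * real m) / Gamma s \<le> s * exp (growth * t + 1) / (2 ^ m * R ^ m)" by simp
  hence "t powr (\<alpha> * real m) / Gamma s * norm (b m) \<le> s * exp (growth * t + 1) / (2 ^ m * R ^ m) * (C * R ^ m)"
    using b[of m] s R by (intro mult_mono) auto
  also have "\<dots> = C * s * exp 1 * (1/2) ^ m * exp (growth * t)"
    using R by (simp add: exp_add field_simps power_one_over)
  finally show ?thesis using G by (simp add: s_def)
qed

lemma total_nonneg: "total \<ge> 0"
  unfolding total_def using C_nonneg \<alpha> \<delta> by (intro suminf_nonneg total_summable) auto

lemma series_sums: 
  assumes "t > 0"
  shows "summable (\<lambda>m. norm ((t powr (\<alpha> * real m) / Gamma (\<alpha> * real m + \<delta>)) *\<^sub>R b m))"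
  by (rule summable_comparison_test'[OF summable_mult2[OF total_summable, of "exp (growth * t)"]])
     (use term_bound[OF assms] in simp)

lemma series_bound:
  assumes "t > 0"
  shows "norm (series t) \<le> total * exp (growth * t)"
proof -
  have "norm (series t) \<le> (\<Sum>m. norm ((t powr (\<alpha> * real m) / Gamma (\<alpha> * real m + \<delta>)) *\<^sub>R b m))"
    unfolding series_def by (rule summable_norm[OF series_sums[OF assms]])
  also have "\<dots> \<le> (\<Sum>m. C * (\<alpha> * real m + \<delta>) * exp 1 * (1/2) ^ m * exp (growth * t))"
    by (rule suminf_le[OF term_bound[OF assms] series_sums[OF assms] summable_mult2[OF total_summable]])
  also have "\<dots> = total * exp (growth * t)" unfolding total_def by (rule suminf_mult2[symmetric, OF total_summable])
  finally show ?thesis .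
qed

lemma continuous_on_series: "continuous_on {0<..} series"
proof -
  have "continuous_on {0<..<T} series" if T: "T > 0" for T
  proof -
    have "uniform_limit {0<..<T}
        (\<lambda>n t. \<Sum>m<n. (t powr (\<alpha> * real m) / Gamma (\<alpha> * real m + \<delta>)) *\<^sub>R b m) series sequentially"
      unfolding series_def[abs_def]
    proof (rule Weierstrass_m_test)
      show "summable (\<lambda>m. C * (\<alpha> * real m + \<delta>) * exp 1 * (1/2) ^ m * exp (growth * T))"
        by (rule summable_mult2[OF total_summable])
      fix m t assume t: "t \<in> {0<..<T}"
      have "norm ((t powr (\<alpha> * real m) / Gamma (\<alpha> * real m + \<delta>)) *\<^sub>R b m)
          \<le> C * (\<alpha> * real m + \<delta>) * exp 1 * (1/2) ^ m * exp (growth * t)"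
        using t by (intro term_bound) auto
      also have "\<dots> \<le> C * (\<alpha> * real m + \<delta>) * exp 1 * (1/2) ^ m * exp (growth * T)"
        using t C_nonneg \<alpha> \<delta> growth by (intro mult_left_mono) auto
      finally show "norm ((t powr (\<alpha> * real m) / Gamma (\<alpha> * real m + \<delta>)) *\<^sub>R b m) \<le> \<dots>" .
    qed
    thus ?thesis
      by (rule uniform_limit_theorem[rotated])
         (auto intro!: always_eventually continuous_intros simp: less_imp_neq[OF Gamma_pos, symmetric])
  qed
  hence "continuous_on (\<Union>T\<in>{0<..}. {0<..<T}) series"
    by (intro continuous_on_open_UN) auto
  moreover have "(\<Union>T\<in>{0<..}. {0<..<T}) = ({0<..} :: real set)"
    by (auto intro: gt_ex) (meson greaterThanLessThan_iff greaterThan_iff gt_ex less_trans)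
  ultimately show ?thesis by simp
qed

text \<open>
  Term by term, from the Euler integral.
\<close>
lemma has_laplace_series:
  assumes \<theta>: "\<theta> > growth"
  shows "has_laplace (\<lambda>t. t powr (\<delta> - 1) *\<^sub>R series t) \<theta> (\<Sum>m. \<theta> powr (- (\<alpha> * real m + \<delta>)) *\<^sub>R b m)"
proof -
  have th0: "\<theta> > 0" using \<theta> growth(1) by simp
  define s where "s m = \<alpha> * real m + \<delta>" for m
  have s: "s m > 0" for m using \<alpha> \<delta> by (auto simp: s_def intro: add_nonneg_pos)
  have G: "Gamma (s m) > 0" for m using s by (simp add: Gamma_real_pos)
  define h where "h m t = indicator {0<..} t *\<^sub>R (exp (- \<theta> * t) * t powr (s m - 1))" for m t
  define f where "f m t = (h m t / Gamma (s m)) *\<^sub>R b m" for m t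
  have h: "integrable lborel (h m)" "integral\<^sup>L lborel (h m) = Gamma (s m) / \<theta> powr s m" for m
    using has_laplace_powr[OF s[of m] th0]
    by (auto simp: has_laplace_def set_integrable_def set_lebesgue_integral_def h_def[abs_def])
  have hnn: "h m t \<ge> 0" for m t by (auto simp: h_def)
  have fint: "integrable lborel (f m)" for m unfolding f_def[abs_def] using h by auto
  have feq: "f m t = indicator {0<..} t *\<^sub>R (exp (- \<theta> * t) *\<^sub>R (t powr (\<delta> - 1) *\<^sub>R
      ((t powr (\<alpha> * real m) / Gamma (\<alpha> * real m + \<delta>)) *\<^sub>R b m)))" for m t
    by (auto simp: f_def h_def s_def powr_add[symmetric] algebra_simps indicator_def)
  have Ifm: "integral\<^sup>L lborel (f m) = \<theta> powr (- s m) *\<^sub>R b m" for m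
    unfolding f_def[abs_def] using h[of m] G[of m] by (simp add: powr_minus_divide)
  have Inorm: "(\<integral>t. norm (f m t) \<partial>lborel) = \<theta> powr (- s m) * norm (b m)" for m
    unfolding f_def using h[of m] G[of m] hnn[of m] by (simp add: powr_minus_divide)
  have sum1: "summable (\<lambda>m. norm (f m t))" for t
  proof (cases "t > 0")
    case True
    show ?thesis unfolding feq norm_scaleR using series_sums[OF True]
      by (intro summable_mult) auto
  qed (simp add: feq)
  have sum2: "summable (\<lambda>m. \<integral>t. norm (f m t) \<partial>lborel)"
  proof (rule summable_comparison_test')
    show "summable (\<lambda>m. \<theta> powr (- \<delta>) * C * (1/2) ^ m)" by (intro summable_mult) auto
    fix m :: nat
    have "growth powr (\<alpha> * real m) \<le> \<theta> powr (\<alpha> * real m)" using \<theta> growth(1) \<alpha> by (intro powr_mono2) auto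
    hence "2 ^ m * R ^ m \<le> \<theta> powr (\<alpha> * real m)" using growth(2)[of m] by simp
    hence "1 / \<theta> powr (\<alpha> * real m) \<le> 1 / (2 ^ m * R ^ m)" using R th0 by (intro divide_left_mono mult_pos_pos) auto
    hence "1 / \<theta> powr (\<alpha> * real m) * norm (b m) \<le> 1 / (2 ^ m * R ^ m) * (C * R ^ m)"
      using b[of m] R by (intro mult_mono) auto
    also have "\<dots> = C * (1/2) ^ m" using R by (simp add: power_one_over)
    finally have "\<theta> powr (- \<delta>) * (1 / \<theta> powr (\<alpha> * real m) * norm (b m)) \<le> \<theta> powr (- \<delta>) * (C * (1/2) ^ m)"
      by (intro mult_left_mono) auto
    moreover have "\<theta> powr (- s m) = \<theta> powr (- \<delta>) * (1 / \<theta> powr (\<alpha> * real m))"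
      using th0 by (simp add: s_def powr_diff powr_minus_divide)
    ultimately show "norm (\<integral>t. norm (f m t) \<partial>lborel) \<le> \<theta> powr (- \<delta>) * C * (1/2) ^ m"
      unfolding Inorm by (simp add: mult.assoc)
  qed
  have sumf: "(\<Sum>m. f m t) = indicator {0<..} t *\<^sub>R (exp (- \<theta> * t) *\<^sub>R (t powr (\<delta> - 1) *\<^sub>R series t))" for t
  proof (cases "t > 0")
    case True
    have "summable (\<lambda>m. (t powr (\<alpha> * real m) / Gamma (\<alpha> * real m + \<delta>)) *\<^sub>R b m)"
      by (rule summable_norm_cancel[OF series_sums[OF True]])
    from suminf_scaleR_right[OF this, of "indicator {0<..} t * exp (- \<theta> * t) * t powr (\<delta> - 1)"]
    show ?thesis unfolding feq series_def by (simp add: mult.assoc)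
  qed (simp add: feq)
  have "integrable lborel (\<lambda>t. \<Sum>m. f m t)" "(\<integral>t. (\<Sum>m. f m t) \<partial>lborel) = (\<Sum>m. \<theta> powr (- s m) *\<^sub>R b m)"
    using integrable_suminf[OF fint AE_I2[OF sum1] sum2] integral_suminf[OF fint AE_I2[OF sum1] sum2]
    unfolding Ifm by auto
  thus ?thesis unfolding sumf has_laplace_def set_integrable_def set_lebesgue_integral_def s_def by simp
qed

end

section \<open>The kernel of the tempered Caputo derivative\<close>

text \<open>
  The kernel with which \<open>tempered_caputo\<close> convolves the derivative; it is the tail of the Levy
  measure of the tempered stable subordinator.
\<close>
definition tempered_kernel :: "real \<Rightarrow> real \<Rightarrow> real \<Rightarrow> real" where
  "tempered_kernel \<beta> \<rho> s = \<beta> * \<rho> powr \<beta> / Gamma (1 - \<beta>) * upper_incomplete_gamma (- \<beta>) (\<rho> * s)"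

context
  fixes \<beta> \<rho> :: real
  assumes \<beta>: "0 < \<beta>" "\<beta> < 1" and \<rho>: "0 < \<rho>"
begin

text \<open>
  Substituting \<open>z = s y\<close> in the incomplete gamma function splits the kernel into the power \<open>s^(-\<beta>)\<close>
  and this factor, which is bounded and continuous.
\<close>
definition tail_integral :: "real \<Rightarrow> real" where
  "tail_integral s = (LBINT y:{\<rho>..}. exp (- s * y) * y powr (- \<beta> - 1))"

lemma set_integrable_powr_tail: 
  "set_integrable lborel {\<rho>..} (\<lambda>y. y powr (- \<beta> - 1))"
  "(LBINT y:{\<rho>..}. y powr (- \<beta> - 1)) = \<rho> powr (- \<beta>) / \<beta>"
proof -
  have "((\<lambda>y. y powr (- \<beta> - 1)) has_integral - (\<rho> powr ((- \<beta> - 1) + 1)) / ((- \<beta> - 1) + 1)) {\<rho>..}"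
    by (rule has_integral_powr_to_inf) (use \<beta> \<rho> in auto)
  hence *: "((\<lambda>y. y powr (- \<beta> - 1)) has_integral \<rho> powr (- \<beta>) / \<beta>) {\<rho>..}" by simp
  hence "(\<lambda>y. y powr (- \<beta> - 1)) absolutely_integrable_on {\<rho>..}"
    by (intro nonnegative_absolutely_integrable_1) (auto simp: has_integral_integrable)
  thus 1: "set_integrable lborel {\<rho>..} (\<lambda>y. y powr (- \<beta> - 1))"
    by (simp add: absolutely_integrable_on_def integrable_completion set_integrable_def)
  show "(LBINT y:{\<rho>..}. y powr (- \<beta> - 1)) = \<rho> powr (- \<beta>) / \<beta>"
    using set_borel_integral_eq_integral(2)[OF 1] * by (simp add: integral_unique)
qed

lemma tail_integrable:
  assumes "s \<ge> 0"
  shows "set_integrable lborel {\<rho>..} (\<lambda>y. exp (- s * y) * y powr (- \<beta> - 1))"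
  by (rule set_integrable_bound[OF set_integrable_powr_tail(1)])
     (use assms \<rho> in \<open>auto simp: set_borel_measurable_def abs_mult intro!: AE_I2 mult_left_le_one_le\<close>)

lemma tail_integral_bounds:
  assumes "s \<ge> 0"
  shows "0 \<le> tail_integral s" "tail_integral s \<le> \<rho> powr (- \<beta>) / \<beta>"
proof -
  show "0 \<le> tail_integral s" unfolding tail_integral_def set_lebesgue_integral_def
    by (intro integral_nonneg_AE) auto
  show "tail_integral s \<le> \<rho> powr (- \<beta>) / \<beta>"
    unfolding tail_integral_def set_integrable_powr_tail(2)[symmetric]
    by (rule set_integral_mono[OF tail_integrable[OF assms] set_integrable_powr_tail(1)])
       (use assms \<rho> in \<open>auto intro!: mult_left_le_one_le\<close>)
qed

lemma continuous_on_tail_integral: "continuous_on {0<..} tail_integral"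
  unfolding continuous_on_sequentially o_def
proof (intro allI ballI impI, elim conjE)
  fix x :: "nat \<Rightarrow> real" and a assume a: "a \<in> {0<..}" "\<forall>n. x n \<in> {0<..}" "x \<longlonglongrightarrow> a"
  show "(\<lambda>n. tail_integral (x n)) \<longlonglongrightarrow> tail_integral a"
    unfolding tail_integral_def set_lebesgue_integral_def
  proof (rule integral_dominated_convergence[where w = "\<lambda>y. indicator {\<rho>..} y *\<^sub>R y powr (- \<beta> - 1)"])
    show "integrable lborel (\<lambda>y. indicator {\<rho>..} y *\<^sub>R y powr (- \<beta> - 1))"
      using set_integrable_powr_tail(1) by (simp add: set_integrable_def)
    show "AE y in lborel. (\<lambda>n. indicator {\<rho>..} y *\<^sub>R (exp (- x n * y) * y powr (- \<beta> - 1)))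
        \<longlonglongrightarrow> indicator {\<rho>..} y *\<^sub>R (exp (- a * y) * y powr (- \<beta> - 1))"
      by (intro AE_I2 tendsto_intros a)
    have "x n \<ge> 0" for n using a(2) by (auto intro: less_imp_le)
    thus "AE y in lborel. norm (indicator {\<rho>..} y *\<^sub>R (exp (- x n * y) * y powr (- \<beta> - 1)))
        \<le> indicator {\<rho>..} y *\<^sub>R y powr (- \<beta> - 1)" for n
      using \<rho> by (auto simp: indicator_def abs_mult intro!: AE_I2 mult_left_le_one_le)
  qed auto
qed

lemma upper_incomplete_gamma_eq:
  assumes s: "s > 0"
  shows "upper_incomplete_gamma (- \<beta>) (\<rho> * s) = s powr (- \<beta>) * tail_integral s"
proof -
  have "upper_incomplete_gamma (- \<beta>) (\<rho> * s) =
      s * (\<integral>y. indicator {\<rho> * s..} (s * y) * (exp (- (s * y)) * (s * y) powr (- \<beta> - 1)) \<partial>lborel)"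
    unfolding upper_incomplete_gamma_def set_lebesgue_integral_def
    using s by (subst lborel_integral_real_affine[of s _ 0]) auto
  also have "(\<lambda>y. indicator {\<rho> * s..} (s * y) * (exp (- (s * y)) * (s * y) powr (- \<beta> - 1))) =
      (\<lambda>y. s powr (- \<beta> - 1) * (indicator {\<rho>..} y * (exp (- s * y) * y powr (- \<beta> - 1))))"
    using s \<rho> by (auto simp: indicator_def powr_mult fun_eq_iff mult.commute[of \<rho>])
  also have "s * (\<integral>y. s powr (- \<beta> - 1) * (indicator {\<rho>..} y * (exp (- s * y) * y powr (- \<beta> - 1))) \<partial>lborel)
      = (s * s powr (- \<beta> - 1)) * tail_integral s"
    by (simp add: tail_integral_def set_lebesgue_integral_def)
  also have "s * s powr (- \<beta> - 1) = s powr (- \<beta>)"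
    using s by (simp add: powr_diff)
  finally show ?thesis .
qed

lemma Gamma_one_minus_pos: "Gamma (1 - \<beta>) > 0" using \<beta> by (simp add: Gamma_real_pos)

lemma tempered_kernel_eq:
  "s > 0 \<Longrightarrow> tempered_kernel \<beta> \<rho> s = \<beta> * \<rho> powr \<beta> / Gamma (1 - \<beta>) * (s powr (- \<beta>) * tail_integral s)"
  by (simp add: tempered_kernel_def upper_incomplete_gamma_eq)

lemma tempered_kernel_bound:
  assumes "s > 0"
  shows "\<bar>tempered_kernel \<beta> \<rho> s\<bar> \<le> (1 / Gamma (1 - \<beta>)) * s powr (- \<beta>)"
proof -
  have "\<bar>tempered_kernel \<beta> \<rho> s\<bar> = \<beta> * \<rho> powr \<beta> / Gamma (1 - \<beta>) * (s powr (- \<beta>) * tail_integral s)"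
    using \<beta> \<rho> assms tail_integral_bounds[of s] Gamma_one_minus_pos
    by (simp add: tempered_kernel_eq abs_mult)
  also have "\<dots> \<le> \<beta> * \<rho> powr \<beta> / Gamma (1 - \<beta>) * (s powr (- \<beta>) * (\<rho> powr (- \<beta>) / \<beta>))"
    using \<beta> \<rho> assms tail_integral_bounds[of s] Gamma_one_minus_pos
    by (intro mult_left_mono) auto
  also have "\<dots> = (1 / Gamma (1 - \<beta>)) * s powr (- \<beta>)"
    using \<beta> \<rho> by (simp add: powr_minus field_simps)
  finally show ?thesis .
qed

lemma continuous_on_tempered_kernel: "continuous_on {0<..} (tempered_kernel \<beta> \<rho>)"
proof -
  have "continuous_on {0<..} (\<lambda>s. \<beta> * \<rho> powr \<beta> / Gamma (1 - \<beta>) * (s powr (- \<beta>) * tail_integral s))"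
    by (intro continuous_intros continuous_on_tail_integral) auto
  thus ?thesis by (rule continuous_on_eq) (simp add: tempered_kernel_eq)
qed

text \<open>
  Exchanging the integrals over \<open>s\<close> and \<open>y\<close> and computing the inner one by Euler's formula leaves
  \<open>\<integral> y^(-\<beta> - 1) (\<theta> + y)^(\<beta> - 1) dy\<close> over \<open>y \<ge> \<rho>\<close>; its integrand is an exact derivative, a multiple
  of that of \<open>((\<theta> + y) / y)^\<beta>\<close>.
\<close>
lemma has_laplace_tempered_kernel:
  assumes \<theta>: "\<theta> > 0"
  shows "has_laplace (tempered_kernel \<beta> \<rho>) \<theta> (((\<theta> + \<rho>) powr \<beta> - \<rho> powr \<beta>) / \<theta>)"
proof -
  define c where "c = \<beta> * \<rho> powr \<beta> / Gamma (1 - \<beta>)"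
  have c: "c > 0" using \<beta> \<rho> Gamma_one_minus_pos by (simp add: c_def)
  define h where "h y s = indicator {0<..} s * (exp (- (\<theta> + y) * s) * s powr ((1 - \<beta>) - 1))" for y s :: real
  define g where "g s = indicator {0<..} s * (exp (- \<theta> * s) * (s powr (- \<beta>) * tail_integral s))" for s
  define I where "I = Gamma (1 - \<beta>) / (\<beta> * \<theta>) * (((\<theta> + \<rho>) / \<rho>) powr \<beta> - 1)"
  have I: "I \<ge> 0" unfolding I_def using \<beta> \<theta> \<rho> Gamma_one_minus_pos
    by (intro mult_nonneg_nonneg) (auto intro!: ge_one_powr_ge_zero)
  have h_nn: "(\<integral>\<^sup>+ s. ennreal (h y s) \<partial>lborel) = ennreal (Gamma (1 - \<beta>) * (\<theta> + y) powr (\<beta> - 1))" if y: "y > 0" for y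
  proof -
    have "integrable lborel (h y)" "integral\<^sup>L lborel (h y) = Gamma (1 - \<beta>) / (\<theta> + y) powr (1 - \<beta>)"
      using has_laplace_powr[of "1 - \<beta>" "\<theta> + y"] \<beta> \<theta> y
      by (auto simp: has_laplace_def set_integrable_def set_lebesgue_integral_def h_def[abs_def])
    moreover have "(\<theta> + y) powr (\<beta> - 1) = 1 / (\<theta> + y) powr (1 - \<beta>)"
      using powr_minus_divide[of "\<theta> + y" "1 - \<beta>"] by simp
    ultimately have "integrable lborel (h y)" "integral\<^sup>L lborel (h y) = Gamma (1 - \<beta>) * (\<theta> + y) powr (\<beta> - 1)"
      by simp_all
    moreover have "AE s in lborel. 0 \<le> h y s" by (auto simp: h_def)
    ultimately show ?thesis using nn_integral_eq_integral by metis
  qed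
  have g_nn: "ennreal (g s) = (\<integral>\<^sup>+ y. ennreal (indicator {\<rho>..} y * y powr (- \<beta> - 1) * h y s) \<partial>lborel)" for s
  proof (cases "s > 0")
    case True
    have "(\<integral>\<^sup>+ y. ennreal (indicator {\<rho>..} y * y powr (- \<beta> - 1) * h y s) \<partial>lborel) =
      (\<integral>\<^sup>+ y. ennreal ((exp (- \<theta> * s) * s powr (- \<beta>)) * (indicator {\<rho>..} y *\<^sub>R (exp (- s * y) * y powr (- \<beta> - 1)))) \<partial>lborel)"
      using True by (intro nn_integral_cong arg_cong[of _ _ ennreal]) (auto simp: h_def exp_add[symmetric] algebra_simps)
    also have "\<dots> = ennreal (\<integral>y. (exp (- \<theta> * s) * s powr (- \<beta>)) * (indicator {\<rho>..} y *\<^sub>R (exp (- s * y) * y powr (- \<beta> - 1))) \<partial>lborel)"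
      using tail_integrable[of s] True
      by (intro nn_integral_eq_integral) (auto simp: set_integrable_def intro!: AE_I2)
    also have "\<dots> = ennreal (g s)" using True
      unfolding g_def tail_integral_def set_lebesgue_integral_def by simp
    finally show ?thesis ..
  qed (simp add: g_def h_def)
  define F where "F y = - Gamma (1 - \<beta>) / (\<beta> * \<theta>) * ((\<theta> + y) / y) powr \<beta>" for y
  have F: "(\<integral>\<^sup>+ y. ennreal (y powr (- \<beta> - 1) * (Gamma (1 - \<beta>) * (\<theta> + y) powr (\<beta> - 1))) * indicator {\<rho>..} y \<partial>lborel)
      = ennreal (- Gamma (1 - \<beta>) / (\<beta> * \<theta>) - F \<rho>)"
  proof (rule nn_integral_FTC_atLeast)
    fix y assume "\<rho> \<le> y"
    hence y: "y > 0" using \<rho> by simp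
    define p q where "p = (\<theta> + y) powr (\<beta> - 1)" and "q = y powr (\<beta> - 1)"
    have pq: "p > 0" "q > 0" using y \<theta> by (auto simp: p_def q_def)
    have e: "((\<theta> + y) / y) powr (\<beta> - 1) = p / q"
      using y \<theta> by (simp add: p_def q_def powr_divide)
    have e2: "y powr (- \<beta> - 1) = 1 / (y * y * q)"
      using y by (simp add: q_def powr_diff powr_minus_divide)
    have "((\<lambda>y. (\<theta> + y) / y) has_real_derivative - \<theta> / (y * y)) (at y)"
      using y by (auto intro!: derivative_eq_intros simp: field_simps)
    from DERIV_fun_powr[OF this, of \<beta>]
    have "((\<lambda>y. ((\<theta> + y) / y) powr \<beta>) has_real_derivative \<beta> * (p / q) * (- \<theta> / (y * y))) (at y)"
      using y \<theta> by (simp add: e)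
    hence "(F has_real_derivative - Gamma (1 - \<beta>) / (\<beta> * \<theta>) * (\<beta> * (p / q) * (- \<theta> / (y * y)))) (at y)"
      unfolding F_def by (rule DERIV_cmult)
    moreover have "- Gamma (1 - \<beta>) / (\<beta> * \<theta>) * (\<beta> * (p / q) * (- \<theta> / (y * y)))
       = y powr (- \<beta> - 1) * (Gamma (1 - \<beta>) * (\<theta> + y) powr (\<beta> - 1))"
      unfolding e2 p_def[symmetric] using y \<theta> \<beta> pq by simp
    ultimately show "(F has_real_derivative y powr (- \<beta> - 1) * (Gamma (1 - \<beta>) * (\<theta> + y) powr (\<beta> - 1))) (at y)"
      by simp
  next
    have "((\<lambda>y. (\<theta> + y) / y) \<longlongrightarrow> 1) at_top" by real_asymp
    hence "((\<lambda>y. ((\<theta> + y) / y) powr \<beta>) \<longlongrightarrow> 1 powr \<beta>) at_top" by (intro tendsto_intros) auto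
    hence "(F \<longlongrightarrow> - Gamma (1 - \<beta>) / (\<beta> * \<theta>) * 1) at_top" unfolding F_def
      by (intro tendsto_intros) auto
    thus "(F \<longlongrightarrow> - Gamma (1 - \<beta>) / (\<beta> * \<theta>)) at_top" by simp
  qed (use \<rho> Gamma_one_minus_pos in auto)
  have "(\<integral>\<^sup>+ s. ennreal (g s) \<partial>lborel) =
     (\<integral>\<^sup>+ s. (\<integral>\<^sup>+ y. ennreal (indicator {\<rho>..} y * y powr (- \<beta> - 1) * h y s) \<partial>lborel) \<partial>lborel)"
    by (simp add: g_nn)
  also have "\<dots> = (\<integral>\<^sup>+ y. (\<integral>\<^sup>+ s. ennreal (indicator {\<rho>..} y * y powr (- \<beta> - 1) * h y s) \<partial>lborel) \<partial>lborel)"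
    by (rule lborel_pair.Fubini') (simp add: h_def)
  also have "\<dots> = (\<integral>\<^sup>+ y. ennreal (y powr (- \<beta> - 1) * (Gamma (1 - \<beta>) * (\<theta> + y) powr (\<beta> - 1))) * indicator {\<rho>..} y \<partial>lborel)"
  proof (rule nn_integral_cong)
    fix y :: real
    show "(\<integral>\<^sup>+ s. ennreal (indicator {\<rho>..} y * y powr (- \<beta> - 1) * h y s) \<partial>lborel) =
      ennreal (y powr (- \<beta> - 1) * (Gamma (1 - \<beta>) * (\<theta> + y) powr (\<beta> - 1))) * indicator {\<rho>..} y"
    proof (cases "y \<ge> \<rho>")
      case True
      hence "(\<integral>\<^sup>+ s. ennreal (indicator {\<rho>..} y * y powr (- \<beta> - 1) * h y s) \<partial>lborel) =
         ennreal (y powr (- \<beta> - 1)) * (\<integral>\<^sup>+ s. ennreal (h y s) \<partial>lborel)"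
        by (subst nn_integral_cmult[symmetric]) (auto simp: h_def ennreal_mult'' intro!: nn_integral_cong)
      also have "(\<integral>\<^sup>+ s. ennreal (h y s) \<partial>lborel) = ennreal (Gamma (1 - \<beta>) * (\<theta> + y) powr (\<beta> - 1))"
        using True \<rho> by (intro h_nn) auto
      also have "ennreal (y powr (- \<beta> - 1)) * \<dots> = ennreal (y powr (- \<beta> - 1) * (Gamma (1 - \<beta>) * (\<theta> + y) powr (\<beta> - 1)))"
        by (rule ennreal_mult'[symmetric]) simp
      finally show ?thesis using True by simp
    qed auto
  qed
  also have "\<dots> = ennreal I" unfolding F
    by (rule arg_cong[of _ _ ennreal]) (simp add: F_def I_def algebra_simps diff_divide_distrib)
  finally have nn: "(\<integral>\<^sup>+ s. ennreal (g s) \<partial>lborel) = ennreal I" .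
  have "g \<in> borel_measurable borel"
  proof -
    have "(\<lambda>s. indicator {0<..} s *\<^sub>R (exp (- \<theta> * s) * (s powr (- \<beta>) * tail_integral s))) \<in> borel_measurable borel"
      by (rule borel_measurable_continuous_on_indicator)
         (auto intro!: continuous_intros continuous_on_tail_integral)
    thus ?thesis by (simp add: g_def[abs_def])
  qed
  moreover have "g s \<ge> 0" for s using tail_integral_bounds(1)[of s] by (simp add: g_def indicator_def)
  ultimately have "has_bochner_integral lborel g I"
    by (intro has_bochner_integral_nn_integral nn I) auto
  hence "has_bochner_integral lborel (\<lambda>s. c * g s) (c * I)"
    by (intro has_bochner_integral_mult_right)
  moreover have "c * g s = indicator {0<..} s *\<^sub>R (exp (- \<theta> * s) *\<^sub>R tempered_kernel \<beta> \<rho> s)" for s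
    by (auto simp: g_def c_def tempered_kernel_eq indicator_def)
  moreover have "c * I = ((\<theta> + \<rho>) powr \<beta> - \<rho> powr \<beta>) / \<theta>"
  proof -
    have *: "b * r / G * (G / (b * t) * (X / r - 1)) = (X - r) / t"
      if "b > 0" "r > 0" "G > 0" "t > 0" for b r G t X :: real
      using that by (simp add: field_simps)
    have e: "((\<theta> + \<rho>) / \<rho>) powr \<beta> = (\<theta> + \<rho>) powr \<beta> / \<rho> powr \<beta>"
      using \<theta> \<rho> by (simp add: powr_divide)
    show ?thesis
      unfolding c_def I_def e by (rule *) (use \<beta> \<theta> \<rho> Gamma_one_minus_pos in auto)
  qed
  ultimately show ?thesis
    unfolding has_laplace_def set_integrable_def set_lebesgue_integral_def has_bochner_integral_iff by simp
qed

end

section \<open>Inverting the transform: from algebraic relations to fractional equations\<close>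

text \<open>
  Two functions with integrable power singularities at \<open>0\<close>. After rescaling to the unit interval their
  convolution becomes \<open>t\<close> times an integral dominated by a Beta integral, so it converges and is
  continuous at every \<open>t > 0\<close>.
\<close>
locale power_bounded_pair =
  fixes w :: "real \<Rightarrow> real" and v :: "real \<Rightarrow> 'b::{banach, second_countable_topology}"
    and \<beta> \<delta> A B K :: real
  assumes \<beta>: "\<beta> < 1" and \<delta>: "\<delta> > 0" and AB: "A \<ge> 0" "B \<ge> 0" and K: "K \<ge> 0"
    and w: "continuous_on {0<..} w" "\<And>s. s > 0 \<Longrightarrow> \<bar>w s\<bar> \<le> A * s powr (- \<beta>)"
    and v: "continuous_on {0<..} v" "\<And>s. s > 0 \<Longrightarrow> norm (v s) \<le> B * s powr (\<delta> - 1) * exp (K * s)"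
begin

definition rescaled :: "real \<Rightarrow> real \<Rightarrow> 'b" where
  "rescaled t x = indicator {0<..<1} x *\<^sub>R (w (t * x) *\<^sub>R v (t * (1 - x)))"

definition beta_weight :: "real \<Rightarrow> real" where
  "beta_weight x = indicator {0..1} x *\<^sub>R (x powr ((1 - \<beta>) - 1) * (1 - x) powr (\<delta> - 1))"

lemma rescaled_measurable: "t > 0 \<Longrightarrow> rescaled t \<in> borel_measurable borel"
  unfolding rescaled_def
  by (rule borel_measurable_continuous_on_indicator)
     (auto intro!: continuous_intros continuous_on_compose2[OF w(1)] continuous_on_compose2[OF v(1)])

lemma beta_weight: "integrable lborel beta_weight" "beta_weight x \<ge> 0"
  using integrable_Beta[of "1 - \<beta>" \<delta>] \<beta> \<delta> by (auto simp: set_integrable_def beta_weight_def[abs_def])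

lemma rescaled_bound:
  assumes t: "t > 0"
  shows "norm (rescaled t x) \<le> A * B * t powr (\<delta> - 1 - \<beta>) * exp (K * t) * beta_weight x"
proof (cases "x \<in> {0<..<1}")
  case True
  have "\<bar>w (t * x)\<bar> * norm (v (t * (1 - x))) \<le>
      (A * (t * x) powr (- \<beta>)) * (B * (t * (1 - x)) powr (\<delta> - 1) * exp (K * (t * (1 - x))))"
    using True t AB by (intro mult_mono w v) auto
  also have "\<dots> \<le> (A * (t * x) powr (- \<beta>)) * (B * (t * (1 - x)) powr (\<delta> - 1) * exp (K * t))"
    using True t AB K by (intro mult_left_mono) (auto intro!: mult_left_mono mult_left_le)
  also have "\<dots> = A * B * t powr (\<delta> - 1 - \<beta>) * exp (K * t) * beta_weight x"
    using True t by (simp add: beta_weight_def powr_mult powr_diff powr_minus_divide mult_ac)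
  finally show ?thesis using True by (simp add: rescaled_def)
next
  case False
  thus ?thesis using t AB beta_weight(2)[of x] by (auto simp: rescaled_def)
qed

lemma rescaled_integrable: 
  assumes "t > 0"
  shows "integrable lborel (rescaled t)"
  by (rule Bochner_Integration.integrable_bound[of _ "\<lambda>x. A * B * t powr (\<delta> - 1 - \<beta>) * exp (K * t) * beta_weight x"])
     (use rescaled_measurable[OF assms] rescaled_bound[OF assms] beta_weight in
       \<open>auto intro!: AE_I2 order.trans[OF _ abs_ge_self]\<close>)

lemma rescaled_affine:
  assumes "t > 0"
  shows "indicator {0<..<t} (0 + t * x) *\<^sub>R (w (0 + t * x) *\<^sub>R v (t - (0 + t * x))) = rescaled t x"
  using assms by (auto simp: rescaled_def indicator_def algebra_simps zero_less_mult_iff)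

lemma set_integrable_convolution:
  assumes t: "t > 0"
  shows "set_integrable lborel {0<..<t} (\<lambda>s. w s *\<^sub>R v (t - s))"
proof -
  have "integrable lborel (\<lambda>x. indicator {0<..<t} (0 + t * x) *\<^sub>R (w (0 + t * x) *\<^sub>R v (t - (0 + t * x))))"
    unfolding rescaled_affine[OF t] by (rule rescaled_integrable[OF t])
  thus ?thesis unfolding set_integrable_def
    using t by (subst (asm) lborel_integrable_real_affine_iff) auto
qed

lemma convolution_pos_eq:
  assumes t: "t > 0"
  shows "convolution_pos w v t = t *\<^sub>R (\<integral>x. rescaled t x \<partial>lborel)"
  unfolding convolution_pos_def set_lebesgue_integral_def
  using t by (subst lborel_integral_real_affine[of t _ 0]) (auto simp only: rescaled_affine[OF t] abs_of_pos)

lemma continuous_on_convolution_pos: "continuous_on {0<..} (convolution_pos w v)"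
proof -
  have *: "continuous_on {a<..<b} (\<lambda>t. \<integral>x. rescaled t x \<partial>lborel)" if a: "a > 0" for a b
    unfolding continuous_on_sequentially o_def
  proof (intro allI ballI impI, elim conjE)
    fix t :: "nat \<Rightarrow> real" and c assume c: "c \<in> {a<..<b}" "\<forall>n. t n \<in> {a<..<b}" "t \<longlonglongrightarrow> c"
    have "compact {a..b}" by simp
    moreover have "continuous_on {a..b} (\<lambda>t. A * B * t powr (\<delta> - 1 - \<beta>) * exp (K * t))"
      using a by (intro continuous_intros) auto
    ultimately have "bounded ((\<lambda>t. A * B * t powr (\<delta> - 1 - \<beta>) * exp (K * t)) ` {a..b})"
      by (intro compact_imp_bounded compact_continuous_image)
    then obtain M where "\<forall>y\<in>(\<lambda>t. A * B * t powr (\<delta> - 1 - \<beta>) * exp (K * t)) ` {a..b}. norm y \<le> M"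
      unfolding bounded_iff by blast
    hence M: "\<bar>A * B * t powr (\<delta> - 1 - \<beta>) * exp (K * t)\<bar> \<le> M" if "t \<in> {a..b}" for t
      using that unfolding ball_simps real_norm_def by blast
    show "(\<lambda>n. \<integral>x. rescaled (t n) x \<partial>lborel) \<longlonglongrightarrow> (\<integral>x. rescaled c x \<partial>lborel)"
    proof (rule integral_dominated_convergence[where w = "\<lambda>x. M * beta_weight x"])
      show "integrable lborel (\<lambda>x. M * beta_weight x)" using beta_weight by simp
      show "AE x in lborel. norm (rescaled (t n) x) \<le> M * beta_weight x" for n
      proof (rule AE_I2)
        fix x
        have tn: "t n > 0" "t n \<in> {a..b}" using c(2) a by (auto intro: less_imp_le) (metis greaterThanLessThan_iff less_trans)
        show "norm (rescaled (t n) x) \<le> M * beta_weight x"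
          by (rule order.trans[OF rescaled_bound[OF tn(1)] mult_right_mono[OF order.trans[OF abs_ge_self M[OF tn(2)]] beta_weight(2)]])
      qed
      have cont: "isCont w s" "isCont v s" if "s > 0" for s
        using that w(1) v(1) by (auto intro!: continuous_on_interior[of "{0<..}"] simp: interior_open)
      show "AE x in lborel. (\<lambda>n. rescaled (t n) x) \<longlonglongrightarrow> rescaled c x"
      proof (rule AE_I2)
        fix x
        show "(\<lambda>n. rescaled (t n) x) \<longlonglongrightarrow> rescaled c x"
        proof (cases "x \<in> {0<..<1}")
          case True
          have "c > 0" using c a by auto
          hence "(\<lambda>n. w (t n * x)) \<longlonglongrightarrow> w (c * x)" "(\<lambda>n. v (t n * (1 - x))) \<longlonglongrightarrow> v (c * (1 - x))"
            using True by (auto intro!: isCont_tendsto_compose[OF cont(1)] isCont_tendsto_compose[OF cont(2)] tendsto_intros c)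
          thus ?thesis unfolding rescaled_def by (intro tendsto_intros)
        qed (simp add: rescaled_def)
      qed
      have "t n > 0" "c > 0" for n using c a by (auto intro: less_trans)
      thus "rescaled c \<in> borel_measurable lborel" "\<And>n. rescaled (t n) \<in> borel_measurable lborel"
        using rescaled_measurable by auto
    qed
  qed
  have "continuous_on (\<Union>c\<in>{0<..}. {c/2<..<c+1}) (\<lambda>t. \<integral>x. rescaled t x \<partial>lborel)"
    by (rule continuous_on_open_UN) (use * in auto)
  moreover have "(\<Union>c\<in>{0<..}. {c/2<..<c+1}) = ({0<..} :: real set)" (is "?U = _")
  proof (intro equalityI subsetI)
    fix c :: real assume "c \<in> {0<..}"
    hence "c \<in> {c/2<..<c+1}" by auto
    thus "c \<in> ?U" using \<open>c \<in> {0<..}\<close> by blast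
  qed auto
  ultimately have "continuous_on {0<..} (\<lambda>t. \<integral>x. rescaled t x \<partial>lborel)" by simp
  hence "continuous_on {0<..} (\<lambda>t. t *\<^sub>R (\<integral>x. rescaled t x \<partial>lborel))" by (intro continuous_intros)
  thus ?thesis by (rule continuous_on_eq) (simp add: convolution_pos_eq)
qed

end

text \<open>
  The fundamental theorem of calculus for an integrand that may be singular at the left end point:
  split the integral at \<open>t / 2\<close>.
\<close>
lemma has_vector_derivative_set_integral:
  fixes v :: "real \<Rightarrow> 'b::euclidean_space"
  assumes int: "\<And>t. t > 0 \<Longrightarrow> set_integrable lborel {0<..<t} v"
    and cont: "continuous_on {0<..} v" and t: "t > 0"
  shows "((\<lambda>t. LBINT s:{0<..<t}. v s) has_vector_derivative v t) (at t)"
proof -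
  define a where "a = t / 2"
  have a: "0 < a" "a < t" using t by (auto simp: a_def)
  have ca: "continuous_on {a..t+1} v" using a by (intro continuous_on_subset[OF cont]) auto
  have "((\<lambda>u. integral {a..u} v) has_vector_derivative v t) (at t within {a..t+1})"
    using a by (intro integral_has_vector_derivative[OF ca]) auto
  hence "((\<lambda>u. integral {a..u} v) has_vector_derivative v t) (at t)"
    using a by (subst (asm) at_within_interior) auto
  hence "((\<lambda>u. (LBINT s:{0<..<a}. v s) + integral {a..u} v) has_vector_derivative v t) (at t)"
    by (auto intro!: derivative_eq_intros)
  moreover have "(LBINT s:{0<..<a}. v s) + integral {a..u} v = (LBINT s:{0<..<u}. v s)" if u: "u \<in> {a<..<t+1}" for u
  proof -
    have i1: "set_integrable lborel {0<..<a} v" by (rule int) (use a in auto)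
    have i2: "set_integrable lborel {a..<u} v"
      by (rule set_integrable_subset[OF int[of u]]) (use a u in auto)
    have i3: "set_integrable lborel {a..u} v"
      by (rule borel_integrable_atLeastAtMost') (use a u in \<open>auto intro: continuous_on_subset[OF ca]\<close>)
    have "{0<..<u} = {0<..<a} \<union> {a..<u}" using a u by auto
    hence "(LBINT s:{0<..<u}. v s) = (LBINT s:{0<..<a}. v s) + (LBINT s:{a..<u}. v s)"
      using set_integral_Un[OF _ i1 i2] by (simp add: disjoint_iff)
    also have "(LBINT s:{a..<u}. v s) = (LBINT s:{a..u}. v s)"
      using i2 i3 AE_lborel_singleton[of u] by (intro set_integral_cong_set)
         (auto simp: set_borel_measurable_def set_integrable_def dest: borel_measurable_integrable elim: eventually_mono)
    also have "\<dots> = integral {a..u} v" by (rule set_borel_integral_eq_integral(2)[OF i3])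
    finally show ?thesis by simp
  qed
  ultimately show ?thesis
    using a by (elim has_vector_derivative_transform_within_open[of _ _ _ "{a<..<t+1}"]) auto
qed

lemma fps_coefficient_bound:
  fixes B :: "'b::{banach, real_normed_field} fps"
  assumes "fps_conv_radius B > 0"
  obtains C R where "R > 0" "\<And>m. norm (fps_nth B m) \<le> C * R ^ m"
proof -
  obtain r :: real where r: "0 < r" "ereal r < fps_conv_radius B"
    using assms ereal_dense2[of 0 "fps_conv_radius B"] by auto
  have "summable (\<lambda>m. fps_nth B m * of_real r ^ m)"
    by (rule summable_fps) (use r in auto)
  hence "(\<lambda>m. fps_nth B m * of_real r ^ m) \<longlonglongrightarrow> 0" by (rule summable_LIMSEQ_zero)
  hence "Bseq (\<lambda>m. fps_nth B m * of_real r ^ m)" by (intro convergent_imp_Bseq) (auto simp: convergent_def)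
  then obtain C where C: "\<And>m. norm (fps_nth B m * of_real r ^ m) \<le> C" unfolding Bseq_def by blast
  have "norm (fps_nth B m) \<le> C * (1 / r) ^ m" for m
    using C[of m] r by (simp add: norm_mult norm_power field_simps power_one_over)
  thus thesis using r by (intro that[of "1/r" C]) auto
qed

text \<open>
  The Laplace exponent of the tempered stable subordinator; for \<open>\<beta> = 1\<close> this is \<open>\<theta>\<close>, the exponent of
  the deterministic process \<open>H(t) = t\<close>.
\<close>
definition tempered_exponent :: "real \<Rightarrow> real \<Rightarrow> real \<Rightarrow> real" where
  "tempered_exponent \<beta> \<rho> \<theta> = (\<theta> + \<rho>) powr \<beta> - \<rho> powr \<beta>"

text \<open>
  The class of functions to which the inversion applies: for large \<open>\<theta>\<close>, \<open>\<theta>\<close> times the transform is a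
  power series in \<open>(\<theta> + \<rho>)^(-\<alpha>)\<close> with positive radius of convergence.
\<close>
definition laplace_expansion ::
    "real \<Rightarrow> real \<Rightarrow> (real \<Rightarrow> 'b::{euclidean_space, real_normed_field}) \<Rightarrow> 'b fps \<Rightarrow> bool" where
  "laplace_expansion \<alpha> \<rho> y Y \<longleftrightarrow> fps_conv_radius Y > 0 \<and>
     (\<forall>\<^sub>F \<theta> in at_top. has_laplace y \<theta> (eval_fps Y (of_real ((\<theta> + \<rho>) powr (- \<alpha>))) / of_real \<theta>))"

text \<open>
  The power series \<open>1 + x - c x^2\<close> to which the exponent of the sum of the subordinators is equal up to
  the factor \<open>x^2\<close>.
\<close>
definition exponent_fps :: "real \<Rightarrow> real \<Rightarrow> 'b::{euclidean_space, real_normed_field} fps" where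
  "exponent_fps \<alpha> \<rho> = 1 + fps_X - fps_const (of_real (\<rho> powr (2 * \<alpha>) + \<rho> powr \<alpha>)) * fps_X ^ 2"

lemma exponent_fps_expansion:
  "(\<lambda>x. 1 + x - of_real (\<rho> powr (2 * \<alpha>) + \<rho> powr \<alpha>) * x ^ 2) has_fps_expansion exponent_fps \<alpha> \<rho>"
  unfolding exponent_fps_def by (intro fps_expansion_intros)

lemma exponent_fps_nth_0: "fps_nth (exponent_fps \<alpha> \<rho>) 0 = 1"
  by (simp add: exponent_fps_def)

lemma tendsto_shifted_powr:
  assumes "\<alpha> > 0"
  shows "((\<lambda>\<theta>. of_real ((\<theta> + \<rho>) powr (- \<alpha>)) :: 'b::real_normed_algebra_1) \<longlongrightarrow> 0) at_top"
proof -
  have "((\<lambda>\<theta>. (\<theta> + \<rho>) powr (- \<alpha>)) \<longlongrightarrow> 0) at_top" using assms by real_asymp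
  from tendsto_of_real[OF this, where ?'a = 'b] show ?thesis by simp
qed

lemma eventually_eval_fps:
  assumes "\<alpha> > 0" "f has_fps_expansion F"
  shows "\<forall>\<^sub>F \<theta> in at_top. eval_fps F (of_real ((\<theta> + \<rho>) powr (- \<alpha>))) = f (of_real ((\<theta> + \<rho>) powr (- \<alpha>)))"
  using assms filterlim_iff[THEN iffD1, OF tendsto_shifted_powr[OF assms(1)]]
  unfolding has_fps_expansion_def by blast

lemma exponent_factorization:
  fixes x :: real
  assumes "\<theta> + \<rho> > 0" "x = (\<theta> + \<rho>) powr (- \<alpha>)"
  shows "(tempered_exponent (2 * \<alpha>) \<rho> \<theta> + tempered_exponent \<alpha> \<rho> \<theta>) * x ^ 2
    = 1 + x - (\<rho> powr (2 * \<alpha>) + \<rho> powr \<alpha>) * x ^ 2"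
proof -
  have x: "(\<theta> + \<rho>) powr \<alpha> * x = 1" using assms by (simp add: powr_minus)
  have "(\<theta> + \<rho>) powr (2 * \<alpha>) = ((\<theta> + \<rho>) powr \<alpha>) ^ 2"
    by (simp add: power2_eq_square powr_add[symmetric])
  hence "(\<theta> + \<rho>) powr (2 * \<alpha>) * x ^ 2 = 1" using x by (metis power_mult_distrib power_one)
  moreover have "(\<theta> + \<rho>) powr \<alpha> * x ^ 2 = x" using x by (simp add: power2_eq_square)
  ultimately show ?thesis by (simp add: tempered_exponent_def algebra_simps)
qed

lemma filterlim_exponent_at_top:
  assumes "\<alpha> > 0"
  shows "filterlim (\<lambda>\<theta>. tempered_exponent (2 * \<alpha>) \<rho> \<theta> + tempered_exponent \<alpha> \<rho> \<theta>) at_top at_top"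
  unfolding tempered_exponent_def using assms by real_asymp

text \<open>
  The passage from the algebraic relation \<open>f (y^ - y0 / \<theta>) = r^\<close>, here solved for \<open>y^\<close>, to the fractional
  equation at every \<open>t > 0\<close>. The series \<open>B = R / (1 + x - c x^2)\<close> satisfies \<open>\<theta> y^ - y0 = x^2 B(x)\<close>; the
  factor \<open>x^2\<close> is the reason why the derivative of \<open>y\<close> is of order \<open>t^(2\<alpha> - 1)\<close> near \<open>0\<close>.
\<close>
theorem tempered_caputo_from_laplace:
  fixes y r :: "real \<Rightarrow> 'b::{euclidean_space, real_normed_field}"
  assumes \<alpha>: "0 < \<alpha>" "\<alpha> \<le> 1/2" and \<rho>: "\<rho> > 0"
    and ly: "\<And>t. t > 0 \<Longrightarrow> continuous (at_left t) y" and lr: "\<And>t. t > 0 \<Longrightarrow> continuous (at_left t) r"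
    and R: "laplace_expansion \<alpha> \<rho> r R"
    and y: "\<forall>\<^sub>F \<theta> in at_top. has_laplace y \<theta> ((y0 + eval_fps R (of_real ((\<theta> + \<rho>) powr (- \<alpha>))) /
        of_real (tempered_exponent (2 * \<alpha>) \<rho> \<theta> + tempered_exponent \<alpha> \<rho> \<theta>)) / of_real \<theta>)"
    and t: "t > 0"
  shows "tempered_caputo_differentiable (2 * \<alpha>) \<rho> y t" "tempered_caputo_differentiable \<alpha> \<rho> y t"
    "tempered_caputo (2 * \<alpha>) \<rho> y t + tempered_caputo \<alpha> \<rho> y t = r t"
proof -
  define f where "f \<theta> = tempered_exponent (2 * \<alpha>) \<rho> \<theta> + tempered_exponent \<alpha> \<rho> \<theta>" for \<theta>
  define c where "c = \<rho> powr (2 * \<alpha>) + \<rho> powr \<alpha>"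
  define x where "x \<theta> = (\<theta> + \<rho>) powr (- \<alpha>)" for \<theta>
  define B where "B = R * inverse (exponent_fps \<alpha> \<rho>)"
  have expB: "(\<lambda>z. eval_fps R z * inverse (1 + z - of_real c * z ^ 2)) has_fps_expansion B"
    unfolding B_def c_def using R
    by (intro fps_expansion_intros exponent_fps_expansion eval_fps_has_fps_expansion)
       (auto simp: exponent_fps_nth_0 laplace_expansion_def)
  hence radB: "fps_conv_radius B > 0" by (simp add: has_fps_expansion_def)
  obtain C0 R0 where R0: "R0 > 0" "\<And>m. norm (fps_nth B m) \<le> C0 * R0 ^ m"
    using fps_coefficient_bound[OF radB] by blast
  interpret fs: fractional_series \<alpha> "2 * \<alpha>" C0 R0 "fps_nth B"
    using \<alpha> R0 by unfold_locales auto
  define V where "V t = exp (- \<rho> * t) *\<^sub>R (t powr (2 * \<alpha> - 1) *\<^sub>R fs.series t)" for t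
  have contV: "continuous_on {0<..} V"
    unfolding V_def by (intro continuous_intros fs.continuous_on_series) auto
  have boundV: "norm (V s) \<le> fs.total * s powr (2 * \<alpha> - 1) * exp (fs.growth * s)" if s: "s > 0" for s
  proof -
    have "norm (V s) = exp (- \<rho> * s) * (s powr (2 * \<alpha> - 1) * norm (fs.series s))"
      by (simp add: V_def)
    also have "\<dots> \<le> 1 * (s powr (2 * \<alpha> - 1) * (fs.total * exp (fs.growth * s)))"
      using s \<rho> by (intro mult_mono fs.series_bound) auto
    finally show ?thesis by (simp add: mult_ac)
  qed
  define Vh where "Vh \<theta> = eval_fps R (of_real (x \<theta>)) / of_real (f \<theta>)" for \<theta>
  have small: "\<forall>\<^sub>F \<theta> in at_top. norm (of_real (x \<theta>) :: 'b) < fps_conv_radius B"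
  proof -
    obtain e :: real where e: "0 < e" "ereal e < fps_conv_radius B"
      using radB ereal_dense2[of 0 "fps_conv_radius B"] by auto
    have "\<forall>\<^sub>F \<theta> in at_top. dist (of_real (x \<theta>) :: 'b) 0 < e"
      unfolding x_def using tendstoD[OF tendsto_shifted_powr[OF \<alpha>(1)] e(1)] .
    thus ?thesis by eventually_elim (use e in \<open>auto intro: less_trans[of _ "ereal e"]\<close>)
  qed
  have lapV: "\<forall>\<^sub>F \<theta> in at_top. has_laplace V \<theta> (Vh \<theta>)"
    using eventually_gt_at_top[of fs.growth] small eventually_eval_fps[OF \<alpha>(1) expB, of \<rho>]
  proof eventually_elim
    case (elim \<theta>)
    have th: "\<theta> > 0" "\<theta> + \<rho> > fs.growth" using elim(1) fs.growth(1) \<rho> by auto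
    have x0: "x \<theta> > 0" using th \<rho> by (simp add: x_def)
    have pw: "(\<theta> + \<rho>) powr (- (\<alpha> * real m + 2 * \<alpha>)) = x \<theta> ^ 2 * x \<theta> ^ m" for m
    proof -
      have "x \<theta> ^ 2 * x \<theta> ^ m = x \<theta> powr real (2 + m)"
        using x0 by (simp only: powr_realpow power_add)
      also have "\<dots> = (\<theta> + \<rho>) powr (- \<alpha> * real (2 + m))" by (simp add: x_def powr_powr)
      also have "- \<alpha> * real (2 + m) = - (\<alpha> * real m + 2 * \<alpha>)" by (simp add: algebra_simps)
      finally show ?thesis ..
    qed
    have "(\<Sum>m. (\<theta> + \<rho>) powr (- (\<alpha> * real m + 2 * \<alpha>)) *\<^sub>R fps_nth B m)
        = (\<Sum>m. of_real (x \<theta> ^ 2) * (fps_nth B m * of_real (x \<theta>) ^ m))"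
      unfolding pw by (simp add: scaleR_conv_of_real mult_ac)
    also have "\<dots> = of_real (x \<theta> ^ 2) * eval_fps B (of_real (x \<theta>))"
      unfolding eval_fps_def by (rule suminf_mult) (rule summable_fps[OF elim(2)])
    also have "eval_fps B (of_real (x \<theta>)) = eval_fps R (of_real (x \<theta>)) * inverse (1 + of_real (x \<theta>) - of_real c * of_real (x \<theta>) ^ 2)"
      using elim(3) by (simp add: x_def)
    also have "1 + of_real (x \<theta>) - of_real c * of_real (x \<theta>) ^ 2 = (of_real (f \<theta> * x \<theta> ^ 2) :: 'b)"
      using exponent_factorization[of \<theta> \<rho> "x \<theta>" \<alpha>] th \<rho> by (simp add: f_def c_def x_def)
    also have "of_real (x \<theta> ^ 2) * (eval_fps R (of_real (x \<theta>)) * inverse (of_real (f \<theta> * x \<theta> ^ 2))) = Vh \<theta>"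
      using x0 by (simp add: Vh_def field_simps)
    finally have sum: "(\<Sum>m. (\<theta> + \<rho>) powr (- (\<alpha> * real m + 2 * \<alpha>)) *\<^sub>R fps_nth B m) = Vh \<theta>" .
    show "has_laplace V \<theta> (Vh \<theta>)"
      unfolding V_def has_laplace_shift using fs.has_laplace_series[OF th(2)] unfolding sum .
  qed
  have fnz: "\<forall>\<^sub>F \<theta> in at_top. f \<theta> > 0"
    using filterlim_exponent_at_top[OF \<alpha>(1), of \<rho>] unfolding f_def filterlim_at_top_dense by blast

  \<comment> \<open>The primitive of \<open>V\<close> is its convolution with \<open>1\<close>, so its transform is \<open>Vh \<theta> / \<theta>\<close>.\<close>
  define z where "z = convolution_pos (\<lambda>_. 1) V"
  interpret one: power_bounded_pair "\<lambda>_. 1" V 0 "2 * \<alpha>" 1 fs.total fs.growth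
    using \<alpha> contV boundV fs.total_nonneg fs.growth(1) by unfold_locales auto
  have zeq: "z t = (LBINT s:{0<..<t}. V s)" for t
  proof -
    have "z t = (\<integral>s. indicator {0<..<t} (t + (-1) * s) *\<^sub>R V (t - (t + (-1) * s)) \<partial>lborel)"
      unfolding z_def convolution_pos_def set_lebesgue_integral_def
      by (subst lborel_integral_real_affine[of "-1" _ t]) auto
    also have "(\<lambda>s. indicator {0<..<t} (t + (-1) * s) *\<^sub>R V (t - (t + (-1) * s))) = (\<lambda>s. indicator {0<..<t} s *\<^sub>R V s)"
      by (auto simp: indicator_def fun_eq_iff)
    finally show ?thesis by (simp add: set_lebesgue_integral_def)
  qed
  have intV: "set_integrable lborel {0<..<t} V" if t: "t > 0" for t
  proof -
    have "integrable lborel (\<lambda>s. indicator {0<..<t} s *\<^sub>R V (t - s))"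
      using one.set_integrable_convolution[OF t] by (simp add: set_integrable_def)
    from lborel_integrable_real_affine[OF this, of "-1" t]
    have "integrable lborel (\<lambda>s. indicator {0<..<t} (t - s) *\<^sub>R V s)" by simp
    moreover have "(\<lambda>s. indicator {0<..<t} (t - s) *\<^sub>R V s) = (\<lambda>s. indicator {0<..<t} s *\<^sub>R V s)"
      by (auto simp: indicator_def fun_eq_iff)
    ultimately show ?thesis by (simp add: set_integrable_def)
  qed
  have dz: "(z has_vector_derivative V t) (at t)" if "t > 0" for t
    unfolding zeq[abs_def] by (rule has_vector_derivative_set_integral[OF intV contV that])
  have lapdiff: "\<forall>\<^sub>F \<theta> in at_top. has_laplace (\<lambda>t. y t - (y0 + z t)) \<theta> 0"
    using y lapV eventually_gt_at_top[of 0]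
  proof eventually_elim
    case (elim \<theta>)
    have 1: "has_laplace z \<theta> ((1 / \<theta>) *\<^sub>R Vh \<theta>)"
      unfolding z_def by (intro has_laplace_convolution_pos has_laplace_one elim)
    have 2: "has_laplace (\<lambda>_. y0) \<theta> ((1 / \<theta>) *\<^sub>R y0)"
      using has_laplace_bounded_linear[OF bounded_linear_scaleR_left[of y0] has_laplace_one[OF elim(3)]] by simp
    have "has_laplace (\<lambda>t. y t - (y0 + z t)) \<theta> ((y0 + Vh \<theta>) / of_real \<theta> - ((1 / \<theta>) *\<^sub>R y0 + (1 / \<theta>) *\<^sub>R Vh \<theta>))"
      using elim(1) unfolding Vh_def f_def x_def
      by (intro has_laplace_diff has_laplace_add 2 1[unfolded Vh_def f_def x_def])
    moreover have "(y0 + Vh \<theta>) / of_real \<theta> - ((1 / \<theta>) *\<^sub>R y0 + (1 / \<theta>) *\<^sub>R Vh \<theta>) = 0"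
      by (simp add: scaleR_conv_of_real add_divide_distrib)
    ultimately show ?case by simp
  qed
  then obtain \<theta>0 where \<theta>0: "\<And>\<theta>. \<theta> \<ge> \<theta>0 \<Longrightarrow> has_laplace (\<lambda>t. y t - (y0 + z t)) \<theta> 0"
    unfolding eventually_at_top_linorder by blast
  hence yz: "y t = y0 + z t" if t: "t > 0" for t
  proof -
    have "continuous (at_left t) z"
      by (rule continuous_at_imp_continuous_within[OF has_vector_derivative_continuous[OF dz[OF t]]])
    hence "continuous (at_left t) (\<lambda>t. y t - (y0 + z t))"
      by (intro continuous_intros ly t)
    with \<theta>0 have "y t - (y0 + z t) = 0" using t by (rule laplace_unique)
    thus ?thesis by simp
  qed
  have dy: "(y has_vector_derivative V t) (at t)" if t: "t > 0" for t
  proof -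
    have "((\<lambda>t. y0 + z t) has_vector_derivative V t) (at t)"
      using dz[OF t] by (auto intro!: derivative_eq_intros)
    thus ?thesis
      by (rule has_vector_derivative_transform_within_open[of _ _ _ "{0<..}"]) (use t yz in auto)
  qed

  \<comment> \<open>The two derivatives applied to \<open>y\<close>. For \<open>\<beta> = 1\<close> there is no kernel, but the transform
      obeys the same formula.\<close>
  define op where "op \<beta> t = (if \<beta> = 1 then V t else convolution_pos (tempered_kernel \<beta> \<rho>) V t)" for \<beta> t
  have op: "tempered_caputo_differentiable \<beta> \<rho> y t" (is ?diff) "tempered_caputo \<beta> \<rho> y t = op \<beta> t" (is ?eq)
    "isCont (op \<beta>) t" (is ?cont)
    if \<beta>: "0 < \<beta>" "\<beta> \<le> 1" and t: "t > 0" for \<beta> t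
  proof -
    have "?diff \<and> ?eq \<and> continuous_on {0<..} (op \<beta>)"
    proof (cases "\<beta> = 1")
      case True
      thus ?thesis using dy[OF t] contV
        by (auto simp: tempered_caputo_differentiable_def tempered_caputo_def op_def[abs_def] vector_derivative_at
            intro: differentiableI_vector)
    next
      case False
      with \<beta> have \<beta>': "0 < \<beta>" "\<beta> < 1" by auto
      interpret ker: power_bounded_pair "tempered_kernel \<beta> \<rho>" V \<beta> "2 * \<alpha>" "1 / Gamma (1 - \<beta>)" fs.total fs.growth
        using \<alpha> contV boundV fs.total_nonneg fs.growth(1) \<beta>' tempered_kernel_bound[OF \<beta>' \<rho>]
          continuous_on_tempered_kernel[OF \<beta>' \<rho>] Gamma_one_minus_pos[OF \<beta>' \<rho>]
        by unfold_locales auto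
      have vd: "vector_derivative y (at (t - s)) = V (t - s)" if "s \<in> {0<..<t}" for s
        using dy[of "t - s"] that by (auto intro: vector_derivative_at)
      have c: "\<beta> * \<rho> powr \<beta> / Gamma (1 - \<beta>) \<noteq> 0"
        using \<beta>' \<rho> less_imp_neq[OF Gamma_one_minus_pos[OF \<beta>' \<rho>]] by (simp del: Gamma_eq_zero_iff)
      have int: "set_integrable lborel {0<..<t} (\<lambda>s. upper_incomplete_gamma (- \<beta>) (\<rho> * s) *\<^sub>R V (t - s))"
      proof -
        have "upper_incomplete_gamma (- \<beta>) (\<rho> * s) *\<^sub>R V (t - s)
            = (1 / (\<beta> * \<rho> powr \<beta> / Gamma (1 - \<beta>))) *\<^sub>R (tempered_kernel \<beta> \<rho> s *\<^sub>R V (t - s))" for s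
          unfolding tempered_kernel_def scaleR_scaleR mult.assoc[symmetric]
          by (simp only: nonzero_eq_divide_eq[OF c, symmetric] times_divide_eq_left mult_1 divide_self[OF c])
        thus ?thesis using set_integrable_scaleR_right[OF ker.set_integrable_convolution[OF t]] by presburger
      qed
      have "set_integrable lborel {0<..<t}
          (\<lambda>s. upper_incomplete_gamma (- \<beta>) (\<rho> * s) *\<^sub>R vector_derivative y (at (t - s)))"
        using int by (rule set_integrable_cong[THEN iffD1, rotated -1]) (simp_all add: vd)
      moreover have "y differentiable at s" if "s > 0" for s
        using dy[OF that] by (rule differentiableI_vector)
      ultimately have "?diff"
        unfolding tempered_caputo_differentiable_def using False by simp
      moreover have "?eq"
        unfolding tempered_caputo_def op_def convolution_pos_def tempered_kernel_def scaleR_scaleR[symmetric] set_integral_scaleR_right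
        using False by (auto intro!: arg_cong2[of _ _ _ _ scaleR] set_lebesgue_integral_cong simp: vd)
      moreover have "continuous_on {0<..} (op \<beta>)"
        using False ker.continuous_on_convolution_pos by (simp add: op_def[abs_def])
      ultimately show ?thesis by blast
    qed
    thus ?diff ?eq ?cont using t by (auto intro!: continuous_on_interior[of "{0<..}"] simp: interior_open)
  qed
  have lapop: "\<forall>\<^sub>F \<theta> in at_top. has_laplace (op \<beta>) \<theta> ((tempered_exponent \<beta> \<rho> \<theta> / \<theta>) *\<^sub>R Vh \<theta>)"
    if \<beta>: "0 < \<beta>" "\<beta> \<le> 1" for \<beta>
    using lapV eventually_gt_at_top[of 0]
  proof eventually_elim
    case (elim \<theta>)
    show ?case
    proof (cases "\<beta> = 1")
      case True
      thus ?thesis using elim \<rho> by (simp add: op_def[abs_def] tempered_exponent_def)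
    next
      case False
      hence "has_laplace (tempered_kernel \<beta> \<rho>) \<theta> (((\<theta> + \<rho>) powr \<beta> - \<rho> powr \<beta>) / \<theta>)"
        using \<beta> \<rho> elim by (intro has_laplace_tempered_kernel) auto
      from has_laplace_convolution_pos[OF this elim(1)] False show ?thesis
        by (simp add: op_def[abs_def] tempered_exponent_def)
    qed
  qed
  show "tempered_caputo_differentiable (2 * \<alpha>) \<rho> y t" "tempered_caputo_differentiable \<alpha> \<rho> y t"
    by (rule op(1); use \<alpha> t in simp)+
  have "\<forall>\<^sub>F \<theta> in at_top. has_laplace r \<theta> (eval_fps R (of_real (x \<theta>)) / of_real \<theta>)"
    using R by (simp add: laplace_expansion_def x_def)
  moreover have "\<forall>\<^sub>F \<theta> in at_top. has_laplace (op (2 * \<alpha>)) \<theta> ((tempered_exponent (2 * \<alpha>) \<rho> \<theta> / \<theta>) *\<^sub>R Vh \<theta>)"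
    by (rule lapop) (use \<alpha> in auto)
  moreover have "\<forall>\<^sub>F \<theta> in at_top. has_laplace (op \<alpha>) \<theta> ((tempered_exponent \<alpha> \<rho> \<theta> / \<theta>) *\<^sub>R Vh \<theta>)"
    by (rule lapop) (use \<alpha> in auto)
  ultimately have "\<forall>\<^sub>F \<theta> in at_top. has_laplace (\<lambda>t. (op (2 * \<alpha>) t + op \<alpha> t) - r t) \<theta> 0"
    using fnz eventually_gt_at_top[of 0]
  proof eventually_elim
    case (elim \<theta>)
    have "(tempered_exponent (2 * \<alpha>) \<rho> \<theta> / \<theta>) *\<^sub>R Vh \<theta> + (tempered_exponent \<alpha> \<rho> \<theta> / \<theta>) *\<^sub>R Vh \<theta>
        = (f \<theta> / \<theta>) *\<^sub>R Vh \<theta>"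
      by (simp add: f_def add_divide_distrib scaleR_add_left)
    also have "\<dots> = eval_fps R (of_real (x \<theta>)) / of_real \<theta>"
      using elim by (simp add: Vh_def scaleR_conv_of_real)
    finally show ?case
      using has_laplace_diff[OF has_laplace_add[OF elim(2,3)] elim(1)] by simp
  qed
  then obtain \<theta>1 where "\<And>\<theta>. \<theta> \<ge> \<theta>1 \<Longrightarrow> has_laplace (\<lambda>t. (op (2 * \<alpha>) t + op \<alpha> t) - r t) \<theta> 0"
    unfolding eventually_at_top_linorder by blast
  moreover have "continuous (at_left t) (\<lambda>t. (op (2 * \<alpha>) t + op \<alpha> t) - r t)"
    using \<alpha> t by (intro continuous_intros lr continuous_at_imp_continuous_within[OF op(3)]) auto
  ultimately have "(op (2 * \<alpha>) t + op \<alpha> t) - r t = 0" using t by (rule laplace_unique)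
  thus "tempered_caputo (2 * \<alpha>) \<rho> y t + tempered_caputo \<alpha> \<rho> y t = r t"
    using op(2)[of "2 * \<alpha>" t] op(2)[of \<alpha> t] \<alpha> t by simp
qed

section \<open>The generalized counting process at a fixed time\<close>

locale generalized_counting = prob_space P for P :: "'a measure" +
  fixes k :: nat and lam :: "nat \<Rightarrow> real" and M :: "real \<Rightarrow> 'a \<Rightarrow> nat"
  assumes gcp: "generalized_counting_process P k lam M"
    and lam: "\<And>j. j \<in> {1..k} \<Longrightarrow> 0 < lam j"
begin

text \<open>
  The function \<open>\<psi>(u)\<close> with \<open>E u^M(s) = exp (-s \<psi>(u))\<close>.
\<close>
definition rate :: "complex \<Rightarrow> complex" where
  "rate u = (\<Sum>j=1..k. of_real (lam j) * (1 - u ^ j))"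

lemma M_real_measurable [measurable]: "0 \<le> t \<Longrightarrow> (\<lambda>\<omega>. real (M t \<omega>)) \<in> borel_measurable P"
  using gcp by (auto simp: generalized_counting_process_def increasing_levy_process_def)

lemma M_measurable [measurable]: "0 \<le> t \<Longrightarrow> M t \<in> measurable P (count_space UNIV)"
proof -
  assume [arith]: "0 \<le> t"
  have "(\<lambda>\<omega>. nat \<lfloor>real (M t \<omega>)\<rfloor>) \<in> measurable P (count_space UNIV)" by measurable
  thus ?thesis by simp
qed

lemma M_mono: "\<omega> \<in> space P \<Longrightarrow> 0 \<le> s \<Longrightarrow> s \<le> t \<Longrightarrow> M s \<omega> \<le> M t \<omega>"
  using gcp by (auto simp: generalized_counting_process_def increasing_levy_process_def mono_on_def)

lemma M_right_continuous: 
  assumes "\<omega> \<in> space P" "0 \<le> t"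
  shows "\<forall>\<^sub>F s in at_right t. M s \<omega> = M t \<omega>"
proof -
  have "((\<lambda>s. real (M s \<omega>)) \<longlongrightarrow> real (M t \<omega>)) (at_right t)"
    using gcp assms by (auto simp: generalized_counting_process_def increasing_levy_process_def continuous_within)
  hence "\<forall>\<^sub>F s in at_right t. dist (real (M s \<omega>)) (real (M t \<omega>)) < 1" by (rule tendstoD) simp
  thus ?thesis by eventually_elim (auto simp: dist_real_def)
qed

lemma M_0: "AE \<omega> in P. M 0 \<omega> = 0"
  using gcp by (auto simp: generalized_counting_process_def increasing_levy_process_def)

lemma nat_floor_diff: "b \<le> a \<Longrightarrow> nat \<lfloor>real a - real b\<rfloor> = a - b"
  by (metis floor_of_nat nat_int of_nat_diff)

lemma M_increment_distr:
  assumes "0 \<le> s" "0 \<le> h"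
  shows "distr P (count_space UNIV) (\<lambda>\<omega>. M (s + h) \<omega> - M s \<omega>) = distr P (count_space UNIV) (M h)"
proof -
  have "distr P borel (\<lambda>\<omega>. real (M (s + h) \<omega>) - real (M s \<omega>)) = distr P borel (\<lambda>\<omega>. real (M h \<omega>) - real (M 0 \<omega>))"
    using gcp assms by (auto simp: generalized_counting_process_def increasing_levy_process_def stationary_increments_def)
  hence "distr (distr P borel (\<lambda>\<omega>. real (M (s + h) \<omega>) - real (M s \<omega>))) (count_space UNIV) (\<lambda>x. nat \<lfloor>x\<rfloor>)
      = distr (distr P borel (\<lambda>\<omega>. real (M h \<omega>) - real (M 0 \<omega>))) (count_space UNIV) (\<lambda>x. nat \<lfloor>x\<rfloor>)" by simp
  hence "distr P (count_space UNIV) (\<lambda>\<omega>. nat \<lfloor>real (M (s + h) \<omega>) - real (M s \<omega>)\<rfloor>)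
      = distr P (count_space UNIV) (\<lambda>\<omega>. nat \<lfloor>real (M h \<omega>) - real (M 0 \<omega>)\<rfloor>)"
    using assms by (subst (asm) (1 2) distr_distr) (auto simp: o_def)
  moreover have "distr P (count_space UNIV) (\<lambda>\<omega>. nat \<lfloor>real (M (s + h) \<omega>) - real (M s \<omega>)\<rfloor>)
      = distr P (count_space UNIV) (\<lambda>\<omega>. M (s + h) \<omega> - M s \<omega>)"
    using assms M_mono[of _ s "s + h"] by (intro distr_cong) (auto simp: nat_floor_diff)
  moreover have "distr P (count_space UNIV) (\<lambda>\<omega>. nat \<lfloor>real (M h \<omega>) - real (M 0 \<omega>)\<rfloor>) = distr P (count_space UNIV) (M h)"
    using assms M_0 by (intro distr_cong_AE) (auto elim!: eventually_mono)
  ultimately show ?thesis by simp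
qed

lemma integrable_of_M:
  fixes \<phi> :: "nat \<Rightarrow> complex"
  assumes "\<And>n. norm (\<phi> n) \<le> B" "N \<in> measurable P (count_space UNIV)"
  shows "integrable P (\<lambda>\<omega>. \<phi> (N \<omega>))"
  by (rule integrable_const_bound[of _ B]) (use assms in auto)

text \<open>
  The jump rates are the derivatives of the one-dimensional laws at time \<open>0\<close>. Splitting according to
  the value of \<open>M h\<close>, and using \<open>u^0 - 1 = 0\<close>, only values \<open>1, ..., k\<close> contribute to first order.
\<close>
lemma pgf_small_time:
  assumes u: "norm u \<le> 1"
  shows "((\<lambda>h. (expectation (\<lambda>\<omega>. u ^ M h \<omega>) - 1) / of_real h) \<longlongrightarrow> - rate u) (at_right 0)"
proof -
  define a where "a j h = prob {\<omega> \<in> space P. M h \<omega> = j}" for j h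
  define b where "b h = prob {\<omega> \<in> space P. M h \<omega> > k}" for h
  have un: "norm (u ^ n) \<le> 1" for n using u by (simp add: norm_power power_le_one)
  have lim_a: "((\<lambda>h. a j h / h) \<longlongrightarrow> lam j) (at_right 0)" if "j \<in> {1..k}" for j
  proof -
    have "(\<lambda>h. a j h - lam j * h) \<in> o[at_right 0](\<lambda>h. h)"
      using gcp that unfolding generalized_counting_process_def a_def by blast
    hence "((\<lambda>h. (a j h - lam j * h) / h) \<longlongrightarrow> 0) (at_right 0)" by (rule smalloD_tendsto)
    hence "((\<lambda>h. (a j h - lam j * h) / h + lam j) \<longlongrightarrow> 0 + lam j) (at_right 0)" by (intro tendsto_intros)
    moreover have "\<forall>\<^sub>F h in at_right 0. (a j h - lam j * h) / h + lam j = a j h / h"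
      using eventually_at_right_less[of "0::real"] by eventually_elim (simp add: field_simps)
    ultimately have "((\<lambda>h. a j h / h) \<longlongrightarrow> 0 + lam j) (at_right 0)" by (rule Lim_transform_eventually)
    thus ?thesis by simp
  qed
  have lim_b: "((\<lambda>h. b h / h) \<longlongrightarrow> 0) (at_right 0)"
    using gcp unfolding generalized_counting_process_def b_def by (intro smalloD_tendsto) blast
  define e where "e h = expectation (\<lambda>\<omega>. indicator {\<omega>. M h \<omega> > k} \<omega> *\<^sub>R (u ^ M h \<omega> - 1))" for h
  have eq: "expectation (\<lambda>\<omega>. u ^ M h \<omega>) - 1 = (\<Sum>j=1..k. of_real (a j h) * (u ^ j - 1)) + e h"
    and e: "norm (e h) \<le> 2 * b h" if h: "h > 0" for h
  proof -
    have [measurable]: "M h \<in> measurable P (count_space UNIV)" using h by simp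
    have i0: "integrable P (\<lambda>\<omega>. u ^ M h \<omega>)" by (rule integrable_of_M[of _ 1]) (use un in auto)
    have "integrable P (\<lambda>\<omega>. indicator {n. n > k} (M h \<omega>) *\<^sub>R (u ^ M h \<omega> - 1))"
    proof (rule integrable_of_M[of "\<lambda>n. indicator {n. n > k} n *\<^sub>R (u ^ n - 1)" 2])
      show "norm (indicator {n. n > k} n *\<^sub>R (u ^ n - 1)) \<le> 2" for n
        using norm_triangle_ineq4[of "u ^ n" 1] un[of n] by (auto simp: indicator_def)
    qed simp
    hence i1: "integrable P (\<lambda>\<omega>. indicator {\<omega>. M h \<omega> > k} \<omega> *\<^sub>R (u ^ M h \<omega> - 1))"
      by (simp add: indicator_def)
    have i2: "integrable P (\<lambda>\<omega>. indicator {\<omega>\<in>space P. M h \<omega> = j} \<omega> *\<^sub>R (u ^ j - 1))" for j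
    proof -
      have ev: "{\<omega>\<in>space P. M h \<omega> = j} \<in> events" by measurable
      show ?thesis by (rule integrable_scaleR_left, rule integrable_real_indicator[OF ev]) (simp add: emeasure_finite less_top[symmetric])
    qed
    have "u ^ M h \<omega> - 1 = (\<Sum>j=1..k. indicator {\<omega>\<in>space P. M h \<omega> = j} \<omega> *\<^sub>R (u ^ j - 1))
        + indicator {\<omega>. M h \<omega> > k} \<omega> *\<^sub>R (u ^ M h \<omega> - 1)" if w: "\<omega> \<in> space P" for \<omega>
    proof (cases "M h \<omega> \<in> {1..k}")
      case True
      have "(\<Sum>j=1..k. indicator {\<omega>\<in>space P. M h \<omega> = j} \<omega> *\<^sub>R (u ^ j - 1)) =
          (\<Sum>j=1..k. if j = M h \<omega> then u ^ j - 1 else 0)"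
        using w by (intro sum.cong) (auto simp: indicator_def)
      thus ?thesis using True by simp
    next
      case False
      hence "M h \<omega> = 0 \<or> M h \<omega> > k" by auto
      moreover have "(\<Sum>j=1..k. indicator {\<omega>\<in>space P. M h \<omega> = j} \<omega> *\<^sub>R (u ^ j - 1)) = 0"
        using False by (intro sum.neutral) (auto simp: indicator_def)
      ultimately show ?thesis by (auto simp: indicator_def)
    qed
    hence "expectation (\<lambda>\<omega>. u ^ M h \<omega> - 1) = expectation (\<lambda>\<omega>. (\<Sum>j=1..k. indicator {\<omega>\<in>space P. M h \<omega> = j} \<omega> *\<^sub>R (u ^ j - 1))
        + indicator {\<omega>. M h \<omega> > k} \<omega> *\<^sub>R (u ^ M h \<omega> - 1))"
      by (intro Bochner_Integration.integral_cong) auto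
    also have "\<dots> = (\<Sum>j=1..k. expectation (\<lambda>\<omega>. indicator {\<omega>\<in>space P. M h \<omega> = j} \<omega> *\<^sub>R (u ^ j - 1))) + e h"
      unfolding e_def Bochner_Integration.integral_add[OF Bochner_Integration.integrable_sum[OF i2] i1]
      by (simp only: Bochner_Integration.integral_sum[OF i2])
    also have "(\<Sum>j=1..k. expectation (\<lambda>\<omega>. indicator {\<omega>\<in>space P. M h \<omega> = j} \<omega> *\<^sub>R (u ^ j - 1))) =
        (\<Sum>j=1..k. of_real (a j h) * (u ^ j - 1))"
      by (intro sum.cong) (auto simp: a_def scaleR_conv_of_real)
    also have "expectation (\<lambda>\<omega>. u ^ M h \<omega> - 1) = expectation (\<lambda>\<omega>. u ^ M h \<omega>) - 1"
      using i0 by (simp add: prob_space)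
    finally show "expectation (\<lambda>\<omega>. u ^ M h \<omega>) - 1 = (\<Sum>j=1..k. of_real (a j h) * (u ^ j - 1)) + e h" .
    have "norm (e h) \<le> expectation (\<lambda>\<omega>. norm (indicator {\<omega>. M h \<omega> > k} \<omega> *\<^sub>R (u ^ M h \<omega> - 1)))"
      unfolding e_def by (rule integral_norm_bound)
    also have "\<dots> \<le> expectation (\<lambda>\<omega>. 2 * indicator {\<omega>\<in>space P. M h \<omega> > k} \<omega>)"
    proof (rule integral_mono[OF integrable_norm[OF i1]])
      have ev: "{\<omega>\<in>space P. M h \<omega> > k} \<in> events" by measurable
      show "integrable P (\<lambda>\<omega>. 2 * indicator {\<omega>\<in>space P. M h \<omega> > k} \<omega> :: real)"
        by (intro integrable_mult_right integrable_real_indicator[OF ev])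
           (simp add: emeasure_finite less_top[symmetric])
    next
      fix \<omega> assume "\<omega> \<in> space P"
      moreover have "norm (u ^ M h \<omega> - 1) \<le> 2"
        using norm_triangle_ineq4[of "u ^ M h \<omega>" 1] un[of "M h \<omega>"] by simp
      ultimately show "norm (indicator {\<omega>. M h \<omega> > k} \<omega> *\<^sub>R (u ^ M h \<omega> - 1)) \<le> 2 * indicator {\<omega>\<in>space P. M h \<omega> > k} \<omega>"
        by (auto simp: indicator_def)
    qed
    also have "\<dots> = 2 * b h" by (simp add: b_def)
    finally show "norm (e h) \<le> 2 * b h" .
  qed
  have "((\<lambda>h. e h / of_real h) \<longlongrightarrow> 0) (at_right 0)"
  proof (rule Lim_null_comparison)
    show "\<forall>\<^sub>F h in at_right 0. norm (e h / of_real h) \<le> 2 * (b h / h)"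
      using eventually_at_right_less[of "0::real"]
      by eventually_elim (use e in \<open>auto simp: norm_divide field_simps\<close>)
    show "((\<lambda>h. 2 * (b h / h)) \<longlongrightarrow> 0) (at_right 0)" using tendsto_mult[OF tendsto_const lim_b, of 2] by simp
  qed
  moreover have "((\<lambda>h. \<Sum>j=1..k. of_real (a j h / h) * (u ^ j - 1)) \<longlongrightarrow> (\<Sum>j=1..k. of_real (lam j) * (u ^ j - 1))) (at_right 0)"
    by (intro tendsto_intros lim_a) auto
  ultimately have "((\<lambda>h. (\<Sum>j=1..k. of_real (a j h / h) * (u ^ j - 1)) + e h / of_real h) \<longlongrightarrow>
      (\<Sum>j=1..k. of_real (lam j) * (u ^ j - 1)) + 0) (at_right 0)" by (intro tendsto_add)
  moreover have "(\<Sum>j=1..k. of_real (lam j) * (u ^ j - 1)) = - rate u"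
    by (simp add: rate_def sum_negf[symmetric] algebra_simps)
  moreover have "\<forall>\<^sub>F h in at_right 0. (\<Sum>j=1..k. of_real (a j h / h) * (u ^ j - 1)) + e h / of_real h
      = (expectation (\<lambda>\<omega>. u ^ M h \<omega>) - 1) / of_real h"
    using eventually_at_right_less[of "0::real"]
    by eventually_elim (simp add: eq add_divide_distrib sum_divide_distrib)
  ultimately show ?thesis using Lim_transform_eventually by fastforce
qed

text \<open>
  \<open>M s\<close> is the sum of \<open>n\<close> independent increments, each distributed as \<open>M (s / n)\<close>.
\<close>
lemma pgf_power:
  fixes u :: complex
  assumes u: "norm u \<le> 1" and s: "s > 0" and n: "n > 0"
  shows "expectation (\<lambda>\<omega>. u ^ M s \<omega>) = expectation (\<lambda>\<omega>. u ^ M (s / real n) \<omega>) ^ n"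
proof -
  define h where "h = s / real n"
  define \<tau> where "\<tau> i = real i * h" for i
  have h: "h > 0" "real n * h = s" using s n by (auto simp: h_def)
  have \<tau>: "\<tau> i \<ge> 0" "\<tau> (Suc i) = \<tau> i + h" for i using h by (auto simp: \<tau>_def algebra_simps)
  have un: "norm (u ^ n) \<le> 1" for n using u by (simp add: norm_power power_le_one)
  have ind: "indep_vars (\<lambda>_. borel) (\<lambda>i \<omega>. real (M (\<tau> (Suc i)) \<omega>) - real (M (\<tau> i) \<omega>)) {..<n}"
  proof -
    have "independent_increments P (\<lambda>t \<omega>. real (M t \<omega>))"
      using gcp unfolding generalized_counting_process_def increasing_levy_process_def by blast
    moreover have "\<forall>i<n. \<tau> i < \<tau> (Suc i)" using h(1) \<tau>(2) by simp
    ultimately show ?thesis using \<tau>(1)[of 0] unfolding independent_increments_def by blast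
  qed
  have "indep_vars (\<lambda>_. borel) (\<lambda>i. (\<lambda>x. u ^ nat \<lfloor>x\<rfloor>) \<circ> (\<lambda>\<omega>. real (M (\<tau> (Suc i)) \<omega>) - real (M (\<tau> i) \<omega>))) {..<n}"
    by (rule indep_vars_compose[OF ind]) simp
  hence ind2: "indep_vars (\<lambda>_. borel) (\<lambda>i \<omega>. u ^ nat \<lfloor>real (M (\<tau> (Suc i)) \<omega>) - real (M (\<tau> i) \<omega>)\<rfloor>) {..<n}"
    by (simp add: o_def)
  have inc: "u ^ nat \<lfloor>real (M (\<tau> (Suc i)) \<omega>) - real (M (\<tau> i) \<omega>)\<rfloor> = u ^ (M (\<tau> i + h) \<omega> - M (\<tau> i) \<omega>)"
    if "\<omega> \<in> space P" for i \<omega>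
    using M_mono[OF that, of "\<tau> i" "\<tau> i + h"] \<tau> h by (simp add: nat_floor_diff)
  have int: "integrable P (\<lambda>\<omega>. u ^ nat \<lfloor>real (M (\<tau> (Suc i)) \<omega>) - real (M (\<tau> i) \<omega>)\<rfloor>)" for i
    by (rule integrable_of_M[of "\<lambda>n. u ^ n" 1]) (use un \<tau>(1) in auto)
  have prod: "(\<Prod>i<m. u ^ (M (\<tau> i + h) \<omega> - M (\<tau> i) \<omega>)) = u ^ (M (\<tau> m) \<omega> - M (\<tau> 0) \<omega>)" if w: "\<omega> \<in> space P" for m \<omega>
  proof (induction m)
    case (Suc m)
    have "M (\<tau> 0) \<omega> \<le> M (\<tau> m) \<omega>" "M (\<tau> m) \<omega> \<le> M (\<tau> m + h) \<omega>"
      using \<tau> h by (auto intro!: M_mono[OF w] simp: \<tau>_def)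
    thus ?case using Suc by (simp add: power_add[symmetric] \<tau>)
  qed simp
  have "expectation (\<lambda>\<omega>. u ^ M s \<omega>) = expectation (\<lambda>\<omega>. \<Prod>i<n. u ^ nat \<lfloor>real (M (\<tau> (Suc i)) \<omega>) - real (M (\<tau> i) \<omega>)\<rfloor>)"
  proof (rule integral_cong_AE)
    show "AE \<omega> in P. u ^ M s \<omega> = (\<Prod>i<n. u ^ nat \<lfloor>real (M (\<tau> (Suc i)) \<omega>) - real (M (\<tau> i) \<omega>)\<rfloor>)"
      using M_0 AE_space
    proof eventually_elim
      case (elim \<omega>)
      have "(\<Prod>i<n. u ^ nat \<lfloor>real (M (\<tau> (Suc i)) \<omega>) - real (M (\<tau> i) \<omega>)\<rfloor>) = u ^ (M (\<tau> n) \<omega> - M (\<tau> 0) \<omega>)"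
        unfolding prod[OF elim(2), symmetric] by (intro prod.cong refl inc elim)
      moreover have "\<tau> n = s" "\<tau> 0 = 0" using h by (auto simp: \<tau>_def)
      ultimately show ?case using elim(1) by simp
    qed
    show "(\<lambda>\<omega>. \<Prod>i<n. u ^ nat \<lfloor>real (M (\<tau> (Suc i)) \<omega>) - real (M (\<tau> i) \<omega>)\<rfloor>) \<in> borel_measurable P"
      by (intro borel_measurable_prod borel_measurable_integrable int)
  qed (use s in auto)
  also have "\<dots> = (\<Prod>i<n. expectation (\<lambda>\<omega>. u ^ nat \<lfloor>real (M (\<tau> (Suc i)) \<omega>) - real (M (\<tau> i) \<omega>)\<rfloor>))"
    by (rule indep_vars_lebesgue_integral[OF _ ind2 int]) simp
  also have "\<dots> = (\<Prod>i<n. expectation (\<lambda>\<omega>. u ^ M h \<omega>))"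
  proof (rule prod.cong)
    fix i
    have "expectation (\<lambda>\<omega>. u ^ nat \<lfloor>real (M (\<tau> (Suc i)) \<omega>) - real (M (\<tau> i) \<omega>)\<rfloor>)
       = expectation (\<lambda>\<omega>. u ^ (M (\<tau> i + h) \<omega> - M (\<tau> i) \<omega>))"
      by (rule Bochner_Integration.integral_cong) (auto simp: inc)
    also have "\<dots> = integral\<^sup>L (distr P (count_space UNIV) (\<lambda>\<omega>. M (\<tau> i + h) \<omega> - M (\<tau> i) \<omega>)) (\<lambda>n. u ^ n)"
      using \<tau> h by (subst integral_distr) (auto simp: add_nonneg_nonneg)
    also have "\<dots> = expectation (\<lambda>\<omega>. u ^ M h \<omega>)"
      using \<tau> h by (subst M_increment_distr) (auto simp: integral_distr)
    finally show "expectation (\<lambda>\<omega>. u ^ nat \<lfloor>real (M (\<tau> (Suc i)) \<omega>) - real (M (\<tau> i) \<omega>)\<rfloor>) = expectation (\<lambda>\<omega>. u ^ M h \<omega>)" .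
  qed simp
  finally show ?thesis by (simp add: h_def)
qed

lemma Re_rate_nonneg:
  assumes "norm u \<le> 1"
  shows "Re (rate u) \<ge> 0"
proof -
  have "Re (u ^ j) \<le> 1" for j
    using complex_Re_le_cmod[of "u ^ j"] assms power_le_one[of "norm u" j] by (simp add: norm_power)
  hence "lam j * (1 - Re (u ^ j)) \<ge> 0" if "j \<in> {1..k}" for j
    using lam[OF that] by (intro mult_nonneg_nonneg) auto
  thus ?thesis unfolding rate_def Re_sum by (intro sum_nonneg) simp
qed

text \<open>
  Both sides are \<open>n\<close>-th powers of their values at \<open>s / n\<close>, which differ by \<open>o (1 / n)\<close>, and all these
  values lie in the unit disc, so the \<open>n\<close>-th powers differ by at most \<open>n o (1 / n)\<close>.
\<close>
lemma pgf_eq: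
  assumes u: "norm u \<le> 1" and s: "s \<ge> 0"
  shows "expectation (\<lambda>\<omega>. u ^ M s \<omega>) = exp (- (rate u * of_real s))"
proof (cases "s = 0")
  case True
  have "expectation (\<lambda>\<omega>. u ^ M 0 \<omega>) = expectation (\<lambda>\<omega>. 1)"
    using M_0 by (intro integral_cong_AE) (auto elim!: eventually_mono)
  thus ?thesis using True by (simp add: prob_space)
next
  case False
  with s have s: "s > 0" by simp
  define ch where "ch s = expectation (\<lambda>\<omega>. u ^ M s \<omega>)" for s
  define E where "E h = exp (- (rate u * of_real h))" for h
  have un: "norm (u ^ n) \<le> 1" for n using u by (simp add: norm_power power_le_one)
  have ch1: "norm (ch h) \<le> 1" if "h \<ge> 0" for h
  proof -
    have "norm (ch h) \<le> expectation (\<lambda>\<omega>. norm (u ^ M h \<omega>))" unfolding ch_def by (rule integral_norm_bound)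
    also have "\<dots> \<le> expectation (\<lambda>_. 1)"
      by (rule integral_mono) (use un that in \<open>auto intro!: integrable_norm integrable_of_M[of _ 1]\<close>)
    finally show ?thesis by (simp add: prob_space)
  qed
  have E1: "norm (E h) \<le> 1" if "h \<ge> 0" for h
    using Re_rate_nonneg[OF u] that by (simp add: E_def)
  have E2: "E s = E (s / real n) ^ n" if "n > 0" for n
    using that by (simp add: E_def exp_of_nat_mult[symmetric])
  have dE: "((\<lambda>h. (E h - 1) / of_real h) \<longlongrightarrow> - rate u) (at_right 0)"
  proof -
    have "((\<lambda>z. exp (- (rate u * z))) has_field_derivative - rate u) (at 0)"
      by (auto intro!: derivative_eq_intros)
    hence l: "((\<lambda>z. (exp (- (rate u * z)) - 1) / z) \<longlongrightarrow> - rate u) (at 0)"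
      by (simp add: DERIV_def)
    have "filterlim (\<lambda>h. complex_of_real h) (at 0) (at_right 0)"
      unfolding filterlim_at using eventually_at_right_less[of "0::real"]
      by (auto elim: eventually_mono intro!: tendsto_eq_intros)
    from filterlim_compose[OF l this] show ?thesis by (simp add: E_def)
  qed
  have "((\<lambda>h. (ch h - 1) / of_real h - (E h - 1) / of_real h) \<longlongrightarrow> - rate u - (- rate u)) (at_right 0)"
    unfolding ch_def by (intro tendsto_diff pgf_small_time u dE)
  hence lim: "((\<lambda>h. norm ((ch h - E h) / of_real h)) \<longlongrightarrow> 0) (at_right 0)"
    by (intro tendsto_norm_zero) (simp add: diff_divide_distrib)
  have fl: "filterlim (\<lambda>n. s / real n) (at_right 0) sequentially" using s by real_asymp
  have "(\<lambda>n. norm ((ch (s / real n) - E (s / real n)) / of_real (s / real n))) \<longlonglongrightarrow> 0"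
    by (rule filterlim_compose[OF lim fl])
  hence "(\<lambda>n. s * norm ((ch (s / real n) - E (s / real n)) / of_real (s / real n))) \<longlonglongrightarrow> 0"
    using tendsto_mult[OF tendsto_const[of s]] by fastforce
  moreover have "\<forall>\<^sub>F n in sequentially. norm (ch s - E s) \<le> s * norm ((ch (s / real n) - E (s / real n)) / of_real (s / real n))"
    using eventually_gt_at_top[of 0]
  proof eventually_elim
    case (elim n)
    have "ch s - E s = ch (s / real n) ^ n - E (s / real n) ^ n"
      using pgf_power[OF u s, of n] elim E2[of n] by (simp add: ch_def)
    also have "norm \<dots> \<le> real n * norm (ch (s / real n) - E (s / real n))"
      by (rule norm_power_diff) (use ch1 E1 s in auto)
    also have "\<dots> = s * norm ((ch (s / real n) - E (s / real n)) / of_real (s / real n))"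
      using s elim by (simp add: norm_divide norm_mult)
    finally show ?case .
  qed
  ultimately have "norm (ch s - E s) \<le> 0"
    by (rule tendsto_lowerbound) simp
  thus ?thesis by (simp add: ch_def E_def)
qed

definition mean_at :: "(nat \<Rightarrow> complex) \<Rightarrow> real \<Rightarrow> complex" where
  "mean_at \<phi> s = expectation (\<lambda>\<omega>. \<phi> (M s \<omega>))"

lemma mean_at_bound:
  assumes "\<And>n. norm (\<phi> n) \<le> B" "0 \<le> s"
  shows "norm (mean_at \<phi> s) \<le> B"
proof -
  have "norm (mean_at \<phi> s) \<le> expectation (\<lambda>\<omega>. norm (\<phi> (M s \<omega>)))"
    unfolding mean_at_def by (rule integral_norm_bound)
  also have "\<dots> \<le> expectation (\<lambda>_. B)"
    by (rule integral_mono) (use assms in \<open>auto intro!: integrable_norm integrable_of_M\<close>)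
  finally show ?thesis by (simp add: prob_space)
qed

text \<open>
  The value \<open>u = 0\<close> of the generating function is the probability of no jump.
\<close>
lemma prob_jump:
  assumes "0 \<le> s" "0 \<le> h"
  shows "prob {\<omega> \<in> space P. M (s + h) \<omega> \<noteq> M s \<omega>} = 1 - exp (- ((\<Sum>j=1..k. lam j) * h))"
proof -
  have sh: "0 \<le> s + h" using assms by simp
  note [measurable] = M_measurable[OF assms(1)] M_measurable[OF assms(2)] M_measurable[OF sh]
  have "prob {\<omega> \<in> space P. M (s + h) \<omega> \<noteq> M s \<omega>} = measure (distr P (count_space UNIV) (\<lambda>\<omega>. M (s + h) \<omega> - M s \<omega>)) {n. n \<noteq> 0}"
  proof (subst measure_distr)
    show "prob {\<omega> \<in> space P. M (s + h) \<omega> \<noteq> M s \<omega>} = prob ((\<lambda>\<omega>. M (s + h) \<omega> - M s \<omega>) -` {n. n \<noteq> 0} \<inter> space P)"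
      using M_mono[of _ s "s + h"] assms by (intro arg_cong[of _ _ prob]) force
  qed auto
  also have "\<dots> = prob {\<omega> \<in> space P. M h \<omega> \<noteq> 0}"
    unfolding M_increment_distr[OF assms]
    by (subst measure_distr) (auto intro!: arg_cong[of _ _ prob])
  also have "\<dots> = 1 - prob {\<omega> \<in> space P. M h \<omega> = 0}"
    by (subst prob_neg) auto
  also have "prob {\<omega> \<in> space P. M h \<omega> = 0} = exp (- ((\<Sum>j=1..k. lam j) * h))"
  proof -
    have ev: "{\<omega> \<in> space P. M h \<omega> = 0} \<in> events" by measurable
    have "(0::complex) ^ M h \<omega> = of_real (indicator {\<omega> \<in> space P. M h \<omega> = 0} \<omega>)" if "\<omega> \<in> space P" for \<omega>
      using that by (auto simp: indicator_def)
    hence "expectation (\<lambda>\<omega>. (0::complex) ^ M h \<omega>) = expectation (\<lambda>\<omega>. of_real (indicator {\<omega> \<in> space P. M h \<omega> = 0} \<omega>))"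
      by (intro Bochner_Integration.integral_cong) auto
    also have "\<dots> = of_real (prob {\<omega> \<in> space P. M h \<omega> = 0})"
      using ev by (subst integral_complex_of_real) simp
    finally have "of_real (prob {\<omega> \<in> space P. M h \<omega> = 0}) = exp (- (rate 0 * of_real h))"
      using pgf_eq[of 0 h] assms by simp
    also have "rate 0 = of_real (\<Sum>j=1..k. lam j)"
      unfolding rate_def of_real_sum by (intro sum.cong) auto
    also have "exp (- (of_real (\<Sum>j=1..k. lam j) * of_real h)) = of_real (exp (- ((\<Sum>j=1..k. lam j) * h)))"
      by (simp only: exp_of_real of_real_mult[symmetric] of_real_minus[symmetric])
    finally show ?thesis using of_real_eq_iff by blast
  qed
  finally show ?thesis .
qed

lemma mean_at_increment:
  assumes \<phi>: "\<And>n. norm (\<phi> n) \<le> B" and sh: "0 \<le> s" "0 \<le> h"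
  shows "norm (mean_at \<phi> (s + h) - mean_at \<phi> s) \<le> 2 * B * (1 - exp (- ((\<Sum>j=1..k. lam j) * h)))"
proof -
  have sh': "0 \<le> s + h" using sh by simp
  note [measurable] = M_measurable[OF sh(1)] M_measurable[OF sh(2)] M_measurable[OF sh']
  have i: "integrable P (\<lambda>\<omega>. \<phi> (M s \<omega>))" "integrable P (\<lambda>\<omega>. \<phi> (M (s + h) \<omega>))"
    by (rule integrable_of_M[OF \<phi> M_measurable[OF sh(1)]], rule integrable_of_M[OF \<phi> M_measurable[OF sh']])
  have [measurable]: "(\<lambda>\<omega>. real (M s \<omega>)) \<in> borel_measurable P" "(\<lambda>\<omega>. real (M (s + h) \<omega>)) \<in> borel_measurable P"
    using sh by auto
  have "{\<omega> \<in> space P. real (M (s + h) \<omega>) \<noteq> real (M s \<omega>)} \<in> events" by measurable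
  hence ev: "{\<omega> \<in> space P. M (s + h) \<omega> \<noteq> M s \<omega>} \<in> events" by simp
  have "norm (mean_at \<phi> (s + h) - mean_at \<phi> s) = norm (expectation (\<lambda>\<omega>. \<phi> (M (s + h) \<omega>) - \<phi> (M s \<omega>)))"
    using i by (simp add: mean_at_def)
  also have "\<dots> \<le> expectation (\<lambda>\<omega>. norm (\<phi> (M (s + h) \<omega>) - \<phi> (M s \<omega>)))"
    by (rule integral_norm_bound)
  also have "\<dots> \<le> expectation (\<lambda>\<omega>. 2 * B * indicator {\<omega> \<in> space P. M (s + h) \<omega> \<noteq> M s \<omega>} \<omega>)"
  proof (rule integral_mono)
    fix \<omega> assume "\<omega> \<in> space P"
    moreover have "norm (\<phi> (M (s + h) \<omega>) - \<phi> (M s \<omega>)) \<le> B + B"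
      by (rule order.trans[OF norm_triangle_ineq4 add_mono[OF \<phi> \<phi>]])
    ultimately show "norm (\<phi> (M (s + h) \<omega>) - \<phi> (M s \<omega>)) \<le> 2 * B * indicator {\<omega> \<in> space P. M (s + h) \<omega> \<noteq> M s \<omega>} \<omega>"
      by (auto simp: indicator_def)
  next
    show "integrable P (\<lambda>\<omega>. 2 * B * indicator {\<omega> \<in> space P. M (s + h) \<omega> \<noteq> M s \<omega>} \<omega>)"
      by (intro integrable_mult_right integrable_real_indicator[OF ev])
         (simp add: emeasure_finite less_top[symmetric])
  qed (use i in auto)
  also have "\<dots> = 2 * B * prob {\<omega> \<in> space P. M (s + h) \<omega> \<noteq> M s \<omega>}" using ev by simp
  finally show ?thesis unfolding prob_jump[OF sh] .
qed

text \<open>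
  Although paths of \<open>M\<close> jump, their law at time \<open>s\<close> moves continuously, uniformly in \<open>s\<close>, because the
  probability of a jump in a short interval is small.
\<close>
lemma continuous_on_mean_at:
  assumes \<phi>: "\<And>n. norm (\<phi> n) \<le> B"
  shows "continuous_on {0..} (mean_at \<phi>)"
  unfolding continuous_on_def
proof
  fix a :: real assume a: "a \<in> {0..}"
  let ?w = "\<lambda>h. 2 * B * (1 - exp (- ((\<Sum>j=1..k. lam j) * h)))"
  have "((\<lambda>s. ?w \<bar>s - a\<bar>) \<longlongrightarrow> ?w \<bar>a - a\<bar>) (at a within {0..})" by (intro tendsto_intros)
  hence lim: "((\<lambda>s. ?w \<bar>s - a\<bar>) \<longlongrightarrow> 0) (at a within {0..})" by simp
  have "\<forall>\<^sub>F s in at a within {0..}. norm (mean_at \<phi> s - mean_at \<phi> a) \<le> ?w \<bar>s - a\<bar>"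
    unfolding eventually_at_filter
  proof (intro always_eventually allI impI)
    fix s :: real assume s: "s \<in> {0..}"
    show "norm (mean_at \<phi> s - mean_at \<phi> a) \<le> ?w \<bar>s - a\<bar>"
    proof (cases "a \<le> s")
      case True
      thus ?thesis using mean_at_increment[OF \<phi>, of a "s - a"] a by auto
    next
      case False
      thus ?thesis using mean_at_increment[OF \<phi>, of s "a - s"] s by (auto simp: norm_minus_commute)
    qed
  qed
  hence "((\<lambda>s. mean_at \<phi> s - mean_at \<phi> a) \<longlongrightarrow> 0) (at a within {0..})"
    using lim by (rule Lim_null_comparison)
  thus "(mean_at \<phi> \<longlongrightarrow> mean_at \<phi> a) (at a within {0..})" by (simp add: LIM_zero_iff)
qed

end

section \<open>Random time changes and inverse subordinators\<close>

text \<open>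
  The first point of the grid of mesh \<open>1 / (m + 1)\<close> strictly to the right of \<open>s\<close>. As \<open>m\<close> grows this
  tends to \<open>s\<close> from the right, so right-continuous processes are limits of their values on countable
  grids.
\<close>
definition grid_above :: "nat \<Rightarrow> real \<Rightarrow> real" where
  "grid_above m s = (real_of_int \<lfloor>real (Suc m) * s\<rfloor> + 1) / real (Suc m)"

lemma less_grid_above: "s < grid_above m s"
proof -
  have "real (Suc m) * s < real_of_int \<lfloor>real (Suc m) * s\<rfloor> + 1" by linarith
  thus ?thesis by (simp add: grid_above_def field_simps del: of_nat_Suc)
qed

lemma filterlim_grid_above: "filterlim (\<lambda>m. grid_above m s) (at_right s) sequentially"
proof -
  have le: "grid_above m s \<le> s + 1 / real (Suc m)" for m
  proof -
    have "real_of_int \<lfloor>real (Suc m) * s\<rfloor> \<le> real (Suc m) * s" by linarith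
    thus ?thesis by (simp add: grid_above_def field_simps del: of_nat_Suc)
  qed
  have "(\<lambda>m. grid_above m s) \<longlonglongrightarrow> s"
  proof (rule tendsto_sandwich[OF _ _ tendsto_const])
    show "\<forall>\<^sub>F m in sequentially. s \<le> grid_above m s"
      by (intro always_eventually allI less_imp_le less_grid_above)
    show "\<forall>\<^sub>F m in sequentially. grid_above m s \<le> s + 1 / real (Suc m)" using le by auto
    show "(\<lambda>m. s + 1 / real (Suc m)) \<longlonglongrightarrow> s"
      using tendsto_add[OF tendsto_const LIMSEQ_inverse_real_of_nat, of s] by (simp add: inverse_eq_divide)
  qed
  thus ?thesis unfolding filterlim_at using less_grid_above by (auto simp: less_imp_neq[symmetric])
qed

context generalized_counting
begin

text \<open>
  Independence applies to the whole processes. On a grid, \<open>M\<close> at the rounded random time is a measurable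
  functional of the pair of paths, and Fubini on the product of their laws averages \<open>M\<close> first. The limit
  along finer grids uses right continuity of \<open>M\<close> and continuity of its averages.
\<close>
lemma subordinate:
  fixes L :: "real \<Rightarrow> 'a \<Rightarrow> real" and \<phi> :: "nat \<Rightarrow> complex"
  assumes ind: "independent_processes P (\<lambda>t \<omega>. real (M t \<omega>)) L"
    and L0: "\<And>\<omega>. \<omega> \<in> space P \<Longrightarrow> 0 \<le> L t \<omega>" and t: "0 \<le> t"
  shows subordinate_measurable: "(\<lambda>\<omega>. M (L t \<omega>) \<omega>) \<in> measurable P (count_space UNIV)"
    and subordinate_expectation: "(\<And>n. norm (\<phi> n) \<le> B) \<Longrightarrow>
      expectation (\<lambda>\<omega>. \<phi> (M (L t \<omega>) \<omega>)) = expectation (\<lambda>\<omega>. mean_at \<phi> (L t \<omega>))"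
proof -
  define T where "T = L t"
  have T0: "0 \<le> T \<omega>" if "\<omega> \<in> space P" for \<omega> using L0[OF that] by (simp add: T_def)
  let ?N = "PiM {0..} (\<lambda>_. borel) :: (real \<Rightarrow> real) measure"
  define X where "X \<omega> = (\<lambda>t\<in>{0..}. real (M t \<omega>))" for \<omega>
  define Y where "Y \<omega> = (\<lambda>t\<in>{0..}. L t \<omega>)" for \<omega>
  have XY: "indep_var ?N X ?N Y"
    using ind by (simp add: independent_processes_def X_def[abs_def] Y_def[abs_def])
  hence X[measurable]: "X \<in> measurable P ?N" and Y[measurable]: "Y \<in> measurable P ?N"
    by (auto simp: indep_var_distribution_eq)
  have Nt[measurable]: "(\<lambda>y. y t) \<in> borel_measurable ?N"
    by (rule measurable_component_singleton) (use t in auto)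
  have YT: "Y \<omega> t = T \<omega>" for \<omega> using t by (simp add: Y_def T_def)
  have T[measurable]: "T \<in> borel_measurable P"
    using measurable_compose[OF Y Nt] by (simp add: YT)
  define j where "j m l = \<lfloor>real (Suc m) * l\<rfloor>" for m :: nat and l :: real
  \<comment> \<open>The maximum keeps the grid points inside the time set even for negative \<open>n\<close>.\<close>
  define i where "i m n = max 0 ((real_of_int n + 1) / real (Suc m))" for m :: nat and n :: int
  have i0: "i m n \<ge> 0" for m n by (simp add: i_def)
  have j[measurable]: "j m \<in> measurable borel (count_space UNIV)" for m
    unfolding j_def by measurable
  have lim: "filterlim (\<lambda>m. i m (j m (T \<omega>))) (at_right (T \<omega>)) sequentially" if w: "\<omega> \<in> space P" for \<omega>
  proof -
    have "i m (j m (T \<omega>)) = grid_above m (T \<omega>)" for m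
      using less_grid_above[of "T \<omega>" m] T0[OF w]
      unfolding i_def j_def grid_above_def[symmetric] by (intro max_absorb2) simp
    thus ?thesis by (simp add: filterlim_grid_above)
  qed
  have ev: "\<forall>\<^sub>F m in sequentially. M (i m (j m (T \<omega>))) \<omega> = M (T \<omega>) \<omega>" if w: "\<omega> \<in> space P" for \<omega>
    by (rule eventually_compose_filterlim[OF M_right_continuous[OF w T0[OF w]] lim[OF w]])
  have Mm: "(\<lambda>\<omega>. M (i m (j m (T \<omega>))) \<omega>) \<in> measurable P (count_space UNIV)" for m
    by (rule measurable_compose_countable[where f="\<lambda>n \<omega>. M (i m n) \<omega>" and g="\<lambda>\<omega>. j m (T \<omega>)",
          OF M_measurable[OF i0] measurable_compose[OF T j]])
  have "(\<lambda>\<omega>. real (M (T \<omega>) \<omega>)) \<in> borel_measurable P"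
  proof (rule borel_measurable_LIMSEQ_real)
    show "(\<lambda>m. real (M (i m (j m (T \<omega>))) \<omega>)) \<longlonglongrightarrow> real (M (T \<omega>) \<omega>)" if "\<omega> \<in> space P" for \<omega>
      using ev[OF that] by (intro tendsto_eventually) (auto elim: eventually_mono)
    show "(\<lambda>\<omega>. real (M (i m (j m (T \<omega>))) \<omega>)) \<in> borel_measurable P" for m
      by (rule measurable_compose[OF Mm]) simp
  qed
  hence "(\<lambda>\<omega>. nat \<lfloor>real (M (T \<omega>) \<omega>)\<rfloor>) \<in> measurable P (count_space UNIV)" by measurable
  hence meas: "(\<lambda>\<omega>. M (T \<omega>) \<omega>) \<in> measurable P (count_space UNIV)" by simp
  thus "(\<lambda>\<omega>. M (L t \<omega>) \<omega>) \<in> measurable P (count_space UNIV)" by (simp add: T_def)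
  assume \<phi>: "\<And>n. norm (\<phi> n) \<le> B"
  have eq: "expectation (\<lambda>\<omega>. \<phi> (M (i m (j m (T \<omega>))) \<omega>)) = expectation (\<lambda>\<omega>. mean_at \<phi> (i m (j m (T \<omega>))))" for m
  proof -
    define F where "F p = \<phi> (nat \<lfloor>fst p (i m (j m (snd p t)))\<rfloor>)" for p :: "(real \<Rightarrow> real) \<times> (real \<Rightarrow> real)"
    have F1: "(\<lambda>p. fst p (i m (j m (snd p t)))) \<in> borel_measurable (?N \<Otimes>\<^sub>M ?N)"
    proof (rule measurable_compose_countable[where f="\<lambda>n p. fst p (i m n)" and g="\<lambda>p. j m (snd p t)"])
      fix n
      have "(\<lambda>x. x (i m n)) \<in> measurable ?N borel"
        by (rule measurable_component_singleton) (use i0 in auto)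
      thus "(\<lambda>p. fst p (i m n)) \<in> borel_measurable (?N \<Otimes>\<^sub>M ?N)"
        by (rule measurable_compose[OF measurable_fst])
    next
      show "(\<lambda>p. j m (snd p t)) \<in> measurable (?N \<Otimes>\<^sub>M ?N) (count_space UNIV)"
        by (rule measurable_compose[OF measurable_compose[OF measurable_snd Nt] j])
    qed
    have F[measurable]: "F \<in> borel_measurable (?N \<Otimes>\<^sub>M ?N)"
      unfolding F_def using F1 by measurable
    interpret DX: prob_space "distr P ?N X" by (rule prob_space_distr[OF X])
    interpret DY: prob_space "distr P ?N Y" by (rule prob_space_distr[OF Y])
    interpret DXY: pair_prob_space "distr P ?N X" "distr P ?N Y" ..
    have prod: "distr P (?N \<Otimes>\<^sub>M ?N) (\<lambda>\<omega>. (X \<omega>, Y \<omega>)) = distr P ?N X \<Otimes>\<^sub>M distr P ?N Y"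
      using XY by (simp add: indep_var_distribution_eq)
    have setsP: "sets (distr P ?N X \<Otimes>\<^sub>M distr P ?N Y) = sets (?N \<Otimes>\<^sub>M ?N)"
      by (rule sets_pair_measure_cong) auto
    have intF: "integrable (distr P ?N X \<Otimes>\<^sub>M distr P ?N Y) (\<lambda>(x, l). F (x, l))"
    proof -
      have "norm (F p) \<le> B" for p by (simp add: F_def \<phi>)
      moreover have "F \<in> borel_measurable (distr P ?N X \<Otimes>\<^sub>M distr P ?N Y)"
        using F by (simp only: measurable_cong_sets[OF setsP refl])
      ultimately have "integrable (distr P ?N X \<Otimes>\<^sub>M distr P ?N Y) F"
        by (intro DXY.P.integrable_const_bound[of _ B] AE_I2)
      thus ?thesis by simp
    qed
    have "expectation (\<lambda>\<omega>. \<phi> (M (i m (j m (T \<omega>))) \<omega>)) = expectation (\<lambda>\<omega>. F (X \<omega>, Y \<omega>))"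
      using i0 by (simp add: F_def X_def YT)
    also have "\<dots> = integral\<^sup>L (distr P (?N \<Otimes>\<^sub>M ?N) (\<lambda>\<omega>. (X \<omega>, Y \<omega>))) F"
      by (subst integral_distr) auto
    also have "\<dots> = (\<integral>y. (\<integral>x. F (x, y) \<partial>distr P ?N X) \<partial>distr P ?N Y)"
      unfolding prod using DXY.integral_snd[OF intF] by simp
    also have "\<dots> = (\<integral>y. mean_at \<phi> (i m (j m (y t))) \<partial>distr P ?N Y)"
    proof (rule Bochner_Integration.integral_cong[OF refl])
      fix y assume "y \<in> space (distr P ?N Y)"
      hence y: "y \<in> space ?N" by simp
      have "(\<lambda>x. F (x, y)) \<in> borel_measurable ?N"
        by (rule measurable_compose[OF measurable_Pair2'[OF y] F])
      hence "(\<integral>x. F (x, y) \<partial>distr P ?N X) = expectation (\<lambda>\<omega>. F (X \<omega>, y))"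
        by (rule integral_distr[OF X])
      thus "(\<integral>x. F (x, y) \<partial>distr P ?N X) = mean_at \<phi> (i m (j m (y t)))"
        using i0 by (simp add: F_def X_def mean_at_def)
    qed
    also have "\<dots> = expectation (\<lambda>\<omega>. mean_at \<phi> (i m (j m (T \<omega>))))"
    proof (subst integral_distr[OF Y])
      show "(\<lambda>y. mean_at \<phi> (i m (j m (y t)))) \<in> borel_measurable ?N"
        by (rule measurable_compose[OF measurable_compose[OF Nt j], of "\<lambda>n. mean_at \<phi> (i m n)"]) simp
    qed (simp add: YT)
    finally show ?thesis .
  qed
  have sg0: "(\<lambda>s. indicator {0..} s *\<^sub>R mean_at \<phi> s) \<in> borel_measurable borel"
    by (rule borel_measurable_continuous_on_indicator[OF _ continuous_on_mean_at[OF \<phi>]]) auto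
  have sg: "(\<lambda>\<omega>. mean_at \<phi> (S \<omega>)) \<in> borel_measurable P"
    if "S \<in> borel_measurable P" "\<And>\<omega>. \<omega> \<in> space P \<Longrightarrow> S \<omega> \<ge> 0" for S
    using measurable_compose[OF that(1) sg0] that(2) by (subst measurable_cong) (auto simp: indicator_def)
  have im: "(\<lambda>\<omega>. i m (j m (T \<omega>))) \<in> borel_measurable P" for m
    by (rule measurable_compose[OF measurable_compose[OF T j], of "i m"]) simp
  have "(\<lambda>m. expectation (\<lambda>\<omega>. \<phi> (M (i m (j m (T \<omega>))) \<omega>))) \<longlonglongrightarrow> expectation (\<lambda>\<omega>. \<phi> (M (T \<omega>) \<omega>))"
  proof (rule integral_dominated_convergence[where w="\<lambda>_. B"])
    show "AE \<omega> in P. (\<lambda>m. \<phi> (M (i m (j m (T \<omega>))) \<omega>)) \<longlonglongrightarrow> \<phi> (M (T \<omega>) \<omega>)"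
    proof (intro AE_I2 tendsto_eventually)
      fix \<omega> assume "\<omega> \<in> space P"
      from ev[OF this] show "\<forall>\<^sub>F m in sequentially. \<phi> (M (i m (j m (T \<omega>))) \<omega>) = \<phi> (M (T \<omega>) \<omega>)"
        by eventually_elim simp
    qed
    show "(\<lambda>\<omega>. \<phi> (M (T \<omega>) \<omega>)) \<in> borel_measurable P" by (rule measurable_compose[OF meas]) simp
    show "(\<lambda>\<omega>. \<phi> (M (i m (j m (T \<omega>))) \<omega>)) \<in> borel_measurable P" for m
      by (rule measurable_compose[OF Mm]) simp
  qed (use \<phi> in auto)
  moreover have "(\<lambda>m. expectation (\<lambda>\<omega>. mean_at \<phi> (i m (j m (T \<omega>))))) \<longlonglongrightarrow> expectation (\<lambda>\<omega>. mean_at \<phi> (T \<omega>))"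
  proof (rule integral_dominated_convergence[where w="\<lambda>_. B"])
    show "AE \<omega> in P. (\<lambda>m. mean_at \<phi> (i m (j m (T \<omega>)))) \<longlonglongrightarrow> mean_at \<phi> (T \<omega>)"
    proof (rule AE_I2)
      fix \<omega> assume w: "\<omega> \<in> space P"
      show "(\<lambda>m. mean_at \<phi> (i m (j m (T \<omega>)))) \<longlonglongrightarrow> mean_at \<phi> (T \<omega>)"
        by (rule continuous_on_tendsto_compose[OF continuous_on_mean_at[OF \<phi>] lim[OF w, unfolded filterlim_at, THEN conjunct2]])
           (use T0[OF w] i0 in auto)
    qed
  qed (use \<phi> i0 T0 mean_at_bound[OF \<phi>] sg im in auto)
  ultimately have "expectation (\<lambda>\<omega>. \<phi> (M (T \<omega>) \<omega>)) = expectation (\<lambda>\<omega>. mean_at \<phi> (T \<omega>))"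
    unfolding eq by (rule LIMSEQ_unique)
  thus "expectation (\<lambda>\<omega>. \<phi> (M (L t \<omega>) \<omega>)) = expectation (\<lambda>\<omega>. mean_at \<phi> (L t \<omega>))" by (simp add: T_def)
qed

end

text \<open>
  A nondecreasing right-continuous process with Laplace transform \<open>exp (-s f(\<theta>))\<close>, together with its
  first passage times.
\<close>
locale inverse_subordinator = prob_space P for P :: "'a measure" +
  fixes H :: "real \<Rightarrow> 'a \<Rightarrow> real" and f :: "real \<Rightarrow> real"
  assumes H_measurable [measurable]: "\<And>t. t \<ge> 0 \<Longrightarrow> H t \<in> borel_measurable P"
    and H_mono: "\<And>\<omega> s t. \<omega> \<in> space P \<Longrightarrow> 0 \<le> s \<Longrightarrow> s \<le> t \<Longrightarrow> H s \<omega> \<le> H t \<omega>"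
    and H_right_continuous: "\<And>\<omega> t. \<omega> \<in> space P \<Longrightarrow> t \<ge> 0 \<Longrightarrow> continuous (at_right t) (\<lambda>s. H s \<omega>)"
    and H_0: "AE \<omega> in P. H 0 \<omega> = 0"
    and H_laplace: "\<And>s \<theta>. s \<ge> 0 \<Longrightarrow> \<theta> > 0 \<Longrightarrow> expectation (\<lambda>\<omega>. exp (- \<theta> * H s \<omega>)) = exp (- s * f \<theta>)"
    and f_pos: "\<And>\<theta>. \<theta> > 0 \<Longrightarrow> f \<theta> > 0"
    and L_measurable [measurable]: "\<And>t. t \<ge> 0 \<Longrightarrow> first_passage H t \<in> borel_measurable P"
begin

abbreviation L :: "real \<Rightarrow> 'a \<Rightarrow> real" where "L \<equiv> first_passage H"

text \<open>
  The paths, almost all, that start at \<open>0\<close> and pass every level, so that the first passage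
  time is a genuine infimum.
\<close>
definition regular_path :: "'a \<Rightarrow> bool" where
  "regular_path \<omega> \<longleftrightarrow> \<omega> \<in> space P \<and> H 0 \<omega> = 0 \<and> (\<forall>t. \<exists>s>0. t \<le> H s \<omega>)"

lemma integrable_exp_H: 
  assumes "s \<ge> 0" "\<theta> > 0"
  shows "integrable P (\<lambda>\<omega>. exp (- \<theta> * H s \<omega>))"
proof (rule integrable_const_bound[of _ 1])
  show "AE \<omega> in P. norm (exp (- \<theta> * H s \<omega>)) \<le> 1"
    using H_0 AE_space
  proof eventually_elim
    case (elim \<omega>)
    thus ?case using H_mono[of \<omega> 0 s] assms by simp
  qed
qed (use assms in auto)

lemma prob_H_less:
  assumes "s \<ge> 0" "\<theta> > 0"
  shows "prob {\<omega> \<in> space P. H s \<omega> < t} \<le> exp (\<theta> * t) * exp (- (f \<theta> * s))"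
proof -
  have [measurable]: "H s \<in> borel_measurable P" using assms by simp
  have ev: "{\<omega> \<in> space P. H s \<omega> < t} \<in> events" by measurable
  have "prob {\<omega> \<in> space P. H s \<omega> < t} = expectation (indicator {\<omega> \<in> space P. H s \<omega> < t})"
    using ev by simp
  also have "\<dots> \<le> expectation (\<lambda>\<omega>. exp (\<theta> * t) * exp (- \<theta> * H s \<omega>))"
  proof (rule integral_mono)
    show "integrable P (indicator {\<omega> \<in> space P. H s \<omega> < t} :: _ \<Rightarrow> real)"
      by (intro integrable_real_indicator[OF ev]) (simp add: emeasure_finite less_top[symmetric])
    show "integrable P (\<lambda>\<omega>. exp (\<theta> * t) * exp (- \<theta> * H s \<omega>))"
      using integrable_exp_H[OF assms] by simp
    show "indicator {\<omega> \<in> space P. H s \<omega> < t} \<omega> \<le> exp (\<theta> * t) * exp (- \<theta> * H s \<omega>)" for \<omega>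
      using assms by (auto simp: indicator_def exp_add[symmetric])
  qed
  also have "\<dots> = exp (\<theta> * t) * exp (- (f \<theta> * s))"
    using H_laplace[OF assms] by (simp add: mult.commute)
  finally show ?thesis .
qed

text \<open>
  By Markov's inequality for \<open>exp (-H s)\<close>, the probability that the path is still below a level at time
  \<open>s\<close> decays exponentially in \<open>s\<close>.
\<close>
lemma AE_regular_path: "AE \<omega> in P. regular_path \<omega>"
proof -
  have "AE \<omega> in P. \<exists>m::nat. real n \<le> H (real (Suc m)) \<omega>" for n :: nat
  proof -
    define A where "A = {\<omega> \<in> space P. \<forall>m. H (real (Suc m)) \<omega> < real n}"
    have A: "A \<in> events" unfolding A_def by measurable
    have "prob A \<le> exp (real n) * exp (- (f 1 * real (Suc m)))" for m
    proof -
      have "{\<omega> \<in> space P. H (real (Suc m)) \<omega> < real n} \<in> events" by measurable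
      hence "prob A \<le> prob {\<omega> \<in> space P. H (real (Suc m)) \<omega> < real n}"
        by (intro finite_measure_mono) (auto simp: A_def)
      also have "\<dots> \<le> exp (1 * real n) * exp (- (f 1 * real (Suc m)))" by (rule prob_H_less) auto
      finally show ?thesis by simp
    qed
    moreover have "(\<lambda>m. exp (real n) * exp (- (f 1 * real (Suc m)))) \<longlonglongrightarrow> 0"
      using f_pos[of 1] by real_asymp
    ultimately have "prob A \<le> 0" using LIMSEQ_le_const by blast
    hence "prob A = 0" by (simp add: measure_le_0_iff)
    hence "A \<in> null_sets P" using A by (simp add: null_sets_def emeasure_eq_measure)
    thus ?thesis by (rule AE_I') (auto simp: A_def not_le)
  qed
  hence "AE \<omega> in P. \<forall>n::nat. \<exists>m::nat. real n \<le> H (real (Suc m)) \<omega>" by (simp add: AE_all_countable)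
  with H_0 AE_space show ?thesis
  proof eventually_elim
    case (elim \<omega>)
    have "\<exists>s>0. t \<le> H s \<omega>" for t
    proof -
      obtain n :: nat where "t \<le> real n" using real_arch_simple by blast
      moreover obtain m :: nat where "real n \<le> H (real (Suc m)) \<omega>" using elim by blast
      ultimately show ?thesis by (intro exI[of _ "real (Suc m)"]) auto
    qed
    with elim show ?case by (simp add: regular_path_def)
  qed
qed

lemma L_nonneg: "0 \<le> L t \<omega>"
  unfolding first_passage_def by (auto intro!: cInf_greatest)

lemma L_eq: "regular_path \<omega> \<Longrightarrow> t > 0 \<Longrightarrow> L t \<omega> = Inf {s. s > 0 \<and> H s \<omega> \<ge> t}"
  by (auto simp: first_passage_def regular_path_def)

lemma less_L_iff:
  assumes w: "regular_path \<omega>" and st: "s > 0" "t > 0"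
  shows "s < L t \<omega> \<longleftrightarrow> H s \<omega> < t"
proof
  have bdd: "bdd_below {s. s > 0 \<and> H s \<omega> \<ge> t}" by (rule bdd_belowI[of _ 0]) auto
  have sp: "\<omega> \<in> space P" using w by (simp add: regular_path_def)
  {
    assume "s < L t \<omega>"
    hence "s \<notin> {s. s > 0 \<and> H s \<omega> \<ge> t}"
      unfolding L_eq[OF w st(2)] using cInf_lower[OF _ bdd] by fastforce
    thus "H s \<omega> < t" using st by auto
  next
    assume "H s \<omega> < t"
    have "((\<lambda>s. H s \<omega>) \<longlongrightarrow> H s \<omega>) (at_right s)"
      using H_right_continuous[OF sp, of s] st by (simp add: continuous_within)
    hence "\<forall>\<^sub>F r in at_right s. H r \<omega> < t" using \<open>H s \<omega> < t\<close> by (rule order_tendstoD)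
    then obtain b where b: "b > s" "\<And>r. s < r \<Longrightarrow> r < b \<Longrightarrow> H r \<omega> < t"
      unfolding eventually_at_right_field by blast
    define r where "r = (s + b) / 2"
    have r: "s < r" "H r \<omega> < t" using b by (auto simp: r_def)
    have "r \<le> L t \<omega>" unfolding L_eq[OF w st(2)]
    proof (rule cInf_greatest)
      show "{s. s > 0 \<and> H s \<omega> \<ge> t} \<noteq> {}" using w by (auto simp: regular_path_def)
      fix x assume x: "x \<in> {s. s > 0 \<and> H s \<omega> \<ge> t}"
      show "r \<le> x"
      proof (rule ccontr)
        assume "\<not> r \<le> x"
        hence "H x \<omega> \<le> H r \<omega>" using x by (intro H_mono[OF sp]) auto
        thus False using x r by auto
      qed
    qed
    thus "s < L t \<omega>" using r by simp
  }
qed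

text \<open>
  If \<open>s < L t\<close> then \<open>H s < t\<close>, a strict inequality that persists for levels slightly below \<open>t\<close>.
\<close>
lemma L_left_continuous:
  assumes w: "regular_path \<omega>" and t: "t > 0"
  shows "((\<lambda>t. L t \<omega>) \<longlongrightarrow> L t \<omega>) (at_left t)"
proof (rule order_tendstoI)
  fix a assume a: "a < L t \<omega>"
  show "\<forall>\<^sub>F r in at_left t. a < L r \<omega>"
  proof (cases "a < 0")
    case True
    thus ?thesis using L_nonneg by (auto intro!: always_eventually intro: less_le_trans)
  next
    case False
    define s where "s = (a + L t \<omega>) / 2"
    have s: "s > 0" "a < s" "s < L t \<omega>" using a False by (auto simp: s_def)
    hence "H s \<omega> < t" using less_L_iff[OF w] t by auto
    hence "\<forall>\<^sub>F r in at_left t. max 0 (H s \<omega>) < r"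
      using t by (intro eventually_at_leftI[of "max 0 (H s \<omega>)"]) auto
    thus ?thesis by eventually_elim (use less_L_iff[OF w s(1)] s in \<open>auto intro: less_trans\<close>)
  qed
next
  fix a assume a: "L t \<omega> < a"
  have "\<forall>\<^sub>F r in at_left t. 0 < r \<and> r < t"
    using t by (auto intro!: eventually_at_leftI[of 0])
  thus "\<forall>\<^sub>F r in at_left t. L r \<omega> < a"
  proof eventually_elim
    case (elim r)
    have "L r \<omega> \<le> L t \<omega>"
    proof (rule ccontr)
      assume "\<not> L r \<omega> \<le> L t \<omega>"
      then obtain s where s: "L t \<omega> < s" "s < L r \<omega>" using dense by (meson not_le)
      hence s0: "s > 0" using L_nonneg[of t \<omega>] by simp
      have "H s \<omega> < r" using less_L_iff[OF w s0, of r] s elim by simp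
      hence "s < L t \<omega>" using less_L_iff[OF w s0, of t] elim t by simp
      thus False using s by simp
    qed
    thus ?case using a by simp
  qed
qed

lemma expectation_left_continuous:
  fixes q :: "real \<Rightarrow> complex"
  assumes q: "continuous_on {0..} q" "\<And>s. s \<ge> 0 \<Longrightarrow> norm (q s) \<le> B" and t: "t > 0"
  shows "continuous (at_left t) (\<lambda>t. expectation (\<lambda>\<omega>. q (L t \<omega>)))"
  unfolding continuous_within
proof (rule tendsto_at_left_sequentially[OF t])
  fix S :: "nat \<Rightarrow> real" assume S: "\<And>n. S n < t" "\<And>n. 0 < S n" "S \<longlonglongrightarrow> t"
  have qm: "(\<lambda>s. indicator {0..} s *\<^sub>R q s) \<in> borel_measurable borel"
    by (rule borel_measurable_continuous_on_indicator[OF _ q(1)]) auto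
  have qL: "(\<lambda>\<omega>. q (L t \<omega>)) \<in> borel_measurable P" if "t > 0" for t
    using measurable_compose[OF L_measurable[of t] qm] that L_nonneg
    by (subst measurable_cong) (auto simp: indicator_def)
  show "(\<lambda>n. expectation (\<lambda>\<omega>. q (L (S n) \<omega>))) \<longlonglongrightarrow> expectation (\<lambda>\<omega>. q (L t \<omega>))"
  proof (rule integral_dominated_convergence[where w="\<lambda>_. B"])
    show "AE \<omega> in P. (\<lambda>n. q (L (S n) \<omega>)) \<longlonglongrightarrow> q (L t \<omega>)"
      using AE_regular_path
    proof eventually_elim
      case (elim \<omega>)
      have "filterlim S (at_left t) sequentially"
        unfolding filterlim_at using S by (auto simp: less_imp_neq)
      from filterlim_compose[OF L_left_continuous[OF elim t] this]
      show ?case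
        by (rule continuous_on_tendsto_compose[OF q(1)]) (use L_nonneg in auto)
    qed
  qed (use q(2) L_nonneg qL t S in auto)
qed

lemma has_laplace_exp:
  assumes "Re \<psi> \<ge> 0" "x > 0"
  shows "has_laplace (\<lambda>s. exp (- (\<psi> * of_real s))) x (1 / (of_real x + \<psi>))"
proof -
  have b: "norm (exp (- (\<psi> * of_real s))) \<le> 1" if "s > 0" for s :: real
    using assms that by simp
  have m: "(\<lambda>s. exp (- (\<psi> * complex_of_real s))) \<in> borel_measurable borel" by measurable
  note lap = has_laplace_bounded[OF m b assms(2)]
  define c where "c = of_real x + \<psi>"
  have c: "c \<noteq> 0" "Re c > 0" using assms by (auto simp: c_def complex_eq_iff)
  have e: "exp (- x * s) *\<^sub>R exp (- (\<psi> * complex_of_real s)) = exp (- (c * of_real s))" for s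
    by (simp add: c_def scaleR_conv_of_real exp_of_real[symmetric] exp_add[symmetric] algebra_simps)
  have int: "set_integrable lborel {0<..} (\<lambda>s. exp (- (c * complex_of_real s)))"
    using lap unfolding has_laplace_def e by blast
  have "(LBINT s=ereal 0..\<infinity>. exp (- (c * complex_of_real s))) = 0 - (- (1 / c))"
  proof (rule interval_integral_FTC_integrable)
    show "((\<lambda>s. - (exp (- (c * complex_of_real s)) / c)) has_vector_derivative exp (- (c * complex_of_real s))) (at s)" for s :: real
    proof -
      have "((\<lambda>z. - (exp (- (c * z)) / c)) has_field_derivative exp (- (c * of_real s))) (at (of_real s))"
        using c by (auto intro!: derivative_eq_intros)
      from has_vector_derivative_real_field[OF this] show ?thesis .
    qed
    show "set_integrable lborel (einterval (ereal 0) \<infinity>) (\<lambda>s. exp (- (c * complex_of_real s)))"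
      using int by (simp add: einterval_def greaterThan_def)
    have "((\<lambda>s. exp (- (c * complex_of_real s))) \<longlongrightarrow> 0) at_top"
    proof (rule tendsto_norm_zero_cancel)
      have "((\<lambda>s. exp (- (Re c * s))) \<longlongrightarrow> 0) at_top" using c(2) by real_asymp
      thus "((\<lambda>s. norm (exp (- (c * complex_of_real s)))) \<longlongrightarrow> 0) at_top" by simp
    qed
    hence "((\<lambda>s. - (exp (- (c * complex_of_real s)) / c)) \<longlongrightarrow> - (0 / c)) at_top"
      using c by (intro tendsto_intros)
    thus "(((\<lambda>s. - (exp (- (c * complex_of_real s)) / c)) \<circ> real_of_ereal) \<longlongrightarrow> 0) (at_left \<infinity>)"
      unfolding at_left_PInf by (simp add: filterlim_filtermap o_def)
    have "((\<lambda>s. - (exp (- (c * complex_of_real s)) / c)) \<longlongrightarrow> - (exp (- (c * complex_of_real 0)) / c)) (at_right 0)"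
      using c by (intro tendsto_intros)
    thus "(((\<lambda>s. - (exp (- (c * complex_of_real s)) / c)) \<circ> real_of_ereal) \<longlongrightarrow> - (1 / c)) (at_right (ereal 0))"
      by (simp add: at_right_ereal filterlim_filtermap o_def)
  qed (auto intro!: continuous_intros)
  hence "(LBINT s:{0<..}. exp (- (c * complex_of_real s))) = 1 / c"
    by (simp add: interval_lebesgue_integral_def einterval_def greaterThan_def)
  thus ?thesis using lap unfolding has_laplace_def e c_def by simp
qed

text \<open>
  The probability \<open>P (H s < t) = P (L t > s)\<close> for \<open>s > 0\<close>; the maximum with \<open>0\<close> makes it defined, and
  jointly measurable, for all real \<open>s\<close>.
\<close>
definition below_prob :: "real \<Rightarrow> real \<Rightarrow> real" where
  "below_prob s t = prob {\<omega> \<in> space P. H (max 0 s) \<omega> < t}"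

lemma H_joint_measurable: "(\<lambda>p. H (max 0 (fst p)) (snd p)) \<in> borel_measurable ((borel :: real measure) \<Otimes>\<^sub>M P)"
proof (rule borel_measurable_LIMSEQ_real)
  show "(\<lambda>p. H (grid_above m (max 0 (fst p))) (snd p)) \<in> borel_measurable (borel \<Otimes>\<^sub>M P)" for m
  proof (rule measurable_compose_countable[where f="\<lambda>n p. H (max 0 ((real_of_int n + 1) / real (Suc m))) (snd p)"
        and g="\<lambda>p. \<lfloor>real (Suc m) * max 0 (fst p)\<rfloor>", THEN measurable_cong[THEN iffD1, rotated]])
    show "(\<lambda>p. H (max 0 ((real_of_int n + 1) / real (Suc m))) (snd p)) \<in> borel_measurable (borel \<Otimes>\<^sub>M P)" for n
      by (rule measurable_compose[OF measurable_snd H_measurable]) simp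
    show "(\<lambda>p. \<lfloor>real (Suc m) * max 0 (fst p)\<rfloor>) \<in> measurable (borel \<Otimes>\<^sub>M P) (count_space UNIV)"
      by measurable
    fix p :: "real \<times> 'a"
    show "H (max 0 ((real_of_int \<lfloor>real (Suc m) * max 0 (fst p)\<rfloor> + 1) / real (Suc m))) (snd p) = H (grid_above m (max 0 (fst p))) (snd p)"
      unfolding grid_above_def[symmetric]
      using less_grid_above[of "max 0 (fst p)" m] by (subst max_absorb2) auto
  qed
  fix p :: "real \<times> 'a" assume "p \<in> space (borel \<Otimes>\<^sub>M P)"
  hence w: "snd p \<in> space P" by (auto simp: space_pair_measure)
  have "((\<lambda>r. H r (snd p)) \<longlongrightarrow> H (max 0 (fst p)) (snd p)) (at_right (max 0 (fst p)))"
    using H_right_continuous[OF w, of "max 0 (fst p)"] by (simp add: continuous_within)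
  from filterlim_compose[OF this filterlim_grid_above]
  show "(\<lambda>m. H (grid_above m (max 0 (fst p))) (snd p)) \<longlonglongrightarrow> H (max 0 (fst p)) (snd p)" .
qed

lemma below_prob_measurable: "(\<lambda>p. below_prob (fst p) (snd p)) \<in> borel_measurable (borel \<Otimes>\<^sub>M borel)"
proof -
  have [measurable]: "(\<lambda>q. H (max 0 (fst (fst q))) (snd q)) \<in> borel_measurable ((borel \<Otimes>\<^sub>M borel) \<Otimes>\<^sub>M P)"
    using measurable_compose[of "\<lambda>q. (fst (fst q), snd q)" "((borel \<Otimes>\<^sub>M borel) \<Otimes>\<^sub>M P)" "borel \<Otimes>\<^sub>M P", OF _ H_joint_measurable]
    by simp
  have "(\<lambda>p. \<integral>\<omega>. (indicator {q. H (max 0 (fst (fst q))) (snd q) < snd (fst q)} (p, \<omega>) :: real) \<partial>P) \<in> borel_measurable (borel \<Otimes>\<^sub>M borel)"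
  proof (rule borel_measurable_lebesgue_integral)
    have "(\<lambda>q. if H (max 0 (fst (fst q))) (snd q) < snd (fst q) then 1 else 0 :: real) \<in> borel_measurable ((borel \<Otimes>\<^sub>M borel) \<Otimes>\<^sub>M P)"
      by measurable
    thus "(\<lambda>(p, \<omega>). indicator {q. H (max 0 (fst (fst q))) (snd q) < snd (fst q)} (p, \<omega>) :: real) \<in> borel_measurable ((borel \<Otimes>\<^sub>M borel) \<Otimes>\<^sub>M P)"
      by (simp add: indicator_def of_bool_def case_prod_beta)
  qed
  moreover have "(\<integral>\<omega>. (indicator {q. H (max 0 (fst (fst q))) (snd q) < snd (fst q)} (p, \<omega>) :: real) \<partial>P) = below_prob (fst p) (snd p)" for p
  proof -
    have "(\<integral>\<omega>. (indicator {q. H (max 0 (fst (fst q))) (snd q) < snd (fst q)} (p, \<omega>) :: real) \<partial>P)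
        = (\<integral>\<omega>. indicator {\<omega>\<in>space P. H (max 0 (fst p)) \<omega> < snd p} \<omega> \<partial>P)"
      by (rule Bochner_Integration.integral_cong) (auto simp: indicator_def)
    thus ?thesis by (simp add: below_prob_def)
  qed
  ultimately show ?thesis by simp
qed

lemma below_prob_bounds: "0 \<le> below_prob s t" "below_prob s t \<le> 1" by (auto simp: below_prob_def)

lemma below_prob_exp_bound: "s \<ge> 0 \<Longrightarrow> \<theta> > 0 \<Longrightarrow> below_prob s t \<le> exp (\<theta> * t) * exp (- (f \<theta> * s))"
  using prob_H_less[of s \<theta> t] by (simp add: below_prob_def max_absorb2)

lemma has_laplace_below_prob:
  assumes s: "s > 0" and \<theta>: "\<theta> > 0"
  shows "has_laplace (below_prob s) \<theta> (exp (- s * f \<theta>) / \<theta>)"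
proof -
  have [measurable]: "H s \<in> borel_measurable P" using s by simp
  define g where "g \<omega> t = (if 0 < t \<and> H s \<omega> < t then exp (- \<theta> * t) else 0)" for \<omega> t
  have gm: "(\<lambda>(\<omega>, t). g \<omega> t) \<in> borel_measurable (P \<Otimes>\<^sub>M lborel)" unfolding g_def by measurable
  interpret PL: pair_sigma_finite P lborel ..
  define e where "e t = indicator {0<..} t *\<^sub>R (exp (- \<theta> * t) *\<^sub>R (1::real))" for t
  have e: "integrable lborel e"
    using has_laplace_one[OF \<theta>] by (simp add: has_laplace_def set_integrable_def e_def[abs_def])
  have gint: "integrable lborel (g \<omega>)" for \<omega>
  proof (rule Bochner_Integration.integrable_bound[OF e])
    show "g \<omega> \<in> borel_measurable lborel" unfolding g_def by measurable
  qed (auto simp: g_def e_def)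
  have gval: "(\<integral>t. g \<omega> t \<partial>lborel) = exp (- \<theta> * H s \<omega>) / \<theta>" if "H s \<omega> \<ge> 0" for \<omega>
  proof -
    have "(\<integral>t. g \<omega> t \<partial>lborel) = (\<integral>t. g \<omega> (H s \<omega> + 1 * t) \<partial>lborel)"
      by (subst lborel_integral_real_affine[of 1 _ "H s \<omega>"]) auto
    also have "(\<lambda>t. g \<omega> (H s \<omega> + 1 * t)) = (\<lambda>t. exp (- \<theta> * H s \<omega>) * e t)"
      using that by (auto simp: g_def e_def fun_eq_iff exp_add[symmetric] algebra_simps)
    also have "(\<integral>t. exp (- \<theta> * H s \<omega>) * e t \<partial>lborel) = exp (- \<theta> * H s \<omega>) * (1 / \<theta>)"
      using has_laplace_one[OF \<theta>] unfolding has_laplace_def set_lebesgue_integral_def e_def by simp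
    finally show ?thesis by simp
  qed
  have Hnn: "AE \<omega> in P. H s \<omega> \<ge> 0" using H_0 AE_space
  proof eventually_elim
    case (elim \<omega>)
    thus ?case using H_mono[of \<omega> 0 s] s by simp
  qed
  have int: "integrable (P \<Otimes>\<^sub>M lborel) (\<lambda>(\<omega>, t). g \<omega> t)"
  proof (rule PL.Fubini_integrable)
    have "integrable P (\<lambda>\<omega>. exp (- \<theta> * H s \<omega>) / \<theta>)" using integrable_exp_H[of s \<theta>] s \<theta> by simp
    moreover have "AE \<omega> in P. exp (- \<theta> * H s \<omega>) / \<theta> = (\<integral>t. norm (case (\<omega>, t) of (\<omega>, t) \<Rightarrow> g \<omega> t) \<partial>lborel)"
      using Hnn
    proof eventually_elim
      case (elim \<omega>)
      have "norm (g \<omega> t) = g \<omega> t" for t by (simp add: g_def)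
      thus ?case using gval[OF elim] by simp
    qed
    moreover have "(\<lambda>\<omega>. \<integral>t. norm (case (\<omega>, t) of (\<omega>, t) \<Rightarrow> g \<omega> t) \<partial>lborel) \<in> borel_measurable P"
      using gm by measurable
    ultimately show "integrable P (\<lambda>\<omega>. \<integral>t. norm (case (\<omega>, t) of (\<omega>, t) \<Rightarrow> g \<omega> t) \<partial>lborel)"
      by (subst integrable_cong_AE[symmetric]) (auto intro: borel_measurable_integrable)
  qed (use gm gint in auto)
  have inner: "(\<integral>\<omega>. g \<omega> t \<partial>P) = indicator {0<..} t *\<^sub>R (exp (- \<theta> * t) *\<^sub>R below_prob s t)" for t
  proof -
    have "(\<integral>\<omega>. g \<omega> t \<partial>P) = (\<integral>\<omega>. (indicator {0<..} t * exp (- \<theta> * t)) * indicator {\<omega>\<in>space P. H s \<omega> < t} \<omega> \<partial>P)"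
      by (rule Bochner_Integration.integral_cong) (auto simp: g_def indicator_def)
    thus ?thesis using s by (simp add: below_prob_def max_absorb2)
  qed
  have "integrable lborel (\<lambda>t. \<integral>\<omega>. g \<omega> t \<partial>P)" using PL.integrable_snd[OF int] .
  moreover have "(\<integral>t. (\<integral>\<omega>. g \<omega> t \<partial>P) \<partial>lborel) = (\<integral>\<omega>. (\<integral>t. g \<omega> t \<partial>lborel) \<partial>P)"
    using PL.Fubini_integral[OF int] .
  moreover have "(\<integral>\<omega>. (\<integral>t. g \<omega> t \<partial>lborel) \<partial>P) = (\<integral>\<omega>. exp (- \<theta> * H s \<omega>) / \<theta> \<partial>P)"
  proof (rule integral_cong_AE)
    show "AE \<omega> in P. (\<integral>t. g \<omega> t \<partial>lborel) = exp (- \<theta> * H s \<omega>) / \<theta>"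
      using Hnn by eventually_elim (rule gval)
  qed (use gm in auto)
  moreover have "(\<integral>\<omega>. exp (- \<theta> * H s \<omega>) / \<theta> \<partial>P) = exp (- s * f \<theta>) / \<theta>"
    using H_laplace[of s \<theta>] s \<theta> by simp
  ultimately show ?thesis
    unfolding inner has_laplace_def set_integrable_def set_lebesgue_integral_def by simp
qed

text \<open>
  The identity \<open>exp (-\<psi> l) = 1 - \<psi> \<integral> exp (-\<psi> s) ds\<close>, integrated over \<open>0 < s < l\<close>, at \<open>l = L t\<close>.
\<close>
lemma expectation_exp_L:
  assumes \<psi>: "Re \<psi> \<ge> 0" and t: "t > 0"
  shows "expectation (\<lambda>\<omega>. exp (- (\<psi> * of_real (L t \<omega>))))
    = 1 - \<psi> * (LBINT s:{0<..}. exp (- (\<psi> * of_real s)) * of_real (below_prob s t))"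
proof -
  have [measurable]: "L t \<in> borel_measurable P" using t by simp
  define g where "g s \<omega> = (if 0 < s \<and> s < L t \<omega> then exp (- (\<psi> * of_real s)) else 0)" for s \<omega>
  have gm: "(\<lambda>(s, \<omega>). g s \<omega>) \<in> borel_measurable (lborel \<Otimes>\<^sub>M P)" unfolding g_def by measurable
  interpret LP: pair_sigma_finite lborel P ..
  have eb: "norm (exp (- (\<psi> * complex_of_real s))) \<le> 1" if "s \<ge> 0" for s using \<psi> that by simp
  have ind: "AE \<omega> in P. s < L t \<omega> \<longleftrightarrow> H s \<omega> < t" if "s > 0" for s
    using AE_regular_path by eventually_elim (use less_L_iff that t in auto)
  have pr: "prob {\<omega> \<in> space P. s < L t \<omega>} = below_prob s t" if s: "s > 0" for s
  proof -
    have [measurable]: "H s \<in> borel_measurable P" using s by simp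
    have "{\<omega> \<in> space P. s < L t \<omega>} \<in> events" "{\<omega> \<in> space P. H s \<omega> < t} \<in> events" by measurable
    thus ?thesis using ind[OF s] s unfolding below_prob_def
      by (intro measure_eq_AE) (auto simp: max_absorb2)
  qed
  have inner: "(\<integral>\<omega>. g s \<omega> \<partial>P) = indicator {0<..} s *\<^sub>R (exp (- (\<psi> * of_real s)) * of_real (below_prob s t))" for s
  proof (cases "s > 0")
    case True
    have ev: "{\<omega> \<in> space P. s < L t \<omega>} \<in> events" by measurable
    have "(\<integral>\<omega>. g s \<omega> \<partial>P) = (\<integral>\<omega>. exp (- (\<psi> * of_real s)) * of_real (indicator {\<omega> \<in> space P. s < L t \<omega>} \<omega>) \<partial>P)"
      using True by (intro Bochner_Integration.integral_cong) (auto simp: g_def indicator_def)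
    also have "\<dots> = exp (- (\<psi> * of_real s)) * of_real (prob {\<omega> \<in> space P. s < L t \<omega>})"
      using ev by (simp add: integral_complex_of_real)
    finally show ?thesis using True pr by simp
  qed (simp add: g_def)
  have norm_inner: "(\<integral>\<omega>. norm (g s \<omega>) \<partial>P) = indicator {0<..} s * (norm (exp (- (\<psi> * of_real s))) * below_prob s t)" for s
  proof (cases "s > 0")
    case True
    have ev: "{\<omega> \<in> space P. s < L t \<omega>} \<in> events" by measurable
    have "(\<integral>\<omega>. norm (g s \<omega>) \<partial>P) = (\<integral>\<omega>. norm (exp (- (\<psi> * of_real s))) * indicator {\<omega> \<in> space P. s < L t \<omega>} \<omega> \<partial>P)"
      using True by (intro Bochner_Integration.integral_cong) (auto simp: g_def indicator_def)
    also have "\<dots> = norm (exp (- (\<psi> * of_real s))) * prob {\<omega> \<in> space P. s < L t \<omega>}"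
      using ev by simp
    finally show ?thesis using True pr by simp
  qed (simp add: g_def)
  have Fm: "(\<lambda>s. below_prob s t) \<in> borel_measurable borel"
    using measurable_compose[OF measurable_Pair2'[of t borel borel] below_prob_measurable, simplified] by simp
  have int: "integrable (lborel \<Otimes>\<^sub>M P) (\<lambda>(s, \<omega>). g s \<omega>)"
  proof (rule LP.Fubini_integrable)
    have "integrable lborel (\<lambda>s. indicator {0<..} s *\<^sub>R (exp (- f 1 * s) *\<^sub>R exp (1 * t)))"
      using has_laplace_bounded[of "\<lambda>_. exp (1 * t)" "exp (1 * t)" "f 1"] f_pos[of 1]
      unfolding has_laplace_def set_integrable_def by simp
    thus "integrable lborel (\<lambda>s. \<integral>\<omega>. norm (case (s, \<omega>) of (s, \<omega>) \<Rightarrow> g s \<omega>) \<partial>P)"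
      unfolding split_conv norm_inner
    proof (rule Bochner_Integration.integrable_bound)
      show "(\<lambda>s. indicator {0<..} s * (norm (exp (- (\<psi> * complex_of_real s))) * below_prob s t)) \<in> borel_measurable lborel"
        using Fm by measurable
      have "norm (exp (- (\<psi> * complex_of_real s))) * below_prob s t \<le> 1 * (exp (1 * t) * exp (- (f 1 * s)))" if "s > 0" for s
        using that below_prob_bounds below_prob_exp_bound[of s 1 t] eb[of s] by (intro mult_mono) auto
      thus "AE s in lborel. norm (indicator {0<..} s * (norm (exp (- (\<psi> * complex_of_real s))) * below_prob s t))
          \<le> norm (indicator {0<..} s *\<^sub>R (exp (- f 1 * s) *\<^sub>R exp (1 * t)))"
        using below_prob_bounds by (auto intro!: AE_I2 simp: indicator_def mult.commute)
    qed
    show "AE s in lborel. integrable P (\<lambda>\<omega>. case (s, \<omega>) of (s, \<omega>) \<Rightarrow> g s \<omega>)"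
    proof (rule AE_I2)
      fix s :: real
      have "norm (g s \<omega>) \<le> 1" for \<omega> using eb[of s] by (simp add: g_def)
      moreover have "g s \<in> borel_measurable P" unfolding g_def by measurable
      ultimately show "integrable P (\<lambda>\<omega>. case (s, \<omega>) of (s, \<omega>) \<Rightarrow> g s \<omega>)"
        by (auto intro!: integrable_const_bound[of _ 1])
    qed
  qed (rule gm)
  have outer: "\<psi> * (\<integral>s. g s \<omega> \<partial>lborel) = 1 - exp (- (\<psi> * of_real (L t \<omega>)))" for \<omega>
  proof -
    define l where "l = L t \<omega>"
    have l: "0 \<le> l" by (simp add: l_def L_nonneg)
    have "\<psi> * (\<integral>s. g s \<omega> \<partial>lborel) = (\<integral>s. \<psi> * g s \<omega> \<partial>lborel)" by simp
    also have "\<dots> = (\<integral>s. indicator {0..l} s *\<^sub>R (\<psi> * exp (- (\<psi> * of_real s))) \<partial>lborel)"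
    proof (rule integral_cong_AE)
      have "AE s in lborel. s \<noteq> 0 \<and> s \<noteq> l" using AE_lborel_singleton[of 0] AE_lborel_singleton[of l] by eventually_elim auto
      thus "AE s in lborel. \<psi> * g s \<omega> = indicator {0..l} s *\<^sub>R (\<psi> * exp (- (\<psi> * of_real s)))"
        by eventually_elim (auto simp: g_def indicator_def l_def)
      show "(\<lambda>s. \<psi> * g s \<omega>) \<in> borel_measurable lborel" unfolding g_def by measurable
    qed measurable
    also have "\<dots> = - exp (- (\<psi> * of_real l)) - (- exp (- (\<psi> * of_real 0)))"
    proof (rule integral_FTC_atLeastAtMost[OF l])
      fix s :: real
      have "((\<lambda>z. - exp (- (\<psi> * z))) has_field_derivative \<psi> * exp (- (\<psi> * of_real s))) (at (of_real s))"
        by (auto intro!: derivative_eq_intros)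
      from has_vector_derivative_real_field[OF this]
      show "((\<lambda>s. - exp (- (\<psi> * of_real s))) has_vector_derivative \<psi> * exp (- (\<psi> * of_real s))) (at s within {0..l})"
        by (rule has_vector_derivative_at_within)
    qed (auto intro!: continuous_intros)
    finally show ?thesis by (simp add: l_def)
  qed
  have "(LBINT s:{0<..}. exp (- (\<psi> * of_real s)) * of_real (below_prob s t)) = (\<integral>s. (\<integral>\<omega>. g s \<omega> \<partial>P) \<partial>lborel)"
    by (simp add: inner set_lebesgue_integral_def)
  also have "\<dots> = (\<integral>\<omega>. (\<integral>s. g s \<omega> \<partial>lborel) \<partial>P)" using LP.Fubini_integral[OF int] by simp
  finally have "\<psi> * (LBINT s:{0<..}. exp (- (\<psi> * of_real s)) * of_real (below_prob s t)) = (\<integral>\<omega>. \<psi> * (\<integral>s. g s \<omega> \<partial>lborel) \<partial>P)"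
    by simp
  also have "\<dots> = (\<integral>\<omega>. 1 - exp (- (\<psi> * of_real (L t \<omega>))) \<partial>P)" unfolding outer ..
  also have "\<dots> = 1 - expectation (\<lambda>\<omega>. exp (- (\<psi> * of_real (L t \<omega>))))"
  proof (subst Bochner_Integration.integral_diff)
    show "integrable P (\<lambda>\<omega>. exp (- (\<psi> * complex_of_real (L t \<omega>))))"
      by (rule integrable_const_bound[of _ 1]) (use eb L_nonneg in auto)
  qed (auto simp: prob_space)
  finally show ?thesis by simp
qed

text \<open>
  Under the transform in \<open>t\<close> the tail \<open>P (L t > s)\<close> becomes \<open>exp (-s f(\<theta>)) / \<theta>\<close>: sampled at an
  independent exponential time of rate \<open>\<theta>\<close>, \<open>L\<close> is exponential with rate \<open>f(\<theta>)\<close>.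
\<close>
lemma has_laplace_expectation_exp_L:
  assumes \<psi>: "Re \<psi> \<ge> 0" and \<theta>: "\<theta> > 0"
  shows "has_laplace (\<lambda>t. expectation (\<lambda>\<omega>. exp (- (\<psi> * of_real (L t \<omega>))))) \<theta>
    (of_real (f \<theta>) / (of_real \<theta> * (of_real (f \<theta>) + \<psi>)))"
proof -
  have f: "f \<theta> > 0" by (rule f_pos[OF \<theta>])
  have nz: "of_real (f \<theta>) + \<psi> \<noteq> 0" using f \<psi> by (auto simp: complex_eq_iff)
  define K where "K s t = indicator {0<..} s *\<^sub>R (exp (- (\<psi> * of_real s)) * of_real (indicator {0<..} t *\<^sub>R (exp (- \<theta> * t) *\<^sub>R below_prob s t)))" for s t :: real
  have eb: "norm (exp (- (\<psi> * complex_of_real s))) \<le> 1" if "s \<ge> 0" for s using \<psi> that by simp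
  have [measurable]: "(\<lambda>p. below_prob (fst p) (snd p)) \<in> borel_measurable (lborel \<Otimes>\<^sub>M lborel)"
    using below_prob_measurable by (subst measurable_cong_sets[OF sets_pair_measure_cong refl]) auto
  have Km: "(\<lambda>(s, t). K s t) \<in> borel_measurable (lborel \<Otimes>\<^sub>M lborel)"
    unfolding K_def case_prod_beta by measurable
  have Ft: "integrable lborel (\<lambda>t. indicator {0<..} t *\<^sub>R (exp (- \<theta> * t) *\<^sub>R below_prob s t))"
      "(\<integral>t. indicator {0<..} t *\<^sub>R (exp (- \<theta> * t) *\<^sub>R below_prob s t) \<partial>lborel) = exp (- s * f \<theta>) / \<theta>" if "s > 0" for s
    using has_laplace_below_prob[OF that \<theta>] by (auto simp: has_laplace_def set_integrable_def set_lebesgue_integral_def)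
  have K1: "(\<integral>t. K s t \<partial>lborel) = indicator {0<..} s *\<^sub>R (exp (- f \<theta> * s) *\<^sub>R (exp (- (\<psi> * of_real s)) / of_real \<theta>))" for s
  proof (cases "s > 0")
    case True
    have "K s t = exp (- (\<psi> * of_real s)) * of_real (indicator {0<..} t *\<^sub>R (exp (- \<theta> * t) *\<^sub>R below_prob s t))" for t
      using True by (simp add: K_def)
    hence "(\<integral>t. K s t \<partial>lborel) = exp (- (\<psi> * of_real s)) * of_real (\<integral>t. indicator {0<..} t *\<^sub>R (exp (- \<theta> * t) *\<^sub>R below_prob s t) \<partial>lborel)"
      by (simp only: integral_mult_right_zero integral_complex_of_real)
    thus ?thesis using True by (simp only: Ft(2)) (simp add: scaleR_conv_of_real mult.commute exp_of_real[symmetric])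
  qed (simp add: K_def)
  have Knorm: "(\<integral>t. norm (K s t) \<partial>lborel) = indicator {0<..} s * (norm (exp (- (\<psi> * of_real s))) * (exp (- f \<theta> * s) / \<theta>))" for s
  proof (cases "s > 0")
    case True
    have "norm (K s t) = norm (exp (- (\<psi> * of_real s))) * (indicator {0<..} t *\<^sub>R (exp (- \<theta> * t) *\<^sub>R below_prob s t))" for t
      using True below_prob_bounds by (auto simp: K_def norm_mult indicator_def)
    hence "(\<integral>t. norm (K s t) \<partial>lborel) = norm (exp (- (\<psi> * of_real s))) * (\<integral>t. indicator {0<..} t *\<^sub>R (exp (- \<theta> * t) *\<^sub>R below_prob s t) \<partial>lborel)"
      by (simp only: integral_mult_right_zero)
    thus ?thesis using True by (simp only: Ft(2)) (simp add: mult.commute)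
  qed (simp add: K_def)
  have Kint: "integrable (lborel \<Otimes>\<^sub>M lborel) (\<lambda>(s, t). K s t)"
  proof (rule lborel_pair.Fubini_integrable[OF Km])
    have "integrable lborel (\<lambda>s. indicator {0<..} s *\<^sub>R (exp (- f \<theta> * s) *\<^sub>R (1 / \<theta>)))"
      using has_laplace_bounded[of "\<lambda>_. 1 / \<theta>" "\<bar>1 / \<theta>\<bar>" "f \<theta>"] f
      unfolding has_laplace_def set_integrable_def by simp
    thus "integrable lborel (\<lambda>s. \<integral>t. norm (case (s, t) of (s, t) \<Rightarrow> K s t) \<partial>lborel)"
      unfolding split_conv Knorm
    proof (rule Bochner_Integration.integrable_bound)
      have "norm (exp (- (\<psi> * complex_of_real s))) * (exp (- f \<theta> * s) / \<theta>) \<le> 1 * (exp (- f \<theta> * s) / \<theta>)" if "s > 0" for s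
        using that \<theta> eb[of s] by (intro mult_right_mono) auto
      thus "AE s in lborel. norm (indicator {0<..} s * (norm (exp (- (\<psi> * complex_of_real s))) * (exp (- f \<theta> * s) / \<theta>)))
          \<le> norm (indicator {0<..} s *\<^sub>R (exp (- f \<theta> * s) *\<^sub>R (1 / \<theta>)))"
        using \<theta> by (auto intro!: AE_I2 simp: indicator_def)
    qed measurable
    show "AE s in lborel. integrable lborel (\<lambda>t. case (s, t) of (s, t) \<Rightarrow> K s t)"
    proof (rule AE_I2)
      fix s :: real
      show "integrable lborel (\<lambda>t. case (s, t) of (s, t) \<Rightarrow> K s t)"
      proof (cases "s > 0")
        case True
        have "K s t = exp (- (\<psi> * of_real s)) * of_real (indicator {0<..} t *\<^sub>R (exp (- \<theta> * t) *\<^sub>R below_prob s t))" for t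
          using True by (simp add: K_def)
        thus ?thesis unfolding split_conv
          using integrable_mult_right[OF integrable_of_real[OF Ft(1)[OF True]]] by (simp only:)
      qed (simp add: K_def)
    qed
  qed
  have K2: "(\<integral>s. K s t \<partial>lborel) = indicator {0<..} t *\<^sub>R (exp (- \<theta> * t) *\<^sub>R (LBINT s:{0<..}. exp (- (\<psi> * of_real s)) * of_real (below_prob s t)))" for t
  proof -
    have "K s t = of_real (indicator {0<..} t * exp (- \<theta> * t)) * (indicator {0<..} s *\<^sub>R (exp (- (\<psi> * of_real s)) * of_real (below_prob s t)))" for s
      by (simp add: K_def scaleR_conv_of_real mult_ac)
    hence "(\<integral>s. K s t \<partial>lborel) = of_real (indicator {0<..} t * exp (- \<theta> * t)) * (LBINT s:{0<..}. exp (- (\<psi> * of_real s)) * of_real (below_prob s t))"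
      unfolding set_lebesgue_integral_def by (simp only: integral_mult_right_zero)
    thus ?thesis by (simp add: scaleR_conv_of_real mult.assoc)
  qed
  have "(\<integral>s. (\<integral>t. K s t \<partial>lborel) \<partial>lborel) = 1 / (of_real (f \<theta>) + \<psi>) / of_real \<theta>"
    using has_laplace_bounded_linear[OF bounded_linear_divide has_laplace_exp[OF \<psi> f], of "of_real \<theta>"]
    unfolding has_laplace_def set_lebesgue_integral_def K1 by simp
  hence "has_laplace (\<lambda>t. LBINT s:{0<..}. exp (- (\<psi> * of_real s)) * of_real (below_prob s t)) \<theta> (1 / (of_real (f \<theta>) + \<psi>) / of_real \<theta>)"
    using lborel_pair.integrable_snd[OF Kint] lborel_pair.Fubini_integral[OF Kint]
    unfolding K2 has_laplace_def set_integrable_def set_lebesgue_integral_def by simp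
  from has_laplace_mult_left[OF this, of \<psi>]
  have 1: "has_laplace (\<lambda>t. \<psi> * (LBINT s:{0<..}. exp (- (\<psi> * of_real s)) * of_real (below_prob s t))) \<theta> (\<psi> * (1 / (of_real (f \<theta>) + \<psi>) / of_real \<theta>))" .
  have "has_laplace (\<lambda>_. of_real 1 :: complex) \<theta> (of_real (1 / \<theta>))"
    by (rule has_laplace_bounded_linear[OF bounded_linear_of_real has_laplace_one[OF \<theta>]])
  hence 2: "has_laplace (\<lambda>_. 1 :: complex) \<theta> (of_real (1 / \<theta>))" by simp
  have 3: "of_real (1 / \<theta>) - \<psi> * (1 / (of_real (f \<theta>) + \<psi>) / of_real \<theta>) = of_real (f \<theta>) / (of_real \<theta> * (of_real (f \<theta>) + \<psi>))"
  proof -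
    have "1 / t - \<psi> * (1 / c / t) = a / (t * c)" if "c = a + \<psi>" "c \<noteq> 0" "t \<noteq> 0" for a c t :: complex
      using that by (simp add: diff_divide_distrib[symmetric] divide_simps)
    from this[of _ "of_real (f \<theta>)" "of_real \<theta>", OF refl nz] show ?thesis using \<theta> by simp
  qed
  show ?thesis
    by (rule has_laplace_cong[THEN iffD1, OF _ 3 has_laplace_diff[OF 2 1]])
       (simp add: expectation_exp_L[OF \<psi>])
qed

end

section \<open>The time-changed counting process\<close>

lemma laplace_expansion_add:
  assumes "laplace_expansion \<alpha> \<rho> y Y" "laplace_expansion \<alpha> \<rho> z Z" "\<alpha> > 0"
  shows "laplace_expansion \<alpha> \<rho> (\<lambda>t. y t + z t) (Y + Z)"
proof -
  have e: "(\<lambda>x. eval_fps Y x + eval_fps Z x) has_fps_expansion (Y + Z)"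
    using assms by (intro fps_expansion_intros eval_fps_has_fps_expansion) (auto simp: laplace_expansion_def)
  have y: "\<forall>\<^sub>F \<theta> in at_top. has_laplace y \<theta> (eval_fps Y (of_real ((\<theta> + \<rho>) powr (- \<alpha>))) / of_real \<theta>)"
    and z: "\<forall>\<^sub>F \<theta> in at_top. has_laplace z \<theta> (eval_fps Z (of_real ((\<theta> + \<rho>) powr (- \<alpha>))) / of_real \<theta>)"
    using assms by (auto simp: laplace_expansion_def)
  have "\<forall>\<^sub>F \<theta> in at_top. has_laplace (\<lambda>t. y t + z t) \<theta> (eval_fps (Y + Z) (of_real ((\<theta> + \<rho>) powr (- \<alpha>))) / of_real \<theta>)"
    using y z eventually_eval_fps[OF assms(3) e, of \<rho>]
  proof eventually_elim
    case (elim \<theta>)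
    show ?case using has_laplace_add[OF elim(1,2)] unfolding elim(3) by (simp add: add_divide_distrib)
  qed
  thus ?thesis using e by (simp add: laplace_expansion_def has_fps_expansion_def)
qed

lemma laplace_expansion_cmult:
  assumes "laplace_expansion \<alpha> \<rho> y Y" "\<alpha> > 0"
  shows "laplace_expansion \<alpha> \<rho> (\<lambda>t. c * y t) (fps_const c * Y)"
proof -
  have e: "(\<lambda>x. c * eval_fps Y x) has_fps_expansion (fps_const c * Y)"
    using assms by (intro fps_expansion_intros eval_fps_has_fps_expansion) (auto simp: laplace_expansion_def)
  have y: "\<forall>\<^sub>F \<theta> in at_top. has_laplace y \<theta> (eval_fps Y (of_real ((\<theta> + \<rho>) powr (- \<alpha>))) / of_real \<theta>)"
    using assms by (auto simp: laplace_expansion_def)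
  have "\<forall>\<^sub>F \<theta> in at_top. has_laplace (\<lambda>t. c * y t) \<theta> (eval_fps (fps_const c * Y) (of_real ((\<theta> + \<rho>) powr (- \<alpha>))) / of_real \<theta>)"
    using y eventually_eval_fps[OF assms(2) e, of \<rho>]
  proof eventually_elim
    case (elim \<theta>)
    show ?case using has_laplace_mult_left[OF elim(1), of c] unfolding elim(2) by simp
  qed
  thus ?thesis using e by (simp add: laplace_expansion_def has_fps_expansion_def)
qed

lemma laplace_expansion_zero: "laplace_expansion \<alpha> \<rho> (\<lambda>_. 0) 0"
  by (simp add: laplace_expansion_def has_laplace_zero)

lemma laplace_expansion_sum:
  assumes "\<And>i. i \<in> I \<Longrightarrow> laplace_expansion \<alpha> \<rho> (y i) (Y i)" "\<alpha> > 0"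
  shows "laplace_expansion \<alpha> \<rho> (\<lambda>t. \<Sum>i\<in>I. y i t) (\<Sum>i\<in>I. Y i)"
  using assms by (induction I rule: infinite_finite_induct) (auto intro: laplace_expansion_zero laplace_expansion_add)

text \<open>
  Dividing by \<open>f + c\<close> stays within the class: multiplied by \<open>x^2\<close>, the factor \<open>f + c\<close> becomes the power
  series \<open>1 + x - c' x^2 + c x^2\<close> with constant term \<open>1\<close>, which is invertible.
\<close>
lemma laplace_expansion_resolvent:
  fixes y s :: "real \<Rightarrow> 'b::{euclidean_space, real_normed_field}"
  assumes \<alpha>: "\<alpha> > 0" and \<rho>: "\<rho> > 0" and s: "laplace_expansion \<alpha> \<rho> s S"
    and y: "\<And>\<theta>. \<theta> > 0 \<Longrightarrow> has_laplace y \<theta> (yh \<theta>)" and sh: "\<And>\<theta>. \<theta> > 0 \<Longrightarrow> has_laplace s \<theta> (sh \<theta>)"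
    and nz: "\<And>x. x > 0 \<Longrightarrow> of_real x + c \<noteq> 0"
    and eq: "\<And>\<theta>. \<theta> > 0 \<Longrightarrow> (of_real (tempered_exponent (2 * \<alpha>) \<rho> \<theta> + tempered_exponent \<alpha> \<rho> \<theta>) + c) * yh \<theta>
      = y0 * of_real (tempered_exponent (2 * \<alpha>) \<rho> \<theta> + tempered_exponent \<alpha> \<rho> \<theta>) / of_real \<theta> + sh \<theta>"
  shows "\<exists>Y. laplace_expansion \<alpha> \<rho> y Y"
proof -
  define f where "f \<theta> = tempered_exponent (2 * \<alpha>) \<rho> \<theta> + tempered_exponent \<alpha> \<rho> \<theta>" for \<theta>
  define e where "e x = 1 + x - of_real (\<rho> powr (2 * \<alpha>) + \<rho> powr \<alpha>) * x ^ 2" for x :: 'b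
  define Y where "Y = (fps_const y0 * exponent_fps \<alpha> \<rho> + fps_X ^ 2 * S) * inverse (exponent_fps \<alpha> \<rho> + fps_const c * fps_X ^ 2)"
  have ee: "e has_fps_expansion exponent_fps \<alpha> \<rho>"
    unfolding e_def by (rule exponent_fps_expansion)
  have Y: "(\<lambda>x. (y0 * e x + x ^ 2 * eval_fps S x) * inverse (e x + c * x ^ 2)) has_fps_expansion Y"
    unfolding Y_def using s
    by (intro fps_expansion_intros ee eval_fps_has_fps_expansion)
       (auto simp: exponent_fps_nth_0 laplace_expansion_def)
  have fpos: "\<forall>\<^sub>F \<theta> in at_top. f \<theta> > 0"
    using filterlim_exponent_at_top[OF \<alpha>, of \<rho>] unfolding f_def filterlim_at_top_dense by blast
  have S: "\<forall>\<^sub>F \<theta> in at_top. has_laplace s \<theta> (eval_fps S (of_real ((\<theta> + \<rho>) powr (- \<alpha>))) / of_real \<theta>)"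
    using s by (simp add: laplace_expansion_def)
  have "\<forall>\<^sub>F \<theta> in at_top. has_laplace y \<theta> (eval_fps Y (of_real ((\<theta> + \<rho>) powr (- \<alpha>))) / of_real \<theta>)"
    using S fpos eventually_eval_fps[OF \<alpha> Y, of \<rho>] eventually_gt_at_top[of 0]
  proof eventually_elim
    case (elim \<theta>)
    define x where "x = (\<theta> + \<rho>) powr (- \<alpha>)"
    define z where "z = (of_real x :: 'b)"
    have x: "x > 0" using elim(4) \<rho> by (simp add: x_def)
    have ex: "e z = of_real (f \<theta>) * z ^ 2"
    proof -
      have "of_real (f \<theta> * x ^ 2) = (of_real (1 + x - (\<rho> powr (2 * \<alpha>) + \<rho> powr \<alpha>) * x ^ 2) :: 'b)"
        using exponent_factorization[of \<theta> \<rho> x \<alpha>] elim(4) \<rho> by (simp only: f_def x_def)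
      thus ?thesis by (simp add: e_def z_def)
    qed
    have z: "z \<noteq> 0" using x by (simp add: z_def)
    have "sh \<theta> = eval_fps S z / of_real \<theta>"
      using elim(1) sh[OF elim(4)] unfolding has_laplace_def z_def x_def by simp
    hence E1: "(of_real (f \<theta>) + c) * yh \<theta> = (y0 * of_real (f \<theta>) + eval_fps S z) / of_real \<theta>"
      using eq[OF elim(4)] by (simp add: f_def add_divide_distrib)
    have "eval_fps Y z = (y0 * e z + z ^ 2 * eval_fps S z) * inverse (e z + c * z ^ 2)"
      using elim(3) by (simp add: z_def x_def)
    also have "\<dots> = (z ^ 2 * (y0 * of_real (f \<theta>) + eval_fps S z)) / (z ^ 2 * (of_real (f \<theta>) + c))"
      unfolding ex divide_inverse by (simp add: algebra_simps)
    also have "\<dots> = (y0 * of_real (f \<theta>) + eval_fps S z) / (of_real (f \<theta>) + c)" using z by simp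
    finally have "eval_fps Y z = (y0 * of_real (f \<theta>) + eval_fps S z) / (of_real (f \<theta>) + c)" .
    moreover have "yh \<theta> = (y0 * of_real (f \<theta>) + eval_fps S z) / of_real \<theta> / (of_real (f \<theta>) + c)"
      unfolding E1[symmetric] using nz[OF elim(2)] by simp
    ultimately have "eval_fps Y z / of_real \<theta> = yh \<theta>" by (simp add: mult.commute)
    thus ?case using y[OF elim(4)] by (simp add: z_def x_def)
  qed
  hence "laplace_expansion \<alpha> \<rho> y Y" using Y by (simp add: laplace_expansion_def has_fps_expansion_def)
  thus ?thesis ..
qed

lemma left_continuous_measurable:
  fixes v :: "real \<Rightarrow> real"
  assumes "\<And>t. t > 0 \<Longrightarrow> continuous (at_left t) v"
  shows "(\<lambda>t. indicator {0<..} t * v t) \<in> borel_measurable borel"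
proof (rule borel_measurable_LIMSEQ_real)
  show "(\<lambda>t. indicator {0<..} t * v (- grid_above m (- t))) \<in> borel_measurable borel" for m
  proof (rule borel_measurable_times)
    show "(\<lambda>t. v (- grid_above m (- t))) \<in> borel_measurable borel" unfolding grid_above_def
      by (rule measurable_compose[of "\<lambda>t. \<lfloor>real (Suc m) * - t\<rfloor>" borel "count_space UNIV"
          "\<lambda>n. v (- ((real_of_int n + 1) / real (Suc m)))"]) auto
  qed auto
  fix t :: real
  show "(\<lambda>m. indicator {0<..} t * v (- grid_above m (- t))) \<longlonglongrightarrow> indicator {0<..} t * v t"
  proof (cases "t > 0")
    case True
    have "filterlim uminus (at_left t) (at_right (- t))"
      by (simp add: at_left_minus filterlim_def)
    hence "filterlim (\<lambda>m. - grid_above m (- t)) (at_left t) sequentially"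
      by (rule filterlim_compose[OF _ filterlim_grid_above])
    hence "(\<lambda>m. v (- grid_above m (- t))) \<longlonglongrightarrow> v t"
      using assms[OF True] unfolding continuous_within by (rule filterlim_compose[rotated])
    thus ?thesis by (intro tendsto_intros)
  qed simp
qed

lemma tempered_stable_subordinator_properties:
  assumes "prob_space P" and X: "tempered_stable_subordinator P \<beta> \<rho> X"
  shows "\<And>t. t \<ge> 0 \<Longrightarrow> X t \<in> borel_measurable P"
    and "\<And>\<omega> s t. \<omega> \<in> space P \<Longrightarrow> 0 \<le> s \<Longrightarrow> s \<le> t \<Longrightarrow> X s \<omega> \<le> X t \<omega>"
    and "\<And>\<omega> t. \<omega> \<in> space P \<Longrightarrow> t \<ge> 0 \<Longrightarrow> continuous (at_right t) (\<lambda>s. X s \<omega>)"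
    and "AE \<omega> in P. X 0 \<omega> = 0"
    and "\<And>s \<theta>. s \<ge> 0 \<Longrightarrow> \<theta> > 0 \<Longrightarrow> \<rho> > 0 \<Longrightarrow>
      prob_space.expectation P (\<lambda>\<omega>. exp (- \<theta> * X s \<omega>)) = exp (- s * tempered_exponent \<beta> \<rho> \<theta>)"
proof -
  interpret prob_space P by fact
  have "(\<forall>t\<ge>0. X t \<in> borel_measurable P) \<and>
     (\<forall>\<omega>\<in>space P. mono_on {0..} (\<lambda>t. X t \<omega>)) \<and>
     (\<forall>\<omega>\<in>space P. \<forall>t\<ge>0. continuous (at_right t) (\<lambda>s. X s \<omega>)) \<and>
     (AE \<omega> in P. X 0 \<omega> = 0) \<and>
     (\<forall>s\<ge>0. \<forall>\<theta>>0. \<rho> > 0 \<longrightarrow> expectation (\<lambda>\<omega>. exp (- \<theta> * X s \<omega>)) = exp (- s * tempered_exponent \<beta> \<rho> \<theta>))"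
  proof (cases "\<beta> = 1")
    case True
    hence eq: "X t \<omega> = t" if "t \<ge> 0" "\<omega> \<in> space P" for t \<omega>
      using X that by (simp add: tempered_stable_subordinator_def)
    have "X t \<in> borel_measurable P" if "t \<ge> 0" for t
      using that by (subst measurable_cong[of _ _ "\<lambda>_. t"]) (auto simp: eq)
    moreover have "continuous (at_right t) (\<lambda>s. X s \<omega>)" if w: "\<omega> \<in> space P" and t: "t \<ge> 0" for \<omega> t
    proof -
      have "\<forall>\<^sub>F s in at_right t. s = X s \<omega>"
        using eventually_at_right_less[of t] by eventually_elim (use eq w t in auto)
      hence "((\<lambda>s. X s \<omega>) \<longlongrightarrow> t) (at_right t)" by (rule Lim_transform_eventually[OF tendsto_ident_at])
      thus ?thesis using eq[OF t w] by (simp add: continuous_within)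
    qed
    moreover have "expectation (\<lambda>\<omega>. exp (- \<theta> * X s \<omega>)) = exp (- s * tempered_exponent \<beta> \<rho> \<theta>)"
      if "s \<ge> 0" "\<theta> > 0" "\<rho> > 0" for s \<theta>
    proof -
      have "expectation (\<lambda>\<omega>. exp (- \<theta> * X s \<omega>)) = expectation (\<lambda>\<omega>. exp (- \<theta> * s))"
        using that by (intro Bochner_Integration.integral_cong) (auto simp: eq)
      thus ?thesis using that True by (simp add: prob_space tempered_exponent_def mult.commute)
    qed
    ultimately show ?thesis using eq by (auto simp: mono_on_def intro!: AE_I2)
  next
    case False
    thus ?thesis using X by (auto simp: tempered_stable_subordinator_def increasing_levy_process_def tempered_exponent_def)
  qed
  thus "\<And>t. t \<ge> 0 \<Longrightarrow> X t \<in> borel_measurable P"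
    "\<And>\<omega> s t. \<omega> \<in> space P \<Longrightarrow> 0 \<le> s \<Longrightarrow> s \<le> t \<Longrightarrow> X s \<omega> \<le> X t \<omega>"
    "\<And>\<omega> t. \<omega> \<in> space P \<Longrightarrow> t \<ge> 0 \<Longrightarrow> continuous (at_right t) (\<lambda>s. X s \<omega>)"
    "AE \<omega> in P. X 0 \<omega> = 0"
    "\<And>s \<theta>. s \<ge> 0 \<Longrightarrow> \<theta> > 0 \<Longrightarrow> \<rho> > 0 \<Longrightarrow> expectation (\<lambda>\<omega>. exp (- \<theta> * X s \<omega>)) = exp (- s * tempered_exponent \<beta> \<rho> \<theta>)"
    by (auto simp: mono_on_def)
qed

text \<open>
  By independence the exponents add.
\<close>
lemma inverse_subordinator_tempered_sum:
  assumes P: "prob_space P" and \<alpha>: "0 < \<alpha>" and \<rho>: "0 < \<rho>"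
    and H1: "tempered_stable_subordinator P (2 * \<alpha>) \<rho> H1" and H2: "tempered_stable_subordinator P \<alpha> \<rho> H2"
    and ind: "independent_processes P H1 H2"
    and L: "\<And>t. t \<ge> 0 \<Longrightarrow> first_passage (\<lambda>s \<omega>. H1 s \<omega> + H2 s \<omega>) t \<in> borel_measurable P"
  shows "inverse_subordinator P (\<lambda>s \<omega>. H1 s \<omega> + H2 s \<omega>)
    (\<lambda>\<theta>. tempered_exponent (2 * \<alpha>) \<rho> \<theta> + tempered_exponent \<alpha> \<rho> \<theta>)"
proof -
  interpret prob_space P by fact
  note h1 = tempered_stable_subordinator_properties[OF P H1]
  note h2 = tempered_stable_subordinator_properties[OF P H2]
  show ?thesis
  proof unfold_locales
    fix s \<theta> :: real assume s: "s \<ge> 0" and \<theta>: "\<theta> > 0"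
    have int: "integrable P (\<lambda>\<omega>. exp (- \<theta> * X s \<omega>))"
      if "X s \<in> borel_measurable P" "AE \<omega> in P. X 0 \<omega> = 0" "\<And>\<omega>. \<omega> \<in> space P \<Longrightarrow> X 0 \<omega> \<le> X s \<omega>" for X
    proof (rule integrable_const_bound[of _ 1])
      show "AE \<omega> in P. norm (exp (- \<theta> * X s \<omega>)) \<le> 1" using that(2) AE_space
      proof eventually_elim
        case (elim \<omega>)
        thus ?case using that(3)[of \<omega>] \<theta> by simp
      qed
    qed (use that in auto)
    have m: "(\<lambda>x. exp (- \<theta> * x s)) \<in> borel_measurable (PiM {0..} (\<lambda>_. borel))"
      by (rule measurable_compose[OF measurable_component_singleton]) (use s in auto)
    have "indep_var borel ((\<lambda>x. exp (- \<theta> * x s)) \<circ> (\<lambda>\<omega>. \<lambda>t\<in>{0..}. H1 t \<omega>)) borel ((\<lambda>x. exp (- \<theta> * x s)) \<circ> (\<lambda>\<omega>. \<lambda>t\<in>{0..}. H2 t \<omega>))"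
      using ind unfolding independent_processes_def by (rule indep_var_compose[OF _ m m])
    hence i: "indep_var borel (\<lambda>\<omega>. exp (- \<theta> * H1 s \<omega>)) borel (\<lambda>\<omega>. exp (- \<theta> * H2 s \<omega>))"
      using s by (simp add: o_def)
    have "expectation (\<lambda>\<omega>. exp (- \<theta> * (H1 s \<omega> + H2 s \<omega>))) = expectation (\<lambda>\<omega>. exp (- \<theta> * H1 s \<omega>) * exp (- \<theta> * H2 s \<omega>))"
      by (simp add: exp_add[symmetric] algebra_simps)
    also have "\<dots> = expectation (\<lambda>\<omega>. exp (- \<theta> * H1 s \<omega>)) * expectation (\<lambda>\<omega>. exp (- \<theta> * H2 s \<omega>))"
      by (rule indep_var_lebesgue_integral[OF i int[of H1] int[of H2]]) (use h1 h2 s in auto)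
    also have "\<dots> = exp (- s * (tempered_exponent (2 * \<alpha>) \<rho> \<theta> + tempered_exponent \<alpha> \<rho> \<theta>))"
      using h1(5)[OF s \<theta> \<rho>] h2(5)[OF s \<theta> \<rho>] by (simp add: exp_add[symmetric] algebra_simps)
    finally show "expectation (\<lambda>\<omega>. exp (- \<theta> * (H1 s \<omega> + H2 s \<omega>))) = \<dots>" .
  next
    fix \<theta> :: real assume \<theta>: "\<theta> > 0"
    have "tempered_exponent \<beta> \<rho> \<theta> > 0" if "\<beta> > 0" for \<beta>
      using that \<theta> \<rho> unfolding tempered_exponent_def by (simp add: powr_less_mono2)
    thus "tempered_exponent (2 * \<alpha>) \<rho> \<theta> + tempered_exponent \<alpha> \<rho> \<theta> > 0" using \<alpha> by (intro add_pos_pos) auto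
  next
    show "AE \<omega> in P. H1 0 \<omega> + H2 0 \<omega> = 0" using h1(4) h2(4) by eventually_elim simp
  qed (use h1 h2 L in \<open>auto intro!: add_mono continuous_intros\<close>)
qed

locale time_changed_counting =
  generalized_counting P k lam M +
  inverse_subordinator P H "\<lambda>\<theta>. tempered_exponent (2 * \<alpha>) \<rho> \<theta> + tempered_exponent \<alpha> \<rho> \<theta>"
  for P :: "'a measure" and k lam M H and \<alpha> \<rho> :: real +
  assumes \<alpha>: "0 < \<alpha>" "\<alpha> \<le> 1/2" and \<rho>: "0 < \<rho>"
    and M_L_independent: "independent_processes P (\<lambda>t \<omega>. real (M t \<omega>)) (first_passage H)"
begin

definition exponent :: "real \<Rightarrow> real" where
  "exponent \<theta> = tempered_exponent (2 * \<alpha>) \<rho> \<theta> + tempered_exponent \<alpha> \<rho> \<theta>"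

lemma exponent_pos: "\<theta> > 0 \<Longrightarrow> exponent \<theta> > 0" using f_pos by (simp add: exponent_def)

abbreviation "p \<equiv> time_changed_prob P M L"
abbreviation "G \<equiv> time_changed_pgf P M L"

definition \<Lambda> :: real where "\<Lambda> = (\<Sum>j=1..k. lam j)"

lemma \<Lambda>_nonneg: "\<Lambda> \<ge> 0" unfolding \<Lambda>_def using lam by (intro sum_nonneg) (auto intro: less_imp_le)

lemma M_L_measurable: "t \<ge> 0 \<Longrightarrow> (\<lambda>\<omega>. M (L t \<omega>) \<omega>) \<in> measurable P (count_space UNIV)"
  using subordinate_measurable[OF M_L_independent L_nonneg] by blast

lemma M_L_expectation:
  fixes \<phi> :: "nat \<Rightarrow> complex"
  shows "t \<ge> 0 \<Longrightarrow> (\<And>n. norm (\<phi> n) \<le> B) \<Longrightarrow> expectation (\<lambda>\<omega>. \<phi> (M (L t \<omega>) \<omega>)) = expectation (\<lambda>\<omega>. mean_at \<phi> (L t \<omega>))"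
  using subordinate_expectation[OF M_L_independent L_nonneg] by blast

lemma M_L_left_continuous:
  fixes \<phi> :: "nat \<Rightarrow> complex"
  assumes \<phi>: "\<And>n. norm (\<phi> n) \<le> B" and t: "t > 0"
  shows "continuous (at_left t) (\<lambda>t. expectation (\<lambda>\<omega>. \<phi> (M (L t \<omega>) \<omega>)))"
proof -
  have eq: "expectation (\<lambda>\<omega>. \<phi> (M (L r \<omega>) \<omega>)) = expectation (\<lambda>\<omega>. mean_at \<phi> (L r \<omega>))" if "r \<ge> 0" for r
    by (rule M_L_expectation[OF that \<phi>])
  have "continuous (at_left t) (\<lambda>t. expectation (\<lambda>\<omega>. mean_at \<phi> (L t \<omega>)))"
    by (rule expectation_left_continuous[OF continuous_on_mean_at[OF \<phi>] mean_at_bound[OF \<phi>] t]) auto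
  moreover have "\<forall>\<^sub>F r in at_left t. 0 < r" using t by (auto intro!: eventually_at_leftI[of 0])
  hence "\<forall>\<^sub>F r in at_left t. expectation (\<lambda>\<omega>. mean_at \<phi> (L r \<omega>)) = expectation (\<lambda>\<omega>. \<phi> (M (L r \<omega>) \<omega>))"
    by eventually_elim (simp add: eq)
  ultimately show ?thesis unfolding continuous_within
    using t by (simp add: eq Lim_transform_eventually)
qed

lemma p_eq: "t \<ge> 0 \<Longrightarrow> of_real (p n t) = expectation (\<lambda>\<omega>. (if M (L t \<omega>) \<omega> = n then 1 else 0 :: complex))"
proof -
  assume t: "t \<ge> 0"
  note [measurable] = M_L_measurable[OF t]
  have ev: "{\<omega> \<in> space P. M (L t \<omega>) \<omega> = n} \<in> events" by measurable
  have "expectation (\<lambda>\<omega>. (if M (L t \<omega>) \<omega> = n then 1 else 0 :: complex)) =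
      expectation (\<lambda>\<omega>. of_real (indicator {\<omega> \<in> space P. M (L t \<omega>) \<omega> = n} \<omega>))"
    by (rule Bochner_Integration.integral_cong) (auto simp: indicator_def)
  also have "\<dots> = of_real (p n t)" using ev by (simp add: integral_complex_of_real time_changed_prob_def)
  finally show ?thesis ..
qed

lemma p_bounds: "0 \<le> p n t" "p n t \<le> 1" by (auto simp: time_changed_prob_def)

lemma p_left_continuous:
  assumes t: "t > 0"
  shows "continuous (at_left t) (p n)"
proof -
  have "continuous (at_left t) (\<lambda>t. expectation (\<lambda>\<omega>. (if M (L t \<omega>) \<omega> = n then 1 else 0 :: complex)))"
    by (rule M_L_left_continuous[of "\<lambda>m. if m = n then 1 else 0" 1, OF _ t]) auto
  hence "continuous (at_left t) (\<lambda>t. Re (expectation (\<lambda>\<omega>. (if M (L t \<omega>) \<omega> = n then 1 else 0 :: complex))))"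
    unfolding continuous_within by (rule tendsto_Re)
  moreover have "\<forall>\<^sub>F r in at_left t. 0 < r" using t by (auto intro!: eventually_at_leftI[of 0])
  hence "\<forall>\<^sub>F r in at_left t. Re (expectation (\<lambda>\<omega>. (if M (L r \<omega>) \<omega> = n then 1 else 0 :: complex))) = p n r"
    by eventually_elim (simp flip: p_eq)
  ultimately show ?thesis unfolding continuous_within
    using t by (simp add: Lim_transform_eventually flip: p_eq)
qed

definition p_laplace :: "nat \<Rightarrow> real \<Rightarrow> real" where
  "p_laplace n \<theta> = (LBINT t:{0<..}. exp (- \<theta> * t) *\<^sub>R p n t)"

lemma has_laplace_p:
  assumes "\<theta> > 0"
  shows "has_laplace (p n) \<theta> (p_laplace n \<theta>)"
proof -
  have "has_laplace (\<lambda>t. indicator {0<..} t * p n t) \<theta> (LBINT t:{0<..}. exp (- \<theta> * t) *\<^sub>R (indicator {0<..} t * p n t))"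
    by (rule has_laplace_bounded[of _ 1, OF left_continuous_measurable[OF p_left_continuous] _ assms])
       (use p_bounds in \<open>auto simp: indicator_def\<close>)
  moreover have "(LBINT t:{0<..}. exp (- \<theta> * t) *\<^sub>R (indicator {0<..} t * p n t)) = p_laplace n \<theta>"
    unfolding p_laplace_def by (rule set_lebesgue_integral_cong) auto
  ultimately show ?thesis by (subst has_laplace_cong[of _ "\<lambda>t. indicator {0<..} t * p n t"]) auto
qed

lemma pgf_sums:
  fixes u :: complex
  assumes u: "norm u \<le> 1" and t: "t \<ge> 0"
  shows "(\<lambda>n. u ^ n * of_real (p n t)) sums expectation (\<lambda>\<omega>. u ^ M (L t \<omega>) \<omega>)"
proof -
  note [measurable] = M_L_measurable[OF t]
  define N where "N \<omega> = M (L t \<omega>) \<omega>" for \<omega>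
  have N[measurable]: "N \<in> measurable P (count_space UNIV)" using M_L_measurable[OF t] by (simp add: N_def[abs_def])
  have un: "norm (u ^ n) \<le> 1" for n using u by (simp add: norm_power power_le_one)
  define h where "h n \<omega> = (if N \<omega> = n then u ^ n else 0)" for n \<omega>
  have ev: "{\<omega> \<in> space P. N \<omega> = n} \<in> events" for n by measurable
  have h1: "h n \<omega> = u ^ n * (if N \<omega> = n then 1 else 0)" for n \<omega> by (simp add: h_def)
  have hint: "integrable P (h n)" for n
    unfolding h_def by (rule integrable_of_M[of "\<lambda>m. if m = n then u ^ n else 0" 1]) (use un in auto)
  have hval: "expectation (h n) = u ^ n * of_real (p n t)" for n
    unfolding h1 integral_mult_right_zero p_eq[OF t] N_def ..
  have hnorm: "expectation (\<lambda>\<omega>. norm (h n \<omega>)) = norm (u ^ n) * p n t" for n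
  proof -
    have "expectation (\<lambda>\<omega>. norm (h n \<omega>)) = expectation (\<lambda>\<omega>. norm (u ^ n) * indicator {\<omega> \<in> space P. N \<omega> = n} \<omega>)"
      by (rule Bochner_Integration.integral_cong) (auto simp: h_def indicator_def)
    thus ?thesis using ev[of n] by (simp add: time_changed_prob_def N_def)
  qed
  have "(\<lambda>n. p n t) sums prob (\<Union>n. {\<omega> \<in> space P. N \<omega> = n})"
    unfolding time_changed_prob_def N_def[symmetric]
    by (rule finite_measure_UNION) (use ev in \<open>auto simp: disjoint_family_on_def\<close>)
  hence sp: "summable (\<lambda>n. p n t)" by (rule sums_summable)
  have "summable (\<lambda>n. expectation (\<lambda>\<omega>. norm (h n \<omega>)))"
    unfolding hnorm
    by (rule summable_comparison_test'[OF sp]) (use un p_bounds in \<open>auto intro!: mult_left_le_one_le\<close>)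
  moreover have "summable (\<lambda>n. norm (h n \<omega>))" for \<omega>
    by (rule summable_finite[of "{N \<omega>}"]) (auto simp: h_def)
  ultimately have "(\<lambda>n. expectation (h n)) sums expectation (\<lambda>\<omega>. \<Sum>n. h n \<omega>)"
    by (intro sums_integral hint AE_I2)
  moreover have "(\<Sum>n. h n \<omega>) = u ^ N \<omega>" for \<omega>
    using suminf_finite[of "{N \<omega>}" "\<lambda>n. h n \<omega>"] by (auto simp: h_def)
  ultimately show ?thesis unfolding hval N_def by simp
qed

lemma G_eq:
  assumes u: "norm u \<le> 1" and t: "t \<ge> 0"
  shows "G u t = expectation (\<lambda>\<omega>. exp (- (rate u * of_real (L t \<omega>))))"
proof -
  have un: "norm (u ^ n) \<le> 1" for n using u by (simp add: norm_power power_le_one)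
  have "G u t = expectation (\<lambda>\<omega>. u ^ M (L t \<omega>) \<omega>)"
    unfolding time_changed_pgf_def using pgf_sums[OF assms] by (rule sums_unique[symmetric])
  also have "\<dots> = expectation (\<lambda>\<omega>. mean_at (\<lambda>n. u ^ n) (L t \<omega>))"
    by (rule M_L_expectation[OF t un])
  also have "\<dots> = expectation (\<lambda>\<omega>. exp (- (rate u * of_real (L t \<omega>))))"
    using pgf_eq[OF u L_nonneg] by (simp add: mean_at_def)
  finally show ?thesis .
qed

lemma G_left_continuous:
  assumes u: "norm u \<le> 1" and t: "t > 0"
  shows "continuous (at_left t) (G u)"
proof -
  have un: "norm (u ^ n) \<le> 1" for n using u by (simp add: norm_power power_le_one)
  have *: "G u t = expectation (\<lambda>\<omega>. u ^ M (L t \<omega>) \<omega>)" if "t \<ge> 0" for t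
    unfolding time_changed_pgf_def using pgf_sums[OF u that] by (rule sums_unique[symmetric])
  have "continuous (at_left t) (\<lambda>t. expectation (\<lambda>\<omega>. u ^ M (L t \<omega>) \<omega>))"
    by (rule M_L_left_continuous[OF un t])
  moreover have "\<forall>\<^sub>F r in at_left t. 0 < r" using t by (auto intro!: eventually_at_leftI[of 0])
  hence "\<forall>\<^sub>F r in at_left t. expectation (\<lambda>\<omega>. u ^ M (L r \<omega>) \<omega>) = G u r"
    by eventually_elim (simp add: *)
  ultimately show ?thesis unfolding continuous_within
    using t by (simp add: * Lim_transform_eventually)
qed

lemma has_laplace_G:
  assumes u: "norm u \<le> 1" and \<theta>: "\<theta> > 0"
  shows "has_laplace (G u) \<theta> (of_real (exponent \<theta>) / (of_real \<theta> * (of_real (exponent \<theta>) + rate u)))"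
  by (rule has_laplace_cong[THEN iffD1, OF _ refl has_laplace_expectation_exp_L[OF Re_rate_nonneg[OF u] \<theta>, folded exponent_def]])
     (simp add: G_eq[OF u])

text \<open>
  The transforms of the probabilities are the coefficients of the transform of the generating
  function, viewed as a power series in \<open>u\<close>.
\<close>
lemma p_laplace_sums:
  assumes u: "norm u < 1" and \<theta>: "\<theta> > 0"
  shows "(\<lambda>n. u ^ n * of_real (p_laplace n \<theta>)) sums (of_real (exponent \<theta>) / (of_real \<theta> * (of_real (exponent \<theta>) + rate u)))"
proof -
  define h where "h n t = indicator {0<..} t *\<^sub>R (exp (- \<theta> * t) *\<^sub>R (u ^ n * complex_of_real (p n t)))" for n t
  have lap: "has_laplace (\<lambda>t. u ^ n * complex_of_real (p n t)) \<theta> (u ^ n * of_real (p_laplace n \<theta>))" for n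
    by (intro has_laplace_mult_left has_laplace_bounded_linear[OF bounded_linear_of_real] has_laplace_p[OF \<theta>])
  have hint: "integrable lborel (h n)" and hval: "integral\<^sup>L lborel (h n) = u ^ n * of_real (p_laplace n \<theta>)" for n
    using lap[of n] by (auto simp: has_laplace_def set_integrable_def set_lebesgue_integral_def h_def[abs_def])
  define e where "e t = indicator {0<..} t *\<^sub>R (exp (- \<theta> * t) *\<^sub>R (1::real))" for t
  have e: "integrable lborel e"
    using has_laplace_one[OF \<theta>] by (simp add: has_laplace_def set_integrable_def e_def[abs_def])
  have hn: "norm (h n t) \<le> norm u ^ n * e t" for n t
    using p_bounds[of n t] by (auto simp: h_def e_def norm_mult norm_power indicator_def intro!: mult_left_le)
  have u': "summable (\<lambda>n. norm u ^ n)" using u by (simp add: summable_geometric)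
  have enn: "e t \<ge> 0" for t by (simp add: e_def)
  have s1: "summable (\<lambda>n. norm (h n t))" for t
    by (rule summable_comparison_test'[OF summable_mult2[OF u', of "e t"]]) (use hn in auto)
  have s2: "summable (\<lambda>n. \<integral>t. norm (h n t) \<partial>lborel)"
  proof (rule summable_comparison_test'[OF summable_mult2[OF u', of "integral\<^sup>L lborel e"]])
    fix n
    have "(\<integral>t. norm (h n t) \<partial>lborel) \<le> (\<integral>t. norm u ^ n * e t \<partial>lborel)"
      by (rule integral_mono) (use hint e hn in auto)
    thus "norm (\<integral>t. norm (h n t) \<partial>lborel) \<le> norm u ^ n * integral\<^sup>L lborel e"
      by (simp add: abs_of_nonneg integral_nonneg_AE)
  qed
  have "(\<lambda>n. integral\<^sup>L lborel (h n)) sums (\<integral>t. (\<Sum>n. h n t) \<partial>lborel)"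
    by (rule sums_integral[OF hint AE_I2[OF s1] s2])
  moreover have "(\<Sum>n. h n t) = indicator {0<..} t *\<^sub>R (exp (- \<theta> * t) *\<^sub>R G u t)" for t
  proof (cases "t > 0")
    case True
    have "summable (\<lambda>n. u ^ n * of_real (p n t))" using pgf_sums[of u t] u True by (auto simp: sums_iff)
    from suminf_scaleR_right[OF this, of "indicator {0<..} t * exp (- \<theta> * t)"]
    show ?thesis unfolding h_def time_changed_pgf_def by simp
  qed (simp add: h_def)
  moreover have "(\<integral>t. indicator {0<..} t *\<^sub>R (exp (- \<theta> * t) *\<^sub>R G u t) \<partial>lborel) = of_real (exponent \<theta>) / (of_real \<theta> * (of_real (exponent \<theta>) + rate u))"
    using has_laplace_G[of u \<theta>] u \<theta> by (simp add: has_laplace_def set_lebesgue_integral_def)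
  ultimately show ?thesis unfolding hval by simp
qed

text \<open>
  Multiply the transform of the generating function by \<open>f + \<psi>(u)\<close>, a polynomial in \<open>u\<close>. The product
  is constant, and its coefficients are compared.
\<close>
lemma p_laplace_recurrence:
  assumes \<theta>: "\<theta> > 0"
  shows "(exponent \<theta> + \<Lambda>) * p_laplace n \<theta> = (if n = 0 then 1 else 0) * exponent \<theta> / \<theta> + (\<Sum>j=1..min n k. lam j * p_laplace (n - j) \<theta>)"
proof -
  define A where "A = Abs_fps (\<lambda>n. complex_of_real (p_laplace n \<theta>))"
  define D where "D = fps_const (complex_of_real (exponent \<theta>)) + (\<Sum>j=1..k. fps_const (complex_of_real (lam j)) * (1 - fps_X ^ j))"
  have sumA: "(\<lambda>n. fps_nth A n * u ^ n) sums (of_real (exponent \<theta>) / (of_real \<theta> * (of_real (exponent \<theta>) + rate u)))" if "norm u < 1" for u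
    using p_laplace_sums[OF that \<theta>] by (simp add: A_def mult.commute)
  have "summable (\<lambda>n. fps_nth A n * (1/2) ^ n)" using sumA[of "1/2"] by (auto simp: sums_iff)
  hence "ereal (norm (1/2 :: complex)) \<le> fps_conv_radius A"
    unfolding fps_conv_radius_def by (rule conv_radius_geI)
  hence radA: "fps_conv_radius A > 0" by (rule less_le_trans[rotated]) auto
  have expD: "(\<lambda>u. of_real (exponent \<theta>) + (\<Sum>j=1..k. of_real (lam j) * (1 - u ^ j))) has_fps_expansion D"
    unfolding D_def by (intro fps_expansion_intros)
  have DA: "(\<lambda>u. (of_real (exponent \<theta>) + (\<Sum>j=1..k. of_real (lam j) * (1 - u ^ j))) * eval_fps A u) has_fps_expansion (D * A)"
    by (intro fps_expansion_intros expD eval_fps_has_fps_expansion radA)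
  have "\<forall>\<^sub>F u in nhds 0. u \<in> ball (0::complex) 1" by (rule eventually_nhds_in_open) auto
  hence "\<forall>\<^sub>F u in nhds 0. eval_fps (D * A) u = eval_fps (fps_const (of_real (exponent \<theta> / \<theta>))) u"
    using DA[unfolded has_fps_expansion_def, THEN conjunct2]
  proof eventually_elim
    case (elim u)
    have u: "norm u < 1" using elim(1) by simp
    have nz: "of_real (exponent \<theta>) + rate u \<noteq> 0"
      using exponent_pos[OF \<theta>] Re_rate_nonneg[of u] u by (auto simp: complex_eq_iff)
    have "eval_fps A u = of_real (exponent \<theta>) / (of_real \<theta> * (of_real (exponent \<theta>) + rate u))"
      unfolding eval_fps_def using sumA[OF u] by (rule sums_unique[symmetric])
    thus ?case using elim(2) nz \<theta> unfolding rate_def[symmetric] by simp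
  qed
  hence eq: "D * A = fps_const (of_real (exponent \<theta> / \<theta>))"
    using DA by (intro eval_fps_eqD) (auto simp: has_fps_expansion_def)
  have "fps_nth (D * A) n = of_real (exponent \<theta>) * of_real (p_laplace n \<theta>) +
      (\<Sum>j=1..k. of_real (lam j) * (of_real (p_laplace n \<theta>) - (if n < j then 0 else of_real (p_laplace (n - j) \<theta>))))"
    unfolding D_def by (simp add: distrib_right sum_distrib_right fps_sum_nth mult.assoc left_diff_distrib fps_X_power_mult_nth A_def cong: if_cong)
  also have "\<dots> = complex_of_real (exponent \<theta> * p_laplace n \<theta> + (\<Sum>j=1..k. lam j * (p_laplace n \<theta> - (if n < j then 0 else p_laplace (n - j) \<theta>))))"
    by (auto intro!: sum.cong)
  finally have "fps_nth (D * A) n = complex_of_real (exponent \<theta> * p_laplace n \<theta> + (\<Sum>j=1..k. lam j * (p_laplace n \<theta> - (if n < j then 0 else p_laplace (n - j) \<theta>))))" .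
  moreover have "fps_nth (D * A) n = complex_of_real (if n = 0 then exponent \<theta> / \<theta> else 0)" unfolding eq by simp
  ultimately have "exponent \<theta> * p_laplace n \<theta> + (\<Sum>j=1..k. lam j * (p_laplace n \<theta> - (if n < j then 0 else p_laplace (n - j) \<theta>))) = (if n = 0 then exponent \<theta> / \<theta> else 0)"
    by (simp only: of_real_eq_iff)
  moreover have "(\<Sum>j=1..k. lam j * (p_laplace n \<theta> - (if n < j then 0 else p_laplace (n - j) \<theta>))) =
      \<Lambda> * p_laplace n \<theta> - (\<Sum>j=1..k. lam j * (if n < j then 0 else p_laplace (n - j) \<theta>))"
    by (simp add: \<Lambda>_def right_diff_distrib sum_subtractf sum_distrib_right)
  moreover have "(\<Sum>j=1..k. lam j * (if n < j then 0 else p_laplace (n - j) \<theta>)) = (\<Sum>j=1..min n k. lam j * p_laplace (n - j) \<theta>)"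
    by (rule sum.mono_neutral_cong_right) auto
  ultimately show ?thesis by (cases "n = 0") (auto simp: distrib_right)
qed

text \<open>
  By the recurrence, each transform is a resolvent applied to the preceding ones.
\<close>
lemma p_expansion: "\<exists>Y. laplace_expansion \<alpha> \<rho> (p n) Y"
proof (induction n rule: less_induct)
  case (less n)
  then obtain Y where Y: "\<And>m. m < n \<Longrightarrow> laplace_expansion \<alpha> \<rho> (p m) (Y m)" by metis
  have S: "laplace_expansion \<alpha> \<rho> (\<lambda>t. \<Sum>j=1..min n k. lam j * p (n - j) t) (\<Sum>j=1..min n k. fps_const (lam j) * Y (n - j))"
    by (intro laplace_expansion_sum laplace_expansion_cmult Y \<alpha>) auto
  show ?case
  proof (rule laplace_expansion_resolvent[OF \<alpha>(1) \<rho> S has_laplace_p])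
    show "has_laplace (\<lambda>t. \<Sum>j=1..min n k. lam j * p (n - j) t) \<theta> (\<Sum>j=1..min n k. lam j * p_laplace (n - j) \<theta>)" if "\<theta> > 0" for \<theta>
      by (intro has_laplace_sum has_laplace_mult_left has_laplace_p that)
    show "of_real x + \<Lambda> \<noteq> 0" if "x > 0" for x using that \<Lambda>_nonneg by simp
    show "(of_real (tempered_exponent (2 * \<alpha>) \<rho> \<theta> + tempered_exponent \<alpha> \<rho> \<theta>) + \<Lambda>) * p_laplace n \<theta>
      = (if n = 0 then 1 else 0) * of_real (tempered_exponent (2 * \<alpha>) \<rho> \<theta> + tempered_exponent \<alpha> \<rho> \<theta>) / of_real \<theta>
        + (\<Sum>j=1..min n k. lam j * p_laplace (n - j) \<theta>)" if "\<theta> > 0" for \<theta>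
      using p_laplace_recurrence[OF that, of n] by (simp add: exponent_def)
  qed
qed

text \<open>
  The transfer to the fractional equation, in the form in which the transforms of \<open>y\<close> and \<open>r\<close> are
  known for all \<open>\<theta> > 0\<close>.
\<close>
lemma fractional_equation_from_laplace:
  fixes y r :: "real \<Rightarrow> 'b::{euclidean_space, real_normed_field}"
  assumes "\<And>t. t > 0 \<Longrightarrow> continuous (at_left t) y" "\<And>t. t > 0 \<Longrightarrow> continuous (at_left t) r"
    and R: "laplace_expansion \<alpha> \<rho> r R"
    and y: "\<And>\<theta>. \<theta> > 0 \<Longrightarrow> has_laplace y \<theta> (yh \<theta>)" and r: "\<And>\<theta>. \<theta> > 0 \<Longrightarrow> has_laplace r \<theta> (rh \<theta>)"
    and eq: "\<And>\<theta>. \<theta> > 0 \<Longrightarrow> of_real (exponent \<theta>) * yh \<theta> = init * of_real (exponent \<theta>) / of_real \<theta> + rh \<theta>" and t: "t > 0"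
  shows "tempered_caputo_differentiable (2 * \<alpha>) \<rho> y t \<and> tempered_caputo_differentiable \<alpha> \<rho> y t \<and>
    tempered_caputo (2 * \<alpha>) \<rho> y t + tempered_caputo \<alpha> \<rho> y t = r t"
proof -
  have "\<forall>\<^sub>F \<theta> in at_top. has_laplace r \<theta> (eval_fps R (of_real ((\<theta> + \<rho>) powr (- \<alpha>))) / of_real \<theta>)"
    using R by (simp add: laplace_expansion_def)
  hence "\<forall>\<^sub>F \<theta> in at_top. has_laplace y \<theta> ((init + eval_fps R (of_real ((\<theta> + \<rho>) powr (- \<alpha>))) / of_real (exponent \<theta>)) / of_real \<theta>)"
    using eventually_gt_at_top[of 0]
  proof eventually_elim
    case (elim \<theta>)
    have fz: "(of_real (exponent \<theta>) :: 'b) \<noteq> 0" using exponent_pos[OF elim(2)] by simp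
    have "rh \<theta> = eval_fps R (of_real ((\<theta> + \<rho>) powr (- \<alpha>))) / of_real \<theta>"
      using elim(1) r[OF elim(2)] unfolding has_laplace_def by simp
    hence "(init + eval_fps R (of_real ((\<theta> + \<rho>) powr (- \<alpha>))) / of_real (exponent \<theta>)) / of_real \<theta> = yh \<theta>"
      using eq[OF elim(2)] fz elim(2) by (simp add: field_simps)
    thus ?case using y[OF elim(2)] by simp
  qed
  from tempered_caputo_from_laplace[OF \<alpha> \<rho> assms(1,2) R this[unfolded exponent_def] t] show ?thesis by blast
qed

lemma p_equation:
  assumes t: "t > 0"
  shows "tempered_caputo_differentiable (2 * \<alpha>) \<rho> (p n) t \<and> tempered_caputo_differentiable \<alpha> \<rho> (p n) t \<and>
    tempered_caputo (2 * \<alpha>) \<rho> (p n) t + tempered_caputo \<alpha> \<rho> (p n) t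
      = - \<Lambda> * p n t + (\<Sum>j=1..min n k. lam j * p (n - j) t)"
proof -
  obtain Y where Y: "\<And>m. laplace_expansion \<alpha> \<rho> (p m) (Y m)" using p_expansion by metis
  show ?thesis
  proof (rule fractional_equation_from_laplace[where r = "\<lambda>t. - \<Lambda> * p n t + (\<Sum>j=1..min n k. lam j * p (n - j) t)" and init = "if n = 0 then 1 else 0"])
    show "continuous (at_left t) (p n)" if "t > 0" for t by (rule p_left_continuous[OF that])
    show "continuous (at_left t) (\<lambda>t. - \<Lambda> * p n t + (\<Sum>j=1..min n k. lam j * p (n - j) t))" if "t > 0" for t
      by (intro continuous_intros p_left_continuous that)
    show "laplace_expansion \<alpha> \<rho> (\<lambda>t. - \<Lambda> * p n t + (\<Sum>j=1..min n k. lam j * p (n - j) t))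
        (fps_const (- \<Lambda>) * Y n + (\<Sum>j=1..min n k. fps_const (lam j) * Y (n - j)))"
      by (intro laplace_expansion_add laplace_expansion_sum laplace_expansion_cmult Y \<alpha>)
    show "has_laplace (p n) \<theta> (p_laplace n \<theta>)" if "\<theta> > 0" for \<theta> by (rule has_laplace_p[OF that])
    show "has_laplace (\<lambda>t. - \<Lambda> * p n t + (\<Sum>j=1..min n k. lam j * p (n - j) t)) \<theta>
        (- \<Lambda> * p_laplace n \<theta> + (\<Sum>j=1..min n k. lam j * p_laplace (n - j) \<theta>))" if "\<theta> > 0" for \<theta>
      by (intro has_laplace_add has_laplace_sum has_laplace_mult_left has_laplace_p that)
    show "of_real (exponent \<theta>) * p_laplace n \<theta> = (if n = 0 then 1 else 0) * of_real (exponent \<theta>) / of_real \<theta>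
        + (- \<Lambda> * p_laplace n \<theta> + (\<Sum>j=1..min n k. lam j * p_laplace (n - j) \<theta>))" if "\<theta> > 0" for \<theta>
      using p_laplace_recurrence[OF that, of n] by (simp add: algebra_simps)
  qed (rule t)
qed

lemma G_equation:
  assumes u: "norm u \<le> 1" and t: "t > 0"
  shows "tempered_caputo_differentiable (2 * \<alpha>) \<rho> (G u) t \<and> tempered_caputo_differentiable \<alpha> \<rho> (G u) t \<and>
    tempered_caputo (2 * \<alpha>) \<rho> (G u) t + tempered_caputo \<alpha> \<rho> (G u) t = - rate u * G u t"
proof -
  have nz: "of_real x + rate u \<noteq> 0" if "x > 0" for x :: real
    using that Re_rate_nonneg[OF u] by (auto simp: complex_eq_iff)
  define Gh where "Gh \<theta> = of_real (exponent \<theta>) / (of_real \<theta> * (of_real (exponent \<theta>) + rate u))" for \<theta>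
  have GhL: "has_laplace (G u) \<theta> (Gh \<theta>)" if "\<theta> > 0" for \<theta>
    unfolding Gh_def by (rule has_laplace_G[OF u that])
  have Gh: "(of_real (exponent \<theta>) + rate u) * Gh \<theta> = 1 * of_real (exponent \<theta>) / of_real \<theta>" if "\<theta> > 0" for \<theta>
    using nz[OF exponent_pos[OF that]] that by (simp add: Gh_def)
  have "\<exists>Y. laplace_expansion \<alpha> \<rho> (G u) Y"
  proof (rule laplace_expansion_resolvent[OF \<alpha>(1) \<rho> laplace_expansion_zero GhL has_laplace_zero nz])
    show "(of_real (tempered_exponent (2 * \<alpha>) \<rho> \<theta> + tempered_exponent \<alpha> \<rho> \<theta>) + rate u) * Gh \<theta>
      = 1 * of_real (tempered_exponent (2 * \<alpha>) \<rho> \<theta> + tempered_exponent \<alpha> \<rho> \<theta>) / of_real \<theta> + 0" if "\<theta> > 0" for \<theta>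
      using Gh[OF that] by (simp add: exponent_def)
  qed
  then obtain Y where Y: "laplace_expansion \<alpha> \<rho> (G u) Y" ..
  show ?thesis
  proof (rule fractional_equation_from_laplace[where r = "\<lambda>t. - rate u * G u t" and init = 1])
    show "continuous (at_left t) (G u)" if "t > 0" for t by (rule G_left_continuous[OF u that])
    show "continuous (at_left t) (\<lambda>t. - rate u * G u t)" if "t > 0" for t
      by (intro continuous_intros G_left_continuous[OF u that])
    show "laplace_expansion \<alpha> \<rho> (\<lambda>t. - rate u * G u t) (fps_const (- rate u) * Y)"
      by (intro laplace_expansion_cmult Y \<alpha>)
    show "has_laplace (\<lambda>t. - rate u * G u t) \<theta> (- rate u * Gh \<theta>)" if "\<theta> > 0" for \<theta>
      by (intro has_laplace_mult_left GhL that)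
    show "of_real (exponent \<theta>) * Gh \<theta> = 1 * of_real (exponent \<theta>) / of_real \<theta> + - rate u * Gh \<theta>" if "\<theta> > 0" for \<theta>
      using Gh[OF that] by (simp add: algebra_simps)
  qed (use GhL t in auto)
qed

lemma p_initial: "p n 0 = (if n = 0 then 1 else 0)"
proof -
  have "p n 0 = prob {\<omega> \<in> space P. M 0 \<omega> = n}"
    by (simp add: time_changed_prob_def first_passage_def)
  also have "\<dots> = (if n = 0 then 1 else 0)"
  proof (cases "n = 0")
    case True
    thus ?thesis using M_0 by (simp add: prob_Collect_eq_1)
  next
    case False
    have "AE \<omega> in P. M 0 \<omega> \<noteq> n" using M_0 by eventually_elim (use False in auto)
    thus ?thesis using False by (simp add: prob_Collect_eq_0)
  qed
  finally show ?thesis .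
qed

lemma G_initial: "G u 0 = 1"
proof -
  have "(\<lambda>n. u ^ n * complex_of_real (p n 0)) = (\<lambda>n. if n = 0 then 1 else 0)"
    by (auto simp: p_initial)
  thus ?thesis unfolding time_changed_pgf_def by (simp add: sums_unique[OF sums_single, symmetric])
qed

end

theorem theorem18:
  fixes P :: "'a measure"
    and \<alpha> \<rho> :: real
    and k :: nat
    and lam :: "nat \<Rightarrow> real"
    and M :: "real \<Rightarrow> 'a \<Rightarrow> nat"
    and H1 H2 L :: "real \<Rightarrow> 'a \<Rightarrow> real"
    and p :: "nat \<Rightarrow> real \<Rightarrow> real"
    and G :: "complex \<Rightarrow> real \<Rightarrow> complex"
  assumes "prob_space P"
    and "0 < \<alpha>" and "\<alpha> \<le> 1/2" and "0 < \<rho>" and "1 \<le> k"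
    and "\<And>j. j \<in> {1..k} \<Longrightarrow> 0 < lam j"
    and "generalized_counting_process P k lam M"
    and "tempered_stable_subordinator P (2 * \<alpha>) \<rho> H1"
    and "tempered_stable_subordinator P \<alpha> \<rho> H2"
    and "independent_processes P H1 H2"
    and "L = first_passage (\<lambda>s \<omega>. H1 s \<omega> + H2 s \<omega>)"
    and "independent_processes P (\<lambda>t \<omega>. real (M t \<omega>)) L"
    and "p = time_changed_prob P M L"
    and "G = time_changed_pgf P M L"
  shows "(\<forall>n. \<forall>t>0.
            tempered_caputo_differentiable (2 * \<alpha>) \<rho> (p n) t \<and>
            tempered_caputo_differentiable \<alpha> \<rho> (p n) t \<and>
            tempered_caputo (2 * \<alpha>) \<rho> (p n) t + tempered_caputo \<alpha> \<rho> (p n) t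
              = - (\<Sum>j=1..k. lam j) * p n t + (\<Sum>j=1..min n k. lam j * p (n - j) t)) \<and>
         p 0 0 = 1 \<and> (\<forall>n\<ge>1. p n 0 = 0) \<and>
         (\<forall>u. norm u \<le> 1 \<longrightarrow>
            (\<forall>t>0.
               tempered_caputo_differentiable (2 * \<alpha>) \<rho> (G u) t \<and>
               tempered_caputo_differentiable \<alpha> \<rho> (G u) t \<and>
               tempered_caputo (2 * \<alpha>) \<rho> (G u) t + tempered_caputo \<alpha> \<rho> (G u) t
                 = - (\<Sum>j=1..k. of_real (lam j) * (1 - u ^ j)) * G u t) \<and>
            G u 0 = 1)"
proof -
  interpret prob_space P by fact
  interpret counting: generalized_counting P k lam M
    by unfold_locales (use assms in auto)
  have L_meas: "L t \<in> borel_measurable P" if t: "t \<ge> 0" for t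
  proof -
    have "(\<lambda>\<omega>. \<lambda>t\<in>{0..}. L t \<omega>) \<in> measurable P (PiM {0..} (\<lambda>_. borel))"
      using assms(12) by (auto simp: independent_processes_def indep_var_distribution_eq)
    from measurable_compose[OF this measurable_component_singleton[of t]] show ?thesis using t by simp
  qed
  interpret passage: inverse_subordinator P "\<lambda>s \<omega>. H1 s \<omega> + H2 s \<omega>"
      "\<lambda>\<theta>. tempered_exponent (2 * \<alpha>) \<rho> \<theta> + tempered_exponent \<alpha> \<rho> \<theta>"
    using inverse_subordinator_tempered_sum[OF assms(1,2,4,8,9,10)] L_meas assms(11) by blast
  interpret time_changed_counting P k lam M "\<lambda>s \<omega>. H1 s \<omega> + H2 s \<omega>" \<alpha> \<rho>
    by unfold_locales (use assms in auto)
  show ?thesis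
    unfolding assms(13,14) assms(11)
    using p_equation G_equation p_initial G_initial by (auto simp: \<Lambda>_def counting.rate_def)
qed

end
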